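(* Let $f: M \to M$ be a continuous map on a compact Riemannian manifold $M$. Then there exists a unique nonempty weak$^*$-compact set $\mathcal{K}$ of $f$-invariant probability measures that is globally empirically stochastically stable. Besides, $\mu\in\mathcal{K}$ if and only if $\mu$ is pseudo-physical.
   Context: Setting. $M$ is a compact finite-dimensional Riemannian manifold, with or without boundary; $m$ is the Lebesgue measure on $M$, i.e. the finite Borel measure obtained from the Riemannian volume; $B_\epsilon(x)$ is the open ball of radius $\epsilon$ centered at $x$. For sets $A,B\subset M$, "$A\subset B$ Lebesgue-a.e." means $m(A\setminus B)=0$. $\mathcal{M}$ is the space of Borel probability measures on $M$ with the weak$^*$ topology, and $\mathrm{dist}^*$ is a fixed metric on $\mathcal{M}$ inducing that topology; the distance from a measure to a set, or between two sets, of measures is the infimum of the pairwise distances. $\mathcal{M}_f\subset\mathcal{M}$ is the set of $f$-invariant probability measures. $\mathbb{N}^+=\{1,2,\dots\}$. Noise. For $\epsilon>0$, $x\in M$ and a Borel set $A$, let $p_\epsilon(x,A)=\dfrac{m(A\cap B_\epsilon(f(x)))}{m(B_\epsilon(f(x)))}$. The transfer operator $\mathcal{L}_\epsilon$ on the space $C^0(M,\mathbb{C})$ of continuous functions is $(\mathcal{L}_\epsilon\varphi)(x)=\int\varphi(y)\,p_\epsilon(x,dy)$; the dual operator $\mathcal{L}_\epsilon^*:\mathcal{M}\to\mathcal{M}$ is defined by $\int\varphi\,d(\mathcal{L}^*_\epsilon\mu)=\int(\mathcal{L}_\epsilon\varphi)\,d\mu$ for all $\varphi\in C^0(M,\mathbb{C})$.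 The empiric stochastic probability is $\sigma_{\epsilon,n,x}=\frac1n\sum_{j=1}^n(\mathcal{L}_\epsilon^* )^j\delta_x$, where $\delta_x$ is the Dirac measure at $x$. Empiric stochastic stability of sets. For a nonempty weak$^*$-compact set $\mathcal{K}\subset\mathcal{M}$, its basin of empiric stochastic stability $\widehat A_{\mathcal{K}}$ is the set of $x\in M$ such that for every $\rho>0$ there is $N=N(\rho)$ such that for every $n\ge N$ there is $\epsilon_0=\epsilon_0(\rho,n)>0$ with $\mathrm{dist}^*(\sigma_{\epsilon,n,x},\mathcal{K})<\rho$ for all $0<\epsilon\le\epsilon_0$. A nonempty weak$^*$-compact set $\mathcal{K}\subset\mathcal{M}_f$ is empirically stochastically stable if: (1) there is a measurable set $\widehat A\subset M$ with $m(\widehat A)>0$ such that for every $\rho>0$ and every large enough $n\in\mathbb{N}^+$ (how large may depend on $\rho$) there is $\epsilon_0>0$ (which may depend on $\rho$ and $n$ but not on $x$) with $\mathrm{dist}^*(\sigma_{\epsilon,n,x},\mathcal{K})<\rho$ for all $0<\epsilon\le\epsilon_0$ and all $x\in\widehat A$; and (2) if $\mathcal{K}'\subset\mathcal{M}_f$ is nonempty and weak$^*$-compact and $\widehat A_{\mathcal{K}}\subset\widehat A_{\mathcal{K}'}$ Lebesgue-a.e., then $\mathcal{K}\subset\mathcal{K}'$. It is globally empirically stochastically stable if it is empirically stochastically stable and $\widehat A_{\mathcal{K}}$ has full Lebesgue measure. Pseudo-physical measures. Let $\sigma_{n,x}=\frac1n\sum_{j=1}^n\delta_{f^j(x)}$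 and let $p\omega_x\subset\mathcal{M}$ be the set of all weak$^*$ limits of convergent subsequences $\sigma_{n_i,x}$ with $n_i\to+\infty$. For $\mu\in\mathcal{M}_f$ and $\rho>0$, let $A_\mu^\rho=\{x\in M:\mathrm{dist}^*(p\omega_x,\{\mu\})<\rho\}$. The measure $\mu\in\mathcal{M}_f$ is pseudo-physical if $m(A_\mu^\rho)>0$ for every $\rho>0$. *)

theory Defs
  imports "HOL-Probability.Probability"
begin

section \<open>Compact Riemannian manifolds, possibly with boundary\<close>

text \<open>
  The manifold is a whole type of class \<open>t2_space\<close> and \<open>second_countable_topology\<close>, its dimension is
  \<open>CARD('n)\<close>, and a chart is an open domain together with a coordinate map.
\<close>

type_synonym ('a, 'n) chart = "'a set \<times> ('a \<Rightarrow> real ^ 'n)"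

primrec Ck_on :: "nat \<Rightarrow> ('v::real_normed_vector \<Rightarrow> 'w::real_normed_vector) \<Rightarrow> 'v set \<Rightarrow> bool" where
  "Ck_on 0 F S \<longleftrightarrow> continuous_on S F"
| "Ck_on (Suc k) F S \<longleftrightarrow>
     (\<forall>x\<in>S. F differentiable (at x)) \<and> (\<forall>v. Ck_on k (\<lambda>x. frechet_derivative F (at x) v) S)"

text \<open>
  \<open>Ck_on\<close> is only meant for open sets. On other sets, such as relatively open subsets of a
  half-space, a map is smooth if it extends locally to a smooth map on an open set.
\<close>

definition smooth_on :: "('v::real_normed_vector \<Rightarrow> 'w::real_normed_vector) \<Rightarrow> 'v set \<Rightarrow> bool" where
  "smooth_on F S \<longleftrightarrow>
     (\<forall>x\<in>S. \<exists>W G. open W \<and> x \<in> W \<and> (\<forall>k. Ck_on k G W) \<and> (\<forall>y\<in>W \<inter> S. G y = F y))"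

definition transition :: "('a, 'n::finite) chart \<Rightarrow> ('a, 'n) chart \<Rightarrow> real ^ 'n \<Rightarrow> real ^ 'n" where
  "transition c d = snd d \<circ> inv_into (fst c) (snd c)"

text \<open>
  The image of a chart is relatively open in a closed half-space \<open>{x. 0 \<le> b \<bullet> x}\<close>, whose bounding
  hyperplane carries the boundary points. The choice \<open>b = 0\<close> is allowed and gives the whole
  Euclidean space, i.e. an interior chart.
\<close>

definition smooth_atlas ::
    "('a::{t2_space, second_countable_topology}, 'n::finite) chart set \<Rightarrow> bool" where
  "smooth_atlas \<A> \<longleftrightarrow>
     (\<Union>c\<in>\<A>. fst c) = UNIV \<and>
     (\<forall>(U, \<phi>)\<in>\<A>. open U \<and> (\<exists>\<psi>. homeomorphism U (\<phi> ` U) \<phi> \<psi>) \<and>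
        (\<exists>b. openin (top_of_set {x. 0 \<le> b \<bullet> x}) (\<phi> ` U))) \<and>
     (\<forall>c\<in>\<A>. \<forall>d\<in>\<A>. smooth_on (transition c d) (snd c ` (fst c \<inter> fst d)))"

text \<open>
  A Riemannian metric is given in each chart \<open>c\<close> by its Gram matrix \<open>g c\<close>, a function of the
  coordinates in that chart. The last condition is the transformation law of a covariant 2-tensor,
  where \<open>T\<close> is the (uniquely determined) derivative of the coordinate change.
\<close>

definition riemannian_metric ::
    "('a::{t2_space, second_countable_topology}, 'n::finite) chart set \<Rightarrow>
     (('a, 'n) chart \<Rightarrow> real ^ 'n \<Rightarrow> real ^ 'n ^ 'n) \<Rightarrow> bool" where
  "riemannian_metric \<A> g \<longleftrightarrow>
     (\<forall>c\<in>\<A>. smooth_on (g c) (snd c ` fst c) \<and>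
        (\<forall>x\<in>snd c ` fst c. transpose (g c x) = g c x \<and>
           (\<forall>v. v \<noteq> 0 \<longrightarrow> 0 < v \<bullet> (g c x *v v)))) \<and>
     (\<forall>c\<in>\<A>. \<forall>d\<in>\<A>. \<forall>p\<in>fst c \<inter> fst d. \<forall>T.
        (transition c d has_derivative T) (at (snd c p) within snd c ` (fst c \<inter> fst d)) \<longrightarrow>
        (\<forall>u v. u \<bullet> (g c (snd c p) *v v) = T u \<bullet> (g d (snd d p) *v T v)))"

definition compact_riemannian_manifold ::
    "('a::{t2_space, second_countable_topology}, 'n::finite) chart set \<Rightarrow>
     (('a, 'n) chart \<Rightarrow> real ^ 'n \<Rightarrow> real ^ 'n ^ 'n) \<Rightarrow> bool" where
  "compact_riemannian_manifold \<A> g \<longleftrightarrow>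
     compact (UNIV :: 'a set) \<and> smooth_atlas \<A> \<and> riemannian_metric \<A> g"

text \<open>
  On each chart domain the Riemannian volume has density \<open>sqrt (det g)\<close> with respect to the Lebesgue
  measure of the coordinates. Since countably many charts cover, this determines the measure.
\<close>

definition riemannian_volume ::
    "('a::{t2_space, second_countable_topology}, 'n::finite) chart set \<Rightarrow>
     (('a, 'n) chart \<Rightarrow> real ^ 'n \<Rightarrow> real ^ 'n ^ 'n) \<Rightarrow> 'a measure \<Rightarrow> bool" where
  "riemannian_volume \<A> g m \<longleftrightarrow>
     sets m = sets borel \<and>
     (\<forall>c\<in>\<A>. \<forall>A\<in>sets borel. A \<subseteq> fst c \<longrightarrow>
        emeasure m A = (\<integral>\<^sup>+x\<in>snd c ` A. ennreal (sqrt (det (g c x))) \<partial>lborel))"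

text \<open>
  In \<open>C1_curve_on\<close> the set \<open>D\<close> of parameters mapped into a chart domain is relatively open in
  \<open>{a..b}\<close>, so that derivatives within \<open>D\<close> are one-sided at the end points of \<open>{a..b}\<close> only.
\<close>

definition C1_curve_on ::
    "('a::{t2_space, second_countable_topology}, 'n::finite) chart set \<Rightarrow>
     (real \<Rightarrow> 'a) \<Rightarrow> real \<Rightarrow> real \<Rightarrow> bool" where
  "C1_curve_on \<A> \<gamma> a b \<longleftrightarrow>
     (\<forall>(U, \<phi>)\<in>\<A>. let D = {t\<in>{a..b}. \<gamma> t \<in> U} in
        \<exists>w. continuous_on D w \<and>
          (\<forall>t\<in>D. ((\<phi> \<circ> \<gamma>) has_vector_derivative w t) (at t within D)))"

definition piecewise_C1_curve ::
    "('a::{t2_space, second_countable_topology}, 'n::finite) chart set \<Rightarrow> (real \<Rightarrow> 'a) \<Rightarrow> bool" where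
  "piecewise_C1_curve \<A> \<gamma> \<longleftrightarrow>
     path \<gamma> \<and>
     (\<exists>S. finite S \<and>
        (\<forall>a b. 0 \<le> a \<and> a < b \<and> b \<le> 1 \<and> {a<..<b} \<inter> S = {} \<longrightarrow> C1_curve_on \<A> \<gamma> a b))"

text \<open>
  The speed does not depend on the selected chart, by the transformation law of the metric. Its value
  at the finitely many break points and at the end points is immaterial for the length.
\<close>

definition speed ::
    "('a::{t2_space, second_countable_topology}, 'n::finite) chart set \<Rightarrow>
     (('a, 'n) chart \<Rightarrow> real ^ 'n \<Rightarrow> real ^ 'n ^ 'n) \<Rightarrow> (real \<Rightarrow> 'a) \<Rightarrow> real \<Rightarrow> real" where
  "speed \<A> g \<gamma> t =
     (let c = (SOME c. c \<in> \<A> \<and> \<gamma> t \<in> fst c);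
          v = vector_derivative (snd c \<circ> \<gamma>) (at t)
      in sqrt (v \<bullet> (g c (snd c (\<gamma> t)) *v v)))"

definition curve_length ::
    "('a::{t2_space, second_countable_topology}, 'n::finite) chart set \<Rightarrow>
     (('a, 'n) chart \<Rightarrow> real ^ 'n \<Rightarrow> real ^ 'n ^ 'n) \<Rightarrow> (real \<Rightarrow> 'a) \<Rightarrow> real" where
  "curve_length \<A> g \<gamma> = integral {0..1} (speed \<A> g \<gamma>)"

text \<open>The distance between points of different connected components is \<open>\<infinity>\<close>.\<close>

definition riemannian_dist ::
    "('a::{t2_space, second_countable_topology}, 'n::finite) chart set \<Rightarrow>
     (('a, 'n) chart \<Rightarrow> real ^ 'n \<Rightarrow> real ^ 'n ^ 'n) \<Rightarrow> 'a \<Rightarrow> 'a \<Rightarrow> ennreal" where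
  "riemannian_dist \<A> g x y =
     (INF \<gamma>\<in>{\<gamma>. piecewise_C1_curve \<A> \<gamma> \<and> pathstart \<gamma> = x \<and> pathfinish \<gamma> = y}.
        ennreal (curve_length \<A> g \<gamma>))"

definition riemannian_ball ::
    "('a::{t2_space, second_countable_topology}, 'n::finite) chart set \<Rightarrow>
     (('a, 'n) chart \<Rightarrow> real ^ 'n \<Rightarrow> real ^ 'n ^ 'n) \<Rightarrow> 'a \<Rightarrow> real \<Rightarrow> 'a set" where
  "riemannian_ball \<A> g x \<epsilon> = {y. riemannian_dist \<A> g x y < ennreal \<epsilon>}"


section \<open>Borel probability measures and the weak-star topology\<close>

definition prob_measures :: "'a::topological_space measure set" where
  "prob_measures = {\<mu>. prob_space \<mu> \<and> sets \<mu> = sets borel}"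

definition invariant_measures ::
    "('a::topological_space \<Rightarrow> 'a) \<Rightarrow> 'a measure set" where
  "invariant_measures f = {\<mu>\<in>prob_measures. distr \<mu> borel f = \<mu>}"

definition weak_star :: "'a::topological_space measure topology" where
  "weak_star = topology_generated_by
     {{\<mu>\<in>prob_measures. (\<integral>x. \<phi> x \<partial>\<mu>) \<in> V} |(\<phi> :: 'a \<Rightarrow> complex) V.
        continuous_on UNIV \<phi> \<and> open V}"

definition metrizes_weak_star ::
    "('a::topological_space measure \<Rightarrow> 'a measure \<Rightarrow> real) \<Rightarrow> bool" where
  "metrizes_weak_star ds \<longleftrightarrow>
     Metric_space prob_measures ds \<and> Metric_space.mtopology prob_measures ds = weak_star"

definition measure_set_dist ::
    "('a measure \<Rightarrow> 'a measure \<Rightarrow> real) \<Rightarrow> 'a measure set \<Rightarrow> 'a measure set \<Rightarrow> real" where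
  "measure_set_dist ds P Q = Inf {ds \<mu> \<nu> |\<mu> \<nu>. \<mu> \<in> P \<and> \<nu> \<in> Q}"

text \<open>The average of \<open>\<nu> 1, \<dots>, \<nu> n\<close>; only meaningful for \<open>n \<ge> 1\<close>.\<close>

definition average_measure :: "nat \<Rightarrow> (nat \<Rightarrow> 'a::topological_space measure) \<Rightarrow> 'a measure" where
  "average_measure n \<nu> =
     measure_of UNIV (sets borel) (\<lambda>A. (\<Sum>j=1..n. emeasure (\<nu> j) A) / of_nat n)"


section \<open>The noise\<close>

definition transition_prob ::
    "('a::{t2_space, second_countable_topology}, 'n::finite) chart set \<Rightarrow>
     (('a, 'n) chart \<Rightarrow> real ^ 'n \<Rightarrow> real ^ 'n ^ 'n) \<Rightarrow> 'a measure \<Rightarrow> ('a \<Rightarrow> 'a) \<Rightarrow>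
     real \<Rightarrow> 'a \<Rightarrow> 'a measure" where
  "transition_prob \<A> g m f \<epsilon> x = uniform_measure m (riemannian_ball \<A> g (f x) \<epsilon>)"

definition transfer_op ::
    "('a::{t2_space, second_countable_topology}, 'n::finite) chart set \<Rightarrow>
     (('a, 'n) chart \<Rightarrow> real ^ 'n \<Rightarrow> real ^ 'n ^ 'n) \<Rightarrow> 'a measure \<Rightarrow> ('a \<Rightarrow> 'a) \<Rightarrow>
     real \<Rightarrow> ('a \<Rightarrow> complex) \<Rightarrow> 'a \<Rightarrow> complex" where
  "transfer_op \<A> g m f \<epsilon> \<phi> x = (\<integral>y. \<phi> y \<partial>transition_prob \<A> g m f \<epsilon> x)"

definition dual_transfer_op ::
    "('a::{t2_space, second_countable_topology}, 'n::finite) chart set \<Rightarrow>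
     (('a, 'n) chart \<Rightarrow> real ^ 'n \<Rightarrow> real ^ 'n ^ 'n) \<Rightarrow> 'a measure \<Rightarrow> ('a \<Rightarrow> 'a) \<Rightarrow>
     real \<Rightarrow> 'a measure \<Rightarrow> 'a measure" where
  "dual_transfer_op \<A> g m f \<epsilon> \<mu> =
     (THE \<nu>. \<nu> \<in> prob_measures \<and>
        (\<forall>\<phi>::'a \<Rightarrow> complex. continuous_on UNIV \<phi> \<longrightarrow>
           (\<integral>x. \<phi> x \<partial>\<nu>) = (\<integral>x. transfer_op \<A> g m f \<epsilon> \<phi> x \<partial>\<mu>)))"

definition empiric_stochastic ::
    "('a::{t2_space, second_countable_topology}, 'n::finite) chart set \<Rightarrow>
     (('a, 'n) chart \<Rightarrow> real ^ 'n \<Rightarrow> real ^ 'n ^ 'n) \<Rightarrow> 'a measure \<Rightarrow> ('a \<Rightarrow> 'a) \<Rightarrow>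
     real \<Rightarrow> nat \<Rightarrow> 'a \<Rightarrow> 'a measure" where
  "empiric_stochastic \<A> g m f \<epsilon> n x =
     average_measure n (\<lambda>j. (dual_transfer_op \<A> g m f \<epsilon> ^^ j) (return borel x))"


section \<open>Empiric stochastic stability\<close>

definition stability_basin ::
    "('a::{t2_space, second_countable_topology}, 'n::finite) chart set \<Rightarrow>
     (('a, 'n) chart \<Rightarrow> real ^ 'n \<Rightarrow> real ^ 'n ^ 'n) \<Rightarrow> 'a measure \<Rightarrow> ('a \<Rightarrow> 'a) \<Rightarrow>
     ('a measure \<Rightarrow> 'a measure \<Rightarrow> real) \<Rightarrow> 'a measure set \<Rightarrow> 'a set" where
  "stability_basin \<A> g m f ds K =
     {x. \<forall>\<rho>>0. \<exists>N>0. \<forall>n\<ge>N. \<exists>\<epsilon>\<^sub>0>0. \<forall>\<epsilon>. 0 < \<epsilon> \<and> \<epsilon> \<le> \<epsilon>\<^sub>0 \<longrightarrow>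
           measure_set_dist ds {empiric_stochastic \<A> g m f \<epsilon> n x} K < \<rho>}"

definition empirically_stochastically_stable ::
    "('a::{t2_space, second_countable_topology}, 'n::finite) chart set \<Rightarrow>
     (('a, 'n) chart \<Rightarrow> real ^ 'n \<Rightarrow> real ^ 'n ^ 'n) \<Rightarrow> 'a measure \<Rightarrow> ('a \<Rightarrow> 'a) \<Rightarrow>
     ('a measure \<Rightarrow> 'a measure \<Rightarrow> real) \<Rightarrow> 'a measure set \<Rightarrow> bool" where
  "empirically_stochastically_stable \<A> g m f ds K \<longleftrightarrow>
     K \<noteq> {} \<and> compactin weak_star K \<and> K \<subseteq> invariant_measures f \<and>
     (\<exists>A\<in>sets m. emeasure m A > 0 \<and>
        (\<forall>\<rho>>0. \<exists>N>0. \<forall>n\<ge>N. \<exists>\<epsilon>\<^sub>0>0. \<forall>\<epsilon>. 0 < \<epsilon> \<and> \<epsilon> \<le> \<epsilon>\<^sub>0 \<longrightarrow>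
           (\<forall>x\<in>A. measure_set_dist ds {empiric_stochastic \<A> g m f \<epsilon> n x} K < \<rho>))) \<and>
     (\<forall>K'. K' \<noteq> {} \<and> compactin weak_star K' \<and> K' \<subseteq> invariant_measures f \<and>
        (AE x in m. x \<in> stability_basin \<A> g m f ds K \<longrightarrow> x \<in> stability_basin \<A> g m f ds K') \<longrightarrow>
        K \<subseteq> K')"

definition globally_empirically_stochastically_stable ::
    "('a::{t2_space, second_countable_topology}, 'n::finite) chart set \<Rightarrow>
     (('a, 'n) chart \<Rightarrow> real ^ 'n \<Rightarrow> real ^ 'n ^ 'n) \<Rightarrow> 'a measure \<Rightarrow> ('a \<Rightarrow> 'a) \<Rightarrow>
     ('a measure \<Rightarrow> 'a measure \<Rightarrow> real) \<Rightarrow> 'a measure set \<Rightarrow> bool" where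
  "globally_empirically_stochastically_stable \<A> g m f ds K \<longleftrightarrow>
     empirically_stochastically_stable \<A> g m f ds K \<and>
     (AE x in m. x \<in> stability_basin \<A> g m f ds K)"


section \<open>Pseudo-physical measures\<close>

definition empiric_measure :: "('a::topological_space \<Rightarrow> 'a) \<Rightarrow> nat \<Rightarrow> 'a \<Rightarrow> 'a measure" where
  "empiric_measure f n x = average_measure n (\<lambda>j. return borel ((f ^^ j) x))"

definition p_omega :: "('a::topological_space \<Rightarrow> 'a) \<Rightarrow> 'a \<Rightarrow> 'a measure set" where
  "p_omega f x =
     {\<mu>. \<exists>r. strict_mono r \<and> limitin weak_star (\<lambda>i. empiric_measure f (r i) x) \<mu> sequentially}"

definition weak_basin ::
    "('a::topological_space \<Rightarrow> 'a) \<Rightarrow> ('a measure \<Rightarrow> 'a measure \<Rightarrow> real) \<Rightarrow>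
     'a measure \<Rightarrow> real \<Rightarrow> 'a set" where
  "weak_basin f ds \<mu> \<rho> = {x. measure_set_dist ds (p_omega f x) {\<mu>} < \<rho>}"

definition pseudo_physical ::
    "'a::topological_space measure \<Rightarrow> ('a \<Rightarrow> 'a) \<Rightarrow> ('a measure \<Rightarrow> 'a measure \<Rightarrow> real) \<Rightarrow>
     'a measure \<Rightarrow> bool" where
  "pseudo_physical m f ds \<mu> \<longleftrightarrow>
     \<mu> \<in> invariant_measures f \<and> (\<forall>\<rho>>0. emeasure m (weak_basin f ds \<mu> \<rho>) > 0)"

end

theory Submission
  imports Defs
begin

text \<open>
  The proof separates the small noise limit from the ergodic theory of the unperturbed map \<open>f\<close>.

  Small noise. For fixed \<open>n\<close>, the empiric stochastic probability with noise \<open>\<epsilon>\<close> started at \<open>x\<close> tends to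
  the empiric measure \<open>\<sigma> n x\<close> of the deterministic orbit as \<open>\<epsilon> \<rightarrow> 0\<close>, uniformly in \<open>x\<close>
  (\<open>empiric_stochastic_uniformly_close\<close>). The reason is that one noisy step spreads mass only over a
  small Riemannian ball, so it differs little from the push-forward by \<open>f\<close> (\<open>limitin_dual\<close>). Since in
  the definition of the stability basin \<open>\<epsilon>\<close> is chosen after \<open>n\<close>, the noise disappears from that
  definition: \<open>x\<close> lies in the basin of a compact set \<open>K\<close> if and only if all limit points of
  \<open>\<sigma> n x\<close> lie in \<open>K\<close> (\<open>stability_basin_iff\<close>).

  Ergodic part. The set \<open>P\<close> of pseudo-physical measures is weak-star closed and attracts almost every
  orbit: an invariant measure outside \<open>P\<close> has a ball whose weak basin is a null set, finitely many such
  balls cover any compact set of invariant measures that misses \<open>P\<close>, and so almost no orbit accumulates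
  there (\<open>AE_p_omega_disjoint\<close>, \<open>AE_p_omega_pseudo_physical\<close>). Hence the basin of \<open>P\<close> has full measure,
  and \<open>P\<close> is not empty. Conversely, any compact set that attracts almost every orbit contains \<open>P\<close>,
  because every neighbourhood of a pseudo-physical measure meets the limit sets of a set of points of
  positive measure (\<open>pseudo_physical_minimal\<close>). So \<open>P\<close> is the least nonempty
  compact set of invariant measures with a basin of full measure, which gives minimality and uniqueness. The uniformity on a set of positive measure that
  stability asks for follows from almost everywhere convergence by an Egorov argument
  (\<open>uniformly_attracted_set\<close>).

  Two bodies of theory support this. The weak-star compactness of the space of Borel probability
  measures is reduced to Helly's selection theorem on the real line by coding the points of the space
  as real numbers (\<open>compact_space_borel_coding\<close>, \<open>prob_measures_convergent_subsequence\<close>). Of Riemannian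
  geometry, only this is used: the volume is finite and positive on nonempty open sets, the relation
  \<open>y \<in> B\<^sub>\<epsilon>(x)\<close> is open in both variables and holds for \<open>y = x\<close>, and the balls shrink uniformly to
  their centers. These facts are proved from the definitions of charts, curves and lengths; both
  distance estimates come from comparing the metric with the Euclidean norm on compact pieces of a chart
  (\<open>quad_bounds\<close>, \<open>short_curves_stay_near\<close>, \<open>short_curves_nearby\<close>).
\<close>

section \<open>Borel probability measures on a compact space\<close>

lemma normal_space_compact_t2:
  assumes "compact (UNIV :: 'a::t2_space set)"
  shows "normal_space (euclidean :: 'a topology)"
proof (rule compact_Hausdorff_or_regular_imp_normal_space)
  show "compact_space (euclidean :: 'a topology)"
    using assms by (simp add: compact_space_def)
  have "Hausdorff_space (euclidean :: 'a topology)"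
    unfolding Hausdorff_space_def disjnt_def using hausdorff by (metis open_openin)
  then show "Hausdorff_space (euclidean :: 'a topology) \<or> regular_space (euclidean :: 'a topology)" ..
qed

lemma base_element_with_closure_inside:
  assumes comp: "compact (UNIV :: 'a::t2_space set)" and "topological_basis \<B>"
    and "open (U :: 'a set)" "x \<in> U"
  obtains b where "b \<in> \<B>" "x \<in> b" "closure b \<subseteq> U"
proof -
  have "closed {x}" "closed (- U)" "{x} \<inter> - U = {}" using assms by auto
  moreover have "\<exists>V W. open V \<and> open W \<and> {x} \<subseteq> V \<and> - U \<subseteq> W \<and> V \<inter> W = {}"
    using normal_space_compact_t2[OF comp] calculation
    unfolding normal_space_def disjnt_def by (metis closed_closedin open_openin)
  ultimately obtain V W where VW: "open V" "open W" "x \<in> V" "- U \<subseteq> W" "V \<inter> W = {}" by blast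
  obtain b where b: "b \<in> \<B>" "x \<in> b" "b \<subseteq> V"
    using topological_basisE[OF assms(2) VW(1) VW(3)] by blast
  have "closure b \<subseteq> - W"
    using b VW by (intro closure_minimal) auto
  then show ?thesis using that b VW by blast
qed

text \<open>
  Second countability makes an open set the union of countably many base elements whose closures still
  lie in it; a weighted sum of Urysohn functions for these closures is positive exactly there. Such
  functions let continuous test functions see open sets.
\<close>

lemma continuous_positive_exactly_on_open:
  fixes U :: "'a::{t2_space, second_countable_topology} set"
  assumes comp: "compact (UNIV :: 'a set)" and U: "open U"
  obtains u :: "'a \<Rightarrow> real"
  where "continuous_on UNIV u" "\<And>x. 0 \<le> u x" "U = {x. 0 < u x}"
proof -
  obtain \<B> :: "'a set set" where B: "countable \<B>" "topological_basis \<B>"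
    using ex_countable_basis by blast
  define \<C> where "\<C> = insert {} {b \<in> \<B>. closure b \<subseteq> U}"
  have C: "countable \<C>" "\<C> \<noteq> {}" using B by (auto simp: \<C>_def)
  define c where "c = from_nat_into \<C>"
  have c: "range c = \<C>" using C by (simp add: c_def range_from_nat_into)
  have cU: "closure (c i) \<subseteq> U" for i using c unfolding \<C>_def by (metis (no_types, lifting) closure_empty empty_subsetI insertE mem_Collect_eq rangeI)
  have "\<exists>v. continuous_map euclidean (top_of_set {0..1::real}) v \<and> v ` (- U) \<subseteq> {0} \<and> v ` closure (c i) \<subseteq> {1}" for i
  proof -
    have "closedin euclidean (- U)" "closedin euclidean (closure (c i))" "disjnt (- U) (closure (c i))"
      using U cU[of i] by (auto simp: disjnt_def closed_closedin[symmetric])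
    from Urysohn_lemma[OF normal_space_compact_t2[OF comp] this, of 0 1] show ?thesis
      by (metis zero_le_one)
  qed
  then obtain v where v: "\<And>i. continuous_map euclidean (top_of_set {0..1::real}) (v i)"
      "\<And>i. v i ` (- U) \<subseteq> {0}" "\<And>i. v i ` closure (c i) \<subseteq> {1}" by metis
  have v01: "0 \<le> v i x" "v i x \<le> 1" for i x
    using v(1)[of i] by (auto simp: continuous_map_in_subtopology)
  have vcont: "continuous_on UNIV (v i)" for i
    using v(1)[of i] by (auto simp: continuous_map_in_subtopology)
  define u where "u x = (\<Sum>i. (1/2)^i * v i x)" for x
  have summ: "summable (\<lambda>i. (1/2)^i * v i x)" for x
    by (rule summable_comparison_test'[of "\<lambda>i. (1/2)^i"]) (auto simp: v01)
  have "uniform_limit UNIV (\<lambda>n x. \<Sum>i<n. (1/2)^i * v i x) u sequentially"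
    unfolding u_def by (rule Weierstrass_m_test[where M="\<lambda>i. (1/2)^i"]) (auto simp: v01)
  then have "continuous_on UNIV u"
    by (rule uniform_limit_theorem[rotated])
      (auto intro!: continuous_intros vcont always_eventually)
  moreover have "0 \<le> u x" for x unfolding u_def by (rule suminf_nonneg[OF summ]) (simp add: v01)
  moreover have "U = {x. 0 < u x}"
  proof (intro set_eqI iffI)
    fix x assume "x \<in> U"
    then obtain b where "b \<in> \<B>" "x \<in> b" "closure b \<subseteq> U"
      using base_element_with_closure_inside[OF comp B(2) U] by blast
    then obtain i where "x \<in> c i" using c unfolding \<C>_def by (metis (mono_tags, lifting) insertI2 mem_Collect_eq rangeE)
    then have "v i x = 1" using v(3)[of i] closure_subset by fastforce
    then have "0 < u x" unfolding u_def
      by (intro suminf_pos2[OF summ, of _ i]) (auto simp: v01)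
    then show "x \<in> {x. 0 < u x}" by simp
  next
    fix x assume x: "x \<in> {x. 0 < u x}"
    show "x \<in> U"
    proof (rule ccontr)
      assume "x \<notin> U"
      then have "v i x = 0" for i using v(2)[of i] by auto
      then have "u x = 0" by (simp add: u_def)
      then show False using x by simp
    qed
  qed
  ultimately show ?thesis using that by blast
qed

lemma continuous_bounded_compact_UNIV:
  fixes \<phi> :: "'a::topological_space \<Rightarrow> 'b::real_normed_vector"
  assumes comp: "compact (UNIV :: 'a set)" and "continuous_on UNIV \<phi>"
  obtains B where "0 \<le> B" "\<And>x. norm (\<phi> x) \<le> B"
proof -
  have "bounded (range \<phi>)" using assms by (intro compact_imp_bounded compact_continuous_image)
  then obtain B where "\<And>x. norm (\<phi> x) \<le> B" by (auto simp: bounded_iff)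
  moreover from this[of undefined] have "0 \<le> B" using norm_ge_zero order_trans by blast
  ultimately show ?thesis using that by blast
qed

lemma prob_measuresD:
  assumes "\<mu> \<in> prob_measures"
  shows "prob_space \<mu>" "sets \<mu> = sets borel" "space \<mu> = UNIV"
  using assms by (auto simp: prob_measures_def dest: sets_eq_imp_space_eq)

lemma integrable_continuous_prob:
  fixes \<phi> :: "'a::topological_space \<Rightarrow> 'b::{banach, second_countable_topology}"
  assumes "compact (UNIV :: 'a set)" "\<mu> \<in> prob_measures" "continuous_on UNIV \<phi>"
  shows "integrable \<mu> \<phi>"
proof -
  interpret prob_space \<mu> using assms prob_measuresD by blast
  obtain B where "\<And>x. norm (\<phi> x) \<le> B"
    using continuous_bounded_compact_UNIV[OF assms(1,3)] by blast
  moreover have "\<phi> \<in> borel_measurable \<mu>"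
    using borel_measurable_continuous_onI[OF assms(3)]
      measurable_cong_sets[OF prob_measuresD(2)[OF assms(2)], of borel borel] by auto
  ultimately show ?thesis by (intro integrable_const_bound[of _ B]) auto
qed

text \<open>
  The measure of \<open>{x. 0 < u x}\<close> is the limit of the integrals of \<open>min 1 (n * u x)\<close>, so the integrals of
  continuous functions determine the measures of open sets, which generate the Borel sets.
\<close>

lemma prob_measures_eqI:
  fixes \<mu> \<nu> :: "'a::{t2_space, second_countable_topology} measure"
  assumes comp: "compact (UNIV :: 'a set)"
    and \<mu>: "\<mu> \<in> prob_measures" and \<nu>: "\<nu> \<in> prob_measures"
    and eq: "\<And>\<phi>::'a \<Rightarrow> real. continuous_on UNIV \<phi> \<Longrightarrow> (\<integral>x. \<phi> x \<partial>\<mu>) = (\<integral>x. \<phi> x \<partial>\<nu>)"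
  shows "\<mu> = \<nu>"
proof -
  have lim: "(\<lambda>n. \<integral>x. min 1 (real n * u x) \<partial>M) \<longlonglongrightarrow> measure M {x. 0 < u x}"
    if M: "M \<in> prob_measures" and u: "continuous_on UNIV u" "\<And>x. 0 \<le> u x"
    for M and u :: "'a \<Rightarrow> real"
  proof -
    interpret M: prob_space M using M prob_measuresD by blast
    have sM: "sets M = sets borel" using M prob_measuresD by blast
    have mu: "u \<in> borel_measurable M"
      using borel_measurable_continuous_onI[OF u(1)] measurable_cong_sets[OF sM, of borel borel] by auto
    have "(\<lambda>n. \<integral>x. min 1 (real n * u x) \<partial>M) \<longlonglongrightarrow> (\<integral>x. indicat_real {x. 0 < u x} x \<partial>M)"
    proof (rule integral_dominated_convergence[where w="\<lambda>_. 1"])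
      have "{x \<in> space M. 0 < u x} \<in> sets M" using mu by measurable
      then show "indicat_real {x. 0 < u x} \<in> borel_measurable M"
        using prob_measuresD(3)[OF M] by simp
      show "AE x in M. (\<lambda>n. min 1 (real n * u x)) \<longlonglongrightarrow> indicat_real {x. 0 < u x} x"
      proof (rule AE_I2)
        fix x
        show "(\<lambda>n. min 1 (real n * u x)) \<longlonglongrightarrow> indicat_real {x. 0 < u x} x"
        proof (cases "0 < u x")
          case True
          obtain N :: nat where N: "1 < N * u x" using reals_Archimedean3[OF True] by blast
          have "\<forall>\<^sub>F n in sequentially. min 1 (real n * u x) = 1"
            using eventually_ge_at_top[of N]
          proof eventually_elim
            case (elim n)
            have "N * u x \<le> n * u x" using elim True by (intro mult_right_mono) auto
            then show ?case using N by auto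
          qed
          then show ?thesis using True by (simp add: tendsto_eventually)
        next
          case False
          then have "u x = 0" using u(2)[of x] by simp
          then show ?thesis by simp
        qed
      qed
      have "\<bar>min 1 (real n * u x)\<bar> \<le> 1" for n x
        using mult_nonneg_nonneg[OF of_nat_0_le_iff u(2), of n x] by linarith
      then show "AE x in M. norm (min 1 (real n * u x)) \<le> 1" for n by simp
    qed (use mu in auto)
    also have "(\<integral>x. indicat_real {x. 0 < u x} x \<partial>M) = measure M {x. 0 < u x}"
      using prob_measuresD(3)[OF M] by simp
    finally show ?thesis .
  qed
  have "measure \<mu> U = measure \<nu> U" if U: "open U" for U :: "'a set"
  proof -
    obtain u :: "'a \<Rightarrow> real" where u: "continuous_on UNIV u" "\<And>x. 0 \<le> u x" "U = {x. 0 < u x}"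
      using continuous_positive_exactly_on_open[OF comp U] by blast
    have "(\<integral>x. min 1 (real n * u x) \<partial>\<mu>) = (\<integral>x. min 1 (real n * u x) \<partial>\<nu>)" for n
      by (rule eq) (intro continuous_intros u)
    then show ?thesis using lim[OF \<mu> u(1,2)] lim[OF \<nu> u(1,2)] u(3) LIMSEQ_unique by fastforce
  qed
  moreover interpret \<mu>: prob_space \<mu> using \<mu> prob_measuresD by blast
  interpret \<nu>: prob_space \<nu> using \<nu> prob_measuresD by blast
  show ?thesis
  proof (rule measure_eqI_generator_eq[of "{U. open U}" UNIV])
    show "Int_stable {U::'a set. open U}" by (auto simp: Int_stable_def)
    show "sets \<mu> = sigma_sets UNIV {U. open U}" "sets \<nu> = sigma_sets UNIV {U. open U}"
      using prob_measuresD[OF \<mu>] prob_measuresD[OF \<nu>] by (simp_all add: borel_def)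
    show "range (\<lambda>_::nat. UNIV) \<subseteq> {U::'a set. open U}" by auto
  qed (use calculation in \<open>auto simp: \<mu>.emeasure_eq_measure \<nu>.emeasure_eq_measure\<close>)
qed

text \<open>
  The points of the Cantor set with ternary digits 0 and 2: at the first digit where two of them
  differ, the difference \<open>2 / 3 ^ (l + 1)\<close> outweighs all later digits, which sum to at most half of it.
\<close>

lemma ternary_digits_separated:
  fixes A B :: "nat \<Rightarrow> bool"
  assumes "A k \<noteq> B k"
  shows "\<bar>(\<Sum>i. 2 * of_bool (A i) / 3^(i+1)) - (\<Sum>i. 2 * of_bool (B i) / 3^(i+1))\<bar> \<ge> 1 / (3::real)^(k+1)"
proof -
  define l where "l = (LEAST l. A l \<noteq> B l)"
  have l: "A l \<noteq> B l" "l \<le> k" "\<And>i. i < l \<Longrightarrow> A i = B i"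
    unfolding l_def
    using LeastI[of "\<lambda>l. A l \<noteq> B l", OF assms] Least_le[of "\<lambda>l. A l \<noteq> B l", OF assms]
      not_less_Least[of _ "\<lambda>l. A l \<noteq> B l"] by blast+
  have geo: "(\<lambda>i. 2 / (3::real)^(i+1)) sums 1"
    using geometric_sums[of "1/3::real"] sums_mult[of _ _ "2/3::real"] by (fastforce simp: power_divide)
  have summ: "summable (\<lambda>i. 2 * of_bool (P i) / (3::real)^(i+1))" for P
    by (rule summable_comparison_test'[OF sums_summable[OF geo]]) (auto simp: of_bool_def)
  define c where "c i = 2 * (of_bool (A i) - of_bool (B i)) / (3::real)^(i+1)" for i
  have csum: "summable c"
    using summable_diff[OF summ[of A] summ[of B]] by (simp add: c_def[abs_def] diff_divide_distrib right_diff_distrib)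
  have cabs: "\<bar>c i\<bar> \<le> 2 / 3^(i+1)" for i by (auto simp: c_def of_bool_def)
  have eq: "(\<Sum>i. 2 * of_bool (A i) / 3^(i+1)) - (\<Sum>i. 2 * of_bool (B i) / 3^(i+1)) = suminf c"
    using suminf_diff[OF summ[of A] summ[of B]] by (simp add: c_def[abs_def] diff_divide_distrib right_diff_distrib)
  have split: "suminf c = (\<Sum>i. c (i + Suc l)) + (\<Sum>i<Suc l. c i)"
    by (rule suminf_split_initial_segment[OF csum])
  have head: "(\<Sum>i<Suc l. c i) = c l" using l(3) by (simp add: c_def)
  have tail: "\<bar>\<Sum>i. c (i + Suc l)\<bar> \<le> 1 / 3^(l+1)"
  proof -
    have g: "(\<lambda>i. 2 / (3::real)^(i + Suc l + 1)) sums (1 / 3^(l+1))"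
      using sums_mult[OF geo, of "1/3^(l+1)"] by (simp add: power_add mult_ac)
    have s: "summable (\<lambda>i. \<bar>c (i + Suc l)\<bar>)"
      by (rule summable_comparison_test'[OF sums_summable[OF g]]) (simp only: real_norm_def abs_idempotent, rule cabs)
    have "\<bar>\<Sum>i. c (i + Suc l)\<bar> \<le> (\<Sum>i. \<bar>c (i + Suc l)\<bar>)" by (rule summable_rabs[OF s])
    also have "\<dots> \<le> (\<Sum>i. 2 / (3::real)^(i + Suc l + 1))"
      by (rule suminf_le[OF _ s sums_summable[OF g]]) (rule cabs)
    also have "\<dots> = 1 / 3^(l+1)" using sums_unique[OF g] by simp
    finally show ?thesis .
  qed
  have "\<bar>c l\<bar> = 2 / 3^(l+1)" using l(1) by (auto simp: c_def of_bool_def)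
  then have "\<bar>suminf c\<bar> \<ge> 1 / 3^(l+1)" using split head tail by linarith
  moreover have "1 / (3::real)^(k+1) \<le> 1 / 3^(l+1)" using l(2) by (intro divide_left_mono power_increasing) auto
  ultimately show ?thesis using eq by simp
qed

text \<open>
  The digits of the code \<open>s x\<close> record to which elements of a countable base the point \<open>x\<close> belongs. The
  code is only Borel, but its inverse is uniformly continuous: by compactness, a continuous function
  \<open>\<phi>\<close> is determined up to a given error by finitely many base elements, that is, by finitely many
  digits. So \<open>\<phi>\<close> is a function of the code that extends continuously to the whole line.
\<close>

lemma compact_space_borel_coding:
  assumes comp: "compact (UNIV :: 'a::{t2_space, second_countable_topology} set)"
  obtains s :: "'a::{t2_space, second_countable_topology} \<Rightarrow> real"
  where "s \<in> borel_measurable borel" "\<And>x. s x \<in> {0..1}"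
    "\<And>\<phi>::'a \<Rightarrow> real. continuous_on UNIV \<phi> \<Longrightarrow>
       \<exists>G. continuous_on UNIV G \<and> bounded (range G) \<and> (\<forall>x. G (s x) = \<phi> x)"
proof -
  obtain \<B> :: "'a set set" where B: "countable \<B>" "topological_basis \<B>"
    using ex_countable_basis by blast
  have Bne: "\<B> \<noteq> {}" using topological_basisE[OF B(2) open_UNIV UNIV_I] by blast
  define c where "c = from_nat_into \<B>"
  have c: "range c = \<B>" using B Bne by (simp add: c_def range_from_nat_into)
  have copen: "open (c i)" for i using B(2) c topological_basis_open by blast
  define s where "s x = (\<Sum>i. 2 * of_bool (x \<in> c i) / (3::real)^(i+1))" for x
  have sep: "(x \<in> c k) = (y \<in> c k)" if "\<bar>s x - s y\<bar> < 1 / 3^(k+1)" for x y k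
    using ternary_digits_separated[of "\<lambda>i. x \<in> c i" k "\<lambda>i. y \<in> c i"] that
    unfolding s_def by argo
  have inj: "x = y" if "s x = s y" for x y
  proof (rule ccontr)
    assume "x \<noteq> y"
    then obtain U where "open U" "x \<in> U" "y \<notin> U" using t1_space by blast
    then obtain b where "b \<in> \<B>" "x \<in> b" "b \<subseteq> U" using topological_basisE[OF B(2)] by metis
    then obtain k where "x \<in> c k" "y \<notin> c k" using c \<open>y \<notin> U\<close> by auto
    then show False using sep[of x y k] that by simp
  qed
  have [measurable]: "c i \<in> sets borel" for i using copen by simp
  have meas: "s \<in> borel_measurable borel"
  proof -
    have "(\<lambda>x. 2 * indicator (c i) x / (3::real)^(i+1)) \<in> borel_measurable borel" for i by measurable
    then show ?thesis unfolding s_def[abs_def]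
      using borel_measurable_suminf[of "\<lambda>i x. 2 * indicator (c i) x / (3::real)^(i+1)" borel]
      by (simp add: indicator_def of_bool_def)
  qed
  have geo: "(\<lambda>i. 2 / (3::real)^(i+1)) sums 1"
    using geometric_sums[of "1/3::real"] sums_mult[of _ _ "2/3::real"] by (fastforce simp: power_divide)
  have s01: "s x \<in> {0..1}" for x
  proof -
    have summ: "summable (\<lambda>i. 2 * of_bool (x \<in> c i) / (3::real)^(i+1))"
      by (rule summable_comparison_test'[OF sums_summable[OF geo]]) (auto simp: of_bool_def)
    have "s x \<le> 1" unfolding s_def sums_unique[OF geo]
      by (rule suminf_le[OF _ summ sums_summable[OF geo]]) (auto simp: of_bool_def)
    moreover have "0 \<le> s x" unfolding s_def by (rule suminf_nonneg[OF summ]) auto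
    ultimately show ?thesis by simp
  qed
  have ext: "\<exists>G. continuous_on UNIV G \<and> bounded (range G) \<and> (\<forall>x. G (s x) = \<phi> x)"
    if \<phi>: "continuous_on UNIV \<phi>" for \<phi> :: "'a \<Rightarrow> real"
  proof -
    define h where "h = \<phi> \<circ> inv s"
    have invs: "inv s (s x) = x" for x using inj by (intro inv_f_f) (auto simp: inj_def)
    have hs: "h (s x) = \<phi> x" for x using invs by (simp add: h_def)
    have uc: "uniformly_continuous_on (range s) h"
      unfolding uniformly_continuous_on_def
    proof (intro allI impI)
      fix e :: real assume e: "0 < e"
      have "\<exists>k. x \<in> c k \<and> (\<forall>y\<in>c k. \<bar>\<phi> y - \<phi> x\<bar> < e/2)" for x
      proof -
        have "open (\<phi> -` ball (\<phi> x) (e/2))" using \<phi> open_vimage by blast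
        moreover have "x \<in> \<phi> -` ball (\<phi> x) (e/2)" using e by simp
        ultimately obtain b where "b \<in> \<B>" "x \<in> b" "b \<subseteq> \<phi> -` ball (\<phi> x) (e/2)"
          using topological_basisE[OF B(2)] by metis
        moreover from this(1) obtain k where "b = c k" using c by blast
        ultimately show ?thesis by (intro exI[of _ k]) (auto simp: dist_real_def abs_minus_commute)
      qed
      then obtain k where k: "\<And>x. x \<in> c (k x)" "\<And>x y. y \<in> c (k x) \<Longrightarrow> \<bar>\<phi> y - \<phi> x\<bar> < e/2" by metis
      obtain F where F: "finite F" "UNIV \<subseteq> (\<Union>x\<in>F. c (k x))"
      proof (rule compactE_image[OF comp, of UNIV "\<lambda>x. c (k x)"])
        show "UNIV \<subseteq> (\<Union>x. c (k x))" using k(1) by blast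
      qed (use copen in auto)
      \<comment> \<open>Points whose codes agree up to digit \<open>K\<close> lie in a common element of the finite cover.\<close>
      define K where "K = Max (k ` F)"
      show "\<exists>d>0. \<forall>x\<in>range s. \<forall>x'\<in>range s. dist x' x < d \<longrightarrow> dist (h x') (h x) < e"
      proof (intro exI[of _ "1/3^(K+1)"] conjI ballI impI)
        fix t t' assume "t \<in> range s" "t' \<in> range s" and d: "dist t' t < 1/3^(K+1)"
        then obtain x y where xy: "t = s x" "t' = s y" by blast
        obtain z where z: "z \<in> F" "x \<in> c (k z)" using F by blast
        have "k z \<le> K" unfolding K_def using z F by (intro Max_ge) auto
        then have "1 / (3::real)^(K+1) \<le> 1 / 3^(k z+1)" by (intro divide_left_mono power_increasing) auto
        then have "\<bar>s x - s y\<bar> < 1 / 3^(k z+1)" using d xy by (simp add: dist_real_def)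
        from sep[OF this] z have "y \<in> c (k z)" by simp
        then show "dist (h t') (h t) < e"
        proof -
          have "\<bar>\<phi> y - \<phi> x\<bar> < e" using k(2)[OF z(2)] k(2)[OF \<open>y \<in> c (k z)\<close>] by linarith
          then show ?thesis using hs xy by (simp add: dist_real_def)
        qed
      qed simp
    qed
    obtain g where g: "uniformly_continuous_on (closure (range s)) g" "\<And>x. x \<in> range s \<Longrightarrow> h x = g x"
      by (rule uniformly_continuous_on_extension_on_closure[OF uc]) (rule that, assumption+)
    have "bounded (range s)"
      using s01 by (intro bounded_subset[OF bounded_closed_interval[of 0 1]]) blast
    then have "compact (closure (range s))" by simp
    then have "bounded (g ` closure (range s))"
      by (intro compact_imp_bounded compact_continuous_image uniformly_continuous_imp_continuous[OF g(1)])
    then obtain Bd where Bd: "\<And>t. t \<in> closure (range s) \<Longrightarrow> norm (g t) \<le> Bd"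
      by (auto simp: bounded_iff)
    have sK: "s x \<in> closure (range s)" for x by (rule subsetD[OF closure_subset]) simp
    have "0 \<le> Bd" by (rule order_trans[OF norm_ge_zero Bd[OF sK]])
    obtain G where G: "continuous_on UNIV G" "\<And>t. t \<in> closure (range s) \<Longrightarrow> G t = g t" "\<And>t. t \<in> UNIV \<Longrightarrow> norm (G t) \<le> Bd"
      by (rule Tietze[OF uniformly_continuous_imp_continuous[OF g(1)] closed_subset[OF subset_UNIV closed_closure] \<open>0 \<le> Bd\<close> Bd])
        (assumption, rule that, assumption+)
    moreover have "G (s x) = \<phi> x" for x
      using g(2)[of "s x"] hs G(2)[OF sK] by simp
    ultimately show ?thesis by (auto simp: bounded_iff)
  qed
  show ?thesis by (rule that[OF meas s01 ext])
qed

section \<open>The weak-star topology is sequentially compact\<close>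

lemma topspace_weak_star [simp]: "topspace (weak_star :: 'a::topological_space measure topology) = prob_measures"
proof -
  let ?S = "{{\<mu> \<in> prob_measures. (\<integral>x. \<phi> x \<partial>\<mu>) \<in> V} | (\<phi> :: 'a \<Rightarrow> complex) V. continuous_on UNIV \<phi> \<and> open V}"
  have "prob_measures \<in> ?S"
    by (rule CollectI, rule exI[of _ "\<lambda>_. 0"], rule exI[of _ UNIV]) simp
  then have "prob_measures \<subseteq> \<Union>?S" by (rule Union_upper)
  moreover have "\<Union>?S \<subseteq> prob_measures" by (rule Union_least) blast
  ultimately show ?thesis unfolding weak_star_def topology_generated_by_topspace by (rule equalityI[rotated])
qed

text \<open>
  The topology is defined by complex test functions; real ones suffice because the integral of a
  complex function is assembled from those of its real and imaginary parts.
\<close>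

lemma limitin_weak_star_iff:
  fixes l :: "'a::topological_space measure"
  assumes comp: "compact (UNIV :: 'a set)"
  shows "limitin weak_star \<mu> l F \<longleftrightarrow> l \<in> prob_measures \<and> (\<forall>\<^sub>F i in F. \<mu> i \<in> prob_measures) \<and>
    (\<forall>\<phi>::'a \<Rightarrow> real. continuous_on UNIV \<phi> \<longrightarrow> ((\<lambda>i. \<integral>x. \<phi> x \<partial>\<mu> i) \<longlongrightarrow> (\<integral>x. \<phi> x \<partial>l)) F)"
    (is "?L \<longleftrightarrow> ?R")
proof
  assume L: ?L
  have l: "l \<in> prob_measures" using limitin_topspace[OF L] by simp
  have ev: "\<forall>\<^sub>F i in F. \<mu> i \<in> prob_measures"
    using L l unfolding limitin_def by (metis openin_topspace topspace_weak_star)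
  have "((\<lambda>i. \<integral>x. \<phi> x \<partial>\<mu> i) \<longlongrightarrow> (\<integral>x. \<phi> x \<partial>l)) F" if \<phi>: "continuous_on UNIV \<phi>" for \<phi> :: "'a \<Rightarrow> real"
  proof -
    have "((\<lambda>i. \<integral>x. complex_of_real (\<phi> x) \<partial>\<mu> i) \<longlongrightarrow> (\<integral>x. complex_of_real (\<phi> x) \<partial>l)) F"
    proof (rule topological_tendstoI)
      fix V assume V: "open V" "(\<integral>x. complex_of_real (\<phi> x) \<partial>l) \<in> V"
      have "openin weak_star {\<mu> \<in> prob_measures. (\<integral>x. complex_of_real (\<phi> x) \<partial>\<mu>) \<in> V}"
        unfolding weak_star_def using V \<phi>
        by (intro topology_generated_by_Basis CollectI exI[of _ "\<lambda>x. complex_of_real (\<phi> x)"] exI[of _ V])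
          (auto intro!: continuous_intros)
      then show "\<forall>\<^sub>F i in F. (\<integral>x. complex_of_real (\<phi> x) \<partial>\<mu> i) \<in> V"
        using L l V unfolding limitin_def
        by (fastforce elim!: eventually_mono)
    qed
    then show ?thesis by (simp add: tendsto_of_real_iff)
  qed
  then show ?R using l ev by blast
next
  assume R: ?R
  have C: "((\<lambda>i. \<integral>x. \<phi> x \<partial>\<mu> i) \<longlongrightarrow> (\<integral>x. \<phi> x \<partial>l)) F" if \<phi>: "continuous_on UNIV \<phi>" for \<phi> :: "'a \<Rightarrow> complex"
  proof -
    have eq: "(\<integral>x. \<phi> x \<partial>M) = Complex (\<integral>x. Re (\<phi> x) \<partial>M) (\<integral>x. Im (\<phi> x) \<partial>M)" if "M \<in> prob_measures" for M
      using integrable_continuous_prob[OF comp that \<phi>] by (simp add: complex_eq_iff)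
    have "((\<lambda>i. Complex (\<integral>x. Re (\<phi> x) \<partial>\<mu> i) (\<integral>x. Im (\<phi> x) \<partial>\<mu> i)) \<longlongrightarrow> (\<integral>x. \<phi> x \<partial>l)) F"
      using R \<phi> by (subst eq) (auto intro!: tendsto_Complex continuous_intros)
    moreover have "\<forall>\<^sub>F i in F. Complex (\<integral>x. Re (\<phi> x) \<partial>\<mu> i) (\<integral>x. Im (\<phi> x) \<partial>\<mu> i) = (\<integral>x. \<phi> x \<partial>\<mu> i)"
      using R eq by (auto elim!: eventually_mono)
    ultimately show ?thesis using tendsto_cong by fast
  qed
  have "l \<in> U \<longrightarrow> (\<forall>\<^sub>F i in F. \<mu> i \<in> U)" if "generate_topology_on {{\<mu>\<in>prob_measures. (\<integral>x. \<phi> x \<partial>\<mu>) \<in> V} |(\<phi> :: 'a \<Rightarrow> complex) V.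
        continuous_on UNIV \<phi> \<and> open V} U" for U
    using that
  proof induction
    case (Int a b)
    then show ?case using eventually_conj[of "\<lambda>i. \<mu> i \<in> a" F "\<lambda>i. \<mu> i \<in> b"] by auto
  next
    case (UN K)
    show ?case
    proof
      assume "l \<in> \<Union>K"
      then obtain k where "k \<in> K" "l \<in> k" by blast
      then have "\<forall>\<^sub>F i in F. \<mu> i \<in> k" using UN by blast
      then show "\<forall>\<^sub>F i in F. \<mu> i \<in> \<Union>K" by (rule eventually_mono) (use \<open>k \<in> K\<close> in blast)
    qed
  next
    case (Basis s)
    then obtain \<phi> :: "'a \<Rightarrow> complex" and V where s: "s = {\<mu>\<in>prob_measures. (\<integral>x. \<phi> x \<partial>\<mu>) \<in> V}" "continuous_on UNIV \<phi>" "open V" by blast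
    show ?case
    proof
      assume "l \<in> s"
      then have "\<forall>\<^sub>F i in F. (\<integral>x. \<phi> x \<partial>\<mu> i) \<in> V" using s C[OF s(2)] topological_tendstoD by blast
      moreover have "\<forall>\<^sub>F i in F. \<mu> i \<in> prob_measures" using R by blast
      ultimately show "\<forall>\<^sub>F i in F. \<mu> i \<in> s" unfolding s by eventually_elim simp
    qed
  qed auto
  then have "\<forall>U. openin weak_star U \<and> l \<in> U \<longrightarrow> (\<forall>\<^sub>F i in F. \<mu> i \<in> U)"
    by (simp add: weak_star_def openin_topology_generated_by_iff)
  then show ?L using R unfolding limitin_def topspace_weak_star by blast
qed

lemma prob_measures_distr:
  assumes "\<mu> \<in> prob_measures" "h \<in> measurable borel borel"
  shows "distr \<mu> borel h \<in> prob_measures"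
  using assms prob_measuresD[OF assms(1)] measurable_cong_sets[OF prob_measuresD(2)[OF assms(1)], of borel borel]
  by (auto simp: prob_measures_def intro!: prob_space.prob_space_distr)

text \<open>
  The images of the measures under a Borel code live on \<open>[0,1]\<close>, so Helly's theorem gives a weakly
  convergent subsequence with a limit \<open>M\<close> carried by the closure \<open>K\<close> of the codes. Every \<open>t \<in> K\<close> can be
  decoded to a point \<open>h t\<close> in such a way that \<open>\<phi> (h t)\<close> is the value at \<open>t\<close> of the continuous extension
  of \<open>\<phi>\<close>, and the push-forward of \<open>M\<close> by \<open>h\<close> is the desired limit.
\<close>

lemma prob_measures_convergent_subsequence:
  fixes \<mu> :: "nat \<Rightarrow> 'a::{t2_space, second_countable_topology} measure"
  assumes comp: "compact (UNIV :: 'a set)" and \<mu>: "\<And>i. \<mu> i \<in> prob_measures"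
  obtains l r where "l \<in> prob_measures" "strict_mono (r :: nat \<Rightarrow> nat)" "limitin weak_star (\<mu> \<circ> r) l sequentially"
proof -
  obtain s :: "'a \<Rightarrow> real" where s: "s \<in> borel_measurable borel" "\<And>x. s x \<in> {0..1}"
    "\<And>\<phi>::'a \<Rightarrow> real. continuous_on UNIV \<phi> \<Longrightarrow>
       \<exists>G. continuous_on UNIV G \<and> bounded (range G) \<and> (\<forall>x. G (s x) = \<phi> x)"
    using compact_space_borel_coding[OF comp] by blast
  have sm: "s \<in> measurable (\<mu> i) borel" for i
    using s(1) measurable_cong_sets[OF prob_measuresD(2)[OF \<mu>[of i]], of borel borel] by auto
  define \<nu> where "\<nu> i = distr (\<mu> i) borel s" for i
  have \<nu>p: "prob_space (\<nu> i)" for i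
    unfolding \<nu>_def using sm prob_measuresD(1)[OF \<mu>] by (intro prob_space.prob_space_distr)
  have \<nu>r: "real_distribution (\<nu> i)" for i
    using \<nu>p[of i] by (auto simp: real_distribution_def real_distribution_axioms_def \<nu>_def)
  have int: "(\<integral>t. G t \<partial>\<nu> i) = (\<integral>x. G (s x) \<partial>\<mu> i)" if "continuous_on UNIV G" for G :: "real \<Rightarrow> real" and i
    unfolding \<nu>_def using sm borel_measurable_continuous_onI[OF that] by (intro integral_distr)
  have "tight \<nu>"
    unfolding tight_def
  proof (intro conjI allI impI \<nu>r)
    fix e :: real assume "e > 0"
    have "measure (\<nu> n) {-1<..1} = 1" for n
    proof -
      have "measure (\<nu> n) {-1<..1} = measure (\<mu> n) (s -` {-1<..1} \<inter> space (\<mu> n))"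
        unfolding \<nu>_def using sm by (intro measure_distr) auto
      also have "s -` {-1<..1} \<inter> space (\<mu> n) = space (\<mu> n)"
      proof -
        have "s x \<in> {-1<..1}" for x using s(2)[of x] by auto
        then show ?thesis by blast
      qed
      finally show ?thesis using prob_measuresD(1)[OF \<mu>] prob_space.prob_space by metis
    qed
    then show "\<exists>a b. a < b \<and> (\<forall>n. 1 - e < measure (\<nu> n) {a<..b})"
      using \<open>e > 0\<close> by (intro exI[of _ "-1"] exI[of _ 1]) auto
  qed
  from tight_imp_convergent_subsubsequence[OF this strict_mono_id]
  obtain r M where r: "strict_mono (r :: nat \<Rightarrow> nat)" and M: "real_distribution M" and conv: "weak_conv_m (\<nu> \<circ> id \<circ> r) M" by blast
  interpret M: real_distribution M by fact
  have lim: "(\<lambda>n. \<integral>x. G (s x) \<partial>\<mu> (r n)) \<longlonglongrightarrow> (\<integral>t. G t \<partial>M)"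
    if G: "continuous_on UNIV G" "bounded (range G)" for G :: "real \<Rightarrow> real"
  proof -
    obtain B where "\<And>t. norm (G t) \<le> B" using G(2) by (auto simp: bounded_iff)
    moreover have "isCont G x" for x using G(1) continuous_on_eq_continuous_at by blast
    ultimately have "(\<lambda>n. \<integral>t. G t \<partial>(\<nu> \<circ> id \<circ> r) n) \<longlonglongrightarrow> (\<integral>t. G t \<partial>M)"
      using conv \<nu>r M by (intro weak_conv_imp_integral_bdd_continuous_conv) (auto simp: o_def)
    then show ?thesis using int[OF G(1)] by simp
  qed
  define K where "K = closure (range s)"
  have Kne: "K \<noteq> {}" by (simp add: K_def)
  \<comment> \<open>The distance to \<open>K\<close>, cut off at 1, has integral 0 along the sequence and hence in the limit.\<close>
  have AEK: "AE t in M. t \<in> K"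
  proof -
    let ?G = "\<lambda>t. min 1 (infdist t K)"
    have Gc: "continuous_on UNIV ?G" by (intro continuous_intros)
    have Gb: "norm (?G t) \<le> 1" for t using infdist_nonneg[of t K] by (auto simp: min_def)
    have sK: "s x \<in> K" for x unfolding K_def by (rule subsetD[OF closure_subset]) simp
    then have "infdist (s x) K = 0" for x by simp
    moreover have "bounded (range ?G)" unfolding bounded_iff using Gb by blast
    note lim[OF Gc this]
    ultimately have "(\<integral>t. ?G t \<partial>M) = 0" by (simp add: LIMSEQ_const_iff)
    moreover have "integrable M ?G"
      using Gb borel_measurable_continuous_onI[OF Gc] by (intro M.integrable_const_bound[of _ 1]) auto
    ultimately have "AE t in M. ?G t = 0"
      using integral_nonneg_eq_0_iff_AE[of M ?G] by (auto simp: infdist_nonneg)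
    then show ?thesis
    proof (rule AE_mp[OF _ AE_I2], intro impI)
      fix t assume "?G t = 0"
      then have "infdist t K = 0" by (auto simp: min_def split: if_splits)
      then show "t \<in> K" using in_closed_iff_infdist_zero[of K t] Kne by (simp add: K_def)
    qed
  qed
  \<comment> \<open>A limit \<open>t\<close> of codes is decoded by a limit point of the coded points.\<close>
  have dec: "\<exists>x. \<forall>\<phi> G. continuous_on UNIV \<phi> \<longrightarrow> continuous_on UNIV G \<longrightarrow> (\<forall>x. G (s x) = \<phi> x) \<longrightarrow> G t = (\<phi> x :: real)"
    if "t \<in> K" for t
  proof -
    from that obtain y where y: "\<forall>n. y n \<in> range s" "y \<longlonglongrightarrow> t"
      unfolding K_def closure_sequential by auto
    have "\<forall>n. \<exists>x. y n = s x" using y(1) by (simp add: image_iff)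
    from choice[OF this] obtain z where z: "\<forall>n. y n = s (z n)" ..
    have "seq_compact (UNIV :: 'a set)" using comp compact_imp_seq_compact by blast
    then obtain x q where q: "strict_mono (q :: nat \<Rightarrow> nat)" "(z \<circ> q) \<longlonglongrightarrow> x"
      unfolding seq_compact_def by blast
    have "G t = \<phi> x" if \<phi>: "continuous_on UNIV \<phi>" and G: "continuous_on UNIV G" and "\<forall>x. G (s x) = \<phi> x" for \<phi> :: "'a \<Rightarrow> real" and G
    proof -
      have lim1: "(\<lambda>n. G (y (q n))) \<longlonglongrightarrow> G t"
        using G LIMSEQ_subseq_LIMSEQ[OF y(2) q(1)]
        by (intro continuous_on_tendsto_compose[OF G]) (auto simp: o_def)
      have lim2: "(\<lambda>n. \<phi> (z (q n))) \<longlonglongrightarrow> \<phi> x"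
        using q(2) by (intro continuous_on_tendsto_compose[OF \<phi>]) (auto simp: o_def)
      have "G (y (q n)) = \<phi> (z (q n))" for n using that(3) z by simp
      with lim1 lim2 show ?thesis by (simp add: LIMSEQ_unique)
    qed
    then show ?thesis by blast
  qed
  then have "\<forall>t\<in>K. \<exists>x. \<forall>\<phi> G. continuous_on UNIV \<phi> \<longrightarrow> continuous_on UNIV G \<longrightarrow> (\<forall>x. G (s x) = \<phi> x) \<longrightarrow> G t = (\<phi> x :: real)"
    by blast
  from bchoice[OF this] obtain d where d: "\<forall>t\<in>K. \<forall>\<phi> G. continuous_on UNIV \<phi> \<longrightarrow> continuous_on UNIV G \<longrightarrow>
      (\<forall>x. G (s x) = \<phi> x) \<longrightarrow> G t = (\<phi> (d t) :: real)" ..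
  define h where "h t = (if t \<in> K then d t else undefined)" for t
  have h: "\<phi> (h t) = G t" if "t \<in> K" "continuous_on UNIV \<phi>" "continuous_on UNIV G" "\<And>x. G (s x) = \<phi> x" for t G and \<phi> :: "'a \<Rightarrow> real"
    using d[rule_format, OF that(1-3)] that(1,4) by (simp add: h_def)
  have hm: "h \<in> measurable borel borel"
  proof (rule borel_measurableI)
    fix U :: "'a set" assume "open U"
    then obtain u :: "'a \<Rightarrow> real" where u: "continuous_on UNIV u" "\<And>x. 0 \<le> u x" "U = {x. 0 < u x}"
      using continuous_positive_exactly_on_open[OF comp] by metis
    obtain G where G: "continuous_on UNIV G" "\<And>x. G (s x) = u x" using s(3)[OF u(1)] by blast
    have "h -` U \<inter> space borel = (K \<inter> {t. 0 < G t}) \<union> ((if undefined \<in> U then UNIV else {}) - K)"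
      using h[OF _ u(1) G] u(3) by (auto simp: h_def split: if_splits)
    moreover have "K \<in> sets borel" by (simp add: K_def)
    moreover have "{t. 0 < G t} \<in> sets borel"
      using open_Collect_less[OF continuous_on_const G(1)] by simp
    ultimately show "h -` U \<inter> space borel \<in> sets borel" by auto
  qed
  define l where "l = distr M borel h"
  have Mp: "M \<in> prob_measures" using M.prob_space_axioms by (simp add: prob_measures_def)
  have l: "l \<in> prob_measures" unfolding l_def by (rule prob_measures_distr[OF Mp hm])
  have "limitin weak_star (\<mu> \<circ> r) l sequentially"
    unfolding limitin_weak_star_iff[OF comp]
  proof (intro conjI l allI impI)
    fix \<phi> :: "'a \<Rightarrow> real" assume \<phi>: "continuous_on UNIV \<phi>"
    obtain G where G: "continuous_on UNIV G" "bounded (range G)" "\<And>x. G (s x) = \<phi> x" using s(3)[OF \<phi>] by blast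
    have hM: "h \<in> measurable M borel" using hm by simp
    have \<phi>m: "\<phi> \<in> borel_measurable borel" by (rule borel_measurable_continuous_onI[OF \<phi>])
    have "(\<integral>x. \<phi> x \<partial>l) = (\<integral>t. \<phi> (h t) \<partial>M)" unfolding l_def by (rule integral_distr[OF hM \<phi>m])
    also have "\<dots> = (\<integral>t. G t \<partial>M)"
    proof (rule integral_cong_AE)
      show "(\<lambda>t. \<phi> (h t)) \<in> borel_measurable M" using measurable_compose[OF hM \<phi>m] .
      show "G \<in> borel_measurable M" using borel_measurable_continuous_onI[OF G(1)] by simp
      show "AE t in M. \<phi> (h t) = G t" using AEK h[OF _ \<phi> G(1) G(3)] by (auto elim!: AE_mp)
    qed
    finally show "(\<lambda>i. \<integral>x. \<phi> x \<partial>(\<mu> \<circ> r) i) \<longlonglongrightarrow> (\<integral>x. \<phi> x \<partial>l)"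
      using lim[OF G(1,2)] G(3) by simp
  qed (use \<mu> in simp)
  then show ?thesis using that l r by blast
qed

section \<open>Averages, and noise that shrinks\<close>

lemma limitin_weak_starD:
  fixes \<phi> :: "'a::topological_space \<Rightarrow> real"
  assumes "compact (UNIV :: 'a set)" "limitin weak_star \<mu> l F" "continuous_on UNIV \<phi>"
  shows "((\<lambda>i. \<integral>x. \<phi> x \<partial>\<mu> i) \<longlongrightarrow> (\<integral>x. \<phi> x \<partial>l)) F"
  using assms limitin_weak_star_iff by blast

lemma return_prob_measures [simp]: "return borel x \<in> prob_measures"
  by (auto simp: prob_measures_def intro!: prob_space_return)

lemma integral_return_borel:
  fixes \<phi> :: "'a::topological_space \<Rightarrow> real"
  shows "continuous_on UNIV \<phi> \<Longrightarrow> (\<integral>y. \<phi> y \<partial>return borel x) = \<phi> x"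
  by (intro integral_return) (auto intro: borel_measurable_continuous_onI)

text \<open>
  Averaging \<open>n\<close> measures means choosing one of them uniformly at random, which makes the general facts
  on mixtures of measures available.
\<close>

lemma average_measure_eq_bind:
  fixes \<nu> :: "nat \<Rightarrow> 'a::topological_space measure"
  assumes n: "1 \<le> n" and \<nu>: "\<And>j. \<nu> j \<in> prob_measures"
  shows "average_measure n \<nu> = measure_pmf (pmf_of_set {1..n}) \<bind> \<nu>"
    and "\<nu> \<in> measurable (measure_pmf (pmf_of_set {1..n})) (subprob_algebra borel)"
proof -
  show meas: "\<nu> \<in> measurable (measure_pmf (pmf_of_set {1..n})) (subprob_algebra borel)"
    using prob_measuresD[OF \<nu>]
    by (auto simp: space_subprob_algebra intro: prob_space_imp_subprob_space)
  let ?M = "measure_pmf (pmf_of_set {1..n}) \<bind> \<nu>"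
  have sets: "sets ?M = sets borel" by (rule sets_bind[where N=borel]) (use prob_measuresD[OF \<nu>] in auto)
  have "emeasure ?M A = (\<Sum>j=1..n. emeasure (\<nu> j) A) / of_nat n" if A: "A \<in> sets borel" for A
  proof -
    have "emeasure ?M A = (\<integral>\<^sup>+j. emeasure (\<nu> j) A \<partial>measure_pmf (pmf_of_set {1..n}))"
      by (rule emeasure_bind[OF _ meas A]) simp
    also have "\<dots> = (\<Sum>j=1..n. emeasure (\<nu> j) A) / of_nat n"
      using n by (subst nn_integral_pmf_of_set) auto
    finally show ?thesis .
  qed
  then have "average_measure n \<nu> = measure_of UNIV (sets borel) (emeasure ?M)"
    unfolding average_measure_def
    by (intro measure_of_eq) (auto simp: sets.sigma_sets_eq[of borel, simplified])
  also have "\<dots> = ?M"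
    using measure_of_of_measure[of ?M] sets sets_eq_imp_space_eq[OF sets] by simp
  finally show "average_measure n \<nu> = ?M" .
qed

lemma average_measure_prob:
  assumes "1 \<le> n" "\<And>j. \<nu> j \<in> prob_measures"
  shows "average_measure n \<nu> \<in> prob_measures"
proof -
  have "prob_space (measure_pmf (pmf_of_set {1..n}) \<bind> \<nu>)"
    using prob_measuresD(1)[OF assms(2)] average_measure_eq_bind(2)[OF assms]
    by (intro prob_space.prob_space_bind[where S=borel] prob_space_measure_pmf) auto
  moreover have "sets (measure_pmf (pmf_of_set {1..n}) \<bind> \<nu>) = sets borel"
    by (rule sets_bind[where N=borel]) (use prob_measuresD(2)[OF assms(2)] in auto)
  ultimately show ?thesis unfolding average_measure_eq_bind(1)[OF assms] prob_measures_def by simp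
qed

lemma integral_average_measure:
  fixes \<phi> :: "'a::topological_space \<Rightarrow> real"
  assumes comp: "compact (UNIV :: 'a set)" and n: "1 \<le> n"
    and \<nu>: "\<And>j. \<nu> j \<in> prob_measures" and \<phi>: "continuous_on UNIV \<phi>"
  shows "(\<integral>x. \<phi> x \<partial>average_measure n \<nu>) = (\<Sum>j=1..n. \<integral>x. \<phi> x \<partial>\<nu> j) / n"
proof -
  obtain B where B: "\<And>x. norm (\<phi> x) \<le> B" using continuous_bounded_compact_UNIV[OF comp \<phi>] by blast
  have "(\<integral>x. \<phi> x \<partial>average_measure n \<nu>) = (\<integral>j. \<integral>x. \<phi> x \<partial>\<nu> j \<partial>measure_pmf (pmf_of_set {1..n}))"
    unfolding average_measure_eq_bind(1)[OF n \<nu>]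
  proof (rule integral_bind[where B=B and B'=1])
    show "AE j in measure_pmf (pmf_of_set {1..n}). emeasure (\<nu> j) (space (\<nu> j)) \<le> ennreal 1"
      using prob_space.emeasure_space_1[OF prob_measuresD(1)[OF \<nu>]] by (intro AE_I2) simp
    show "finite_measure (measure_pmf (pmf_of_set {1..n}))" by (rule measure_pmf.finite_measure_axioms)
    show "\<nu> \<in> measurable (measure_pmf (pmf_of_set {1..n})) (subprob_algebra borel)"
      by (rule average_measure_eq_bind(2)[OF n \<nu>])
  qed (use B borel_measurable_continuous_onI[OF \<phi>] in auto)
  also have "\<dots> = (\<Sum>j=1..n. \<integral>x. \<phi> x \<partial>\<nu> j) / n"
    using n by (subst integral_pmf_of_set) auto
  finally show ?thesis .
qed

lemma limitin_average_measure:
  assumes comp: "compact (UNIV :: 'a::topological_space set)" and n: "1 \<le> n"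
    and lim: "\<And>j. limitin weak_star (\<lambda>i. \<nu> i j) (l j :: 'a measure) F"
    and \<nu>: "\<And>i j. \<nu> i j \<in> prob_measures"
  shows "limitin weak_star (\<lambda>i. average_measure n (\<nu> i)) (average_measure n l) F"
  unfolding limitin_weak_star_iff[OF comp]
proof (intro conjI allI impI)
  have l: "l j \<in> prob_measures" for j using limitin_topspace[OF lim[of j]] by simp
  then show "average_measure n l \<in> prob_measures" using average_measure_prob[OF n] by blast
  show "\<forall>\<^sub>F i in F. average_measure n (\<nu> i) \<in> prob_measures"
    by (intro always_eventually allI average_measure_prob n \<nu>)
  fix \<phi> :: "'a \<Rightarrow> real" assume \<phi>: "continuous_on UNIV \<phi>"
  show "((\<lambda>i. \<integral>x. \<phi> x \<partial>average_measure n (\<nu> i)) \<longlongrightarrow> (\<integral>x. \<phi> x \<partial>average_measure n l)) F"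
    unfolding integral_average_measure[OF comp n l \<phi>] integral_average_measure[OF comp n \<nu> \<phi>]
    by (intro tendsto_divide tendsto_sum tendsto_const limitin_weak_starD[OF comp lim \<phi>]) (use n in auto)
qed

text \<open>
  The interface between geometry and dynamics: of the Riemannian balls and the volume, the dynamical
  part uses only the properties assumed here.
\<close>

locale noisy_dynamics =
  fixes \<A> :: "('a::{t2_space, second_countable_topology}, 'n::finite) chart set"
    and g :: "('a, 'n) chart \<Rightarrow> real ^ 'n \<Rightarrow> real ^ 'n ^ 'n"
    and m :: "'a measure"
    and f :: "'a \<Rightarrow> 'a"
  assumes compact_UNIV: "compact (UNIV :: 'a set)"
    and sets_m: "sets m = sets borel"
    and finite_m: "emeasure m UNIV < \<infinity>"
    and positive_m: "\<And>U. open U \<Longrightarrow> U \<noteq> {} \<Longrightarrow> 0 < emeasure m U"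
    and open_balls: "\<And>\<epsilon>. 0 < \<epsilon> \<Longrightarrow> open {(x, y). y \<in> riemannian_ball \<A> g x \<epsilon>}"
    and center_in_ball: "\<And>\<epsilon> x. 0 < \<epsilon> \<Longrightarrow> x \<in> riemannian_ball \<A> g x \<epsilon>"
    and small_balls: "\<And>(\<phi> :: 'a \<Rightarrow> real) \<eta>. continuous_on UNIV \<phi> \<Longrightarrow> 0 < \<eta> \<Longrightarrow>
        \<exists>\<epsilon>\<^sub>0>0. \<forall>\<epsilon> x. \<forall>y\<in>riemannian_ball \<A> g x \<epsilon>. \<epsilon> \<le> \<epsilon>\<^sub>0 \<longrightarrow> \<bar>\<phi> y - \<phi> x\<bar> < \<eta>"
    and continuous_f: "continuous_on UNIV f"
begin

abbreviation "noise \<equiv> transition_prob \<A> g m f"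
abbreviation "dual \<equiv> dual_transfer_op \<A> g m f"

lemma space_m: "space m = UNIV"
  using sets_eq_imp_space_eq[OF sets_m] by simp

sublocale m: finite_measure m
  by standard (use finite_m space_m in auto)

lemma open_ball: "0 < \<epsilon> \<Longrightarrow> open (riemannian_ball \<A> g x \<epsilon>)"
proof -
  assume "0 < \<epsilon>"
  have "open (Pair x -` {(x, y). y \<in> riemannian_ball \<A> g x \<epsilon>})"
    by (intro open_vimage open_balls[OF \<open>0 < \<epsilon>\<close>] continuous_intros)
  then show ?thesis by (simp add: vimage_def)
qed

lemma ball_emeasure: "0 < \<epsilon> \<Longrightarrow> emeasure m (riemannian_ball \<A> g x \<epsilon>) \<noteq> 0"
  using positive_m[OF open_ball] center_in_ball by (metis empty_iff less_numeral_extra(3))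

lemma kernel_prob: "0 < \<epsilon> \<Longrightarrow> noise \<epsilon> x \<in> prob_measures"
  using ball_emeasure by (auto simp: prob_measures_def transition_prob_def sets_m intro!: prob_space_uniform_measure)

lemma AE_kernel: "0 < \<epsilon> \<Longrightarrow> AE y in noise \<epsilon> x. y \<in> riemannian_ball \<A> g (f x) \<epsilon>"
  unfolding transition_prob_def by (rule AE_uniform_measureI) (use open_ball sets_m in auto)

text \<open>
  The pairs \<open>(x, y)\<close> with \<open>y\<close> in the ball around \<open>f x\<close> form an open set; in a second countable space it is
  measurable for the product of the Borel algebras, so its sections have measurable volume.
\<close>

lemma measurable_kernel:
  assumes "0 < \<epsilon>"
  shows "noise \<epsilon> \<in> measurable borel (subprob_algebra borel)"
proof (rule measurable_subprob_algebra)
  fix A :: "'a set" assume A: "A \<in> sets borel"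
  have m: "(\<lambda>x. emeasure m (riemannian_ball \<A> g (f x) \<epsilon> \<inter> B)) \<in> borel_measurable borel" if B: "B \<in> sets borel" for B
  proof -
    have "open {(x, y). y \<in> riemannian_ball \<A> g (f x) \<epsilon>}"
    proof -
      have "open ((\<lambda>z. (f (fst z), snd z)) -` {(x, y). y \<in> riemannian_ball \<A> g x \<epsilon>})"
        by (intro open_vimage open_balls[OF assms] continuous_intros continuous_on_compose2[OF continuous_f]) auto
      then show ?thesis by (simp add: vimage_def case_prod_unfold)
    qed
    then have "{(x, y). y \<in> riemannian_ball \<A> g (f x) \<epsilon>} \<in> sets (borel \<Otimes>\<^sub>M borel)"
      unfolding borel_prod by (rule borel_open)
    moreover have "UNIV \<times> B \<in> sets (borel \<Otimes>\<^sub>M borel)" using B by (intro pair_measureI) auto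
    ultimately have "{(x, y). y \<in> riemannian_ball \<A> g (f x) \<epsilon>} \<inter> UNIV \<times> B \<in> sets (borel \<Otimes>\<^sub>M borel)" by (rule sets.Int)
    also have "sets (borel \<Otimes>\<^sub>M borel) = sets (borel \<Otimes>\<^sub>M m)"
      by (intro sets_pair_measure_cong refl) (simp add: sets_m)
    finally have "(\<lambda>x. emeasure m (Pair x -` ({(x, y). y \<in> riemannian_ball \<A> g (f x) \<epsilon>} \<inter> UNIV \<times> B))) \<in> borel_measurable borel"
      by (rule m.measurable_emeasure_Pair)
    moreover have "Pair x -` ({(x, y). y \<in> riemannian_ball \<A> g (f x) \<epsilon>} \<inter> UNIV \<times> B) = riemannian_ball \<A> g (f x) \<epsilon> \<inter> B" for x
      by auto
    ultimately show ?thesis by simp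
  qed
  have "emeasure (noise \<epsilon> x) A = emeasure m (riemannian_ball \<A> g (f x) \<epsilon> \<inter> A) / emeasure m (riemannian_ball \<A> g (f x) \<epsilon> \<inter> UNIV)" for x
    unfolding transition_prob_def using A open_ball[OF assms] sets_m by simp
  then show "(\<lambda>x. emeasure (noise \<epsilon> x) A) \<in> borel_measurable borel"
    using m[OF A] m[of UNIV] by (simp only:) (intro borel_measurable_divide_ennreal, auto)
qed (use prob_measuresD[OF kernel_prob[OF assms]] in \<open>auto intro: prob_space_imp_subprob_space\<close>)

lemma
  assumes \<epsilon>: "0 < \<epsilon>" and \<mu>: "\<mu> \<in> prob_measures"
  shows bind_kernel_prob: "\<mu> \<bind> noise \<epsilon> \<in> prob_measures"
    and integral_bind_kernel: "\<And>\<phi>::'a \<Rightarrow> real. continuous_on UNIV \<phi> \<Longrightarrow>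
      (\<integral>x. \<phi> x \<partial>(\<mu> \<bind> noise \<epsilon>)) = (\<integral>x. \<integral>y. \<phi> y \<partial>noise \<epsilon> x \<partial>\<mu>)"
    and measurable_integral_kernel: "\<And>\<phi>::'a \<Rightarrow> real. continuous_on UNIV \<phi> \<Longrightarrow>
      (\<lambda>x. \<integral>y. \<phi> y \<partial>noise \<epsilon> x) \<in> borel_measurable \<mu>"
proof -
  interpret \<mu>: prob_space \<mu> using \<mu> prob_measuresD by blast
  have km: "noise \<epsilon> \<in> measurable \<mu> (subprob_algebra borel)"
    using measurable_kernel[OF \<epsilon>] measurable_cong_sets[OF prob_measuresD(2)[OF \<mu>] refl] by blast
  have "sets (\<mu> \<bind> noise \<epsilon>) = sets borel"
    by (rule sets_bind[where N=borel]) (use prob_measuresD[OF kernel_prob[OF \<epsilon>]] prob_measuresD[OF \<mu>] in auto)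
  moreover have "prob_space (\<mu> \<bind> noise \<epsilon>)"
    using prob_measuresD(1)[OF kernel_prob[OF \<epsilon>]] km by (intro \<mu>.prob_space_bind[where S=borel]) auto
  ultimately show "\<mu> \<bind> noise \<epsilon> \<in> prob_measures" by (simp add: prob_measures_def)
  fix \<phi> :: "'a \<Rightarrow> real" assume \<phi>: "continuous_on UNIV \<phi>"
  obtain B where B: "\<And>x. norm (\<phi> x) \<le> B" using continuous_bounded_compact_UNIV[OF compact_UNIV \<phi>] by blast
  show "(\<integral>x. \<phi> x \<partial>(\<mu> \<bind> noise \<epsilon>)) = (\<integral>x. \<integral>y. \<phi> y \<partial>noise \<epsilon> x \<partial>\<mu>)"
  proof (rule integral_bind[where B=B and B'=1])
    show "AE j in \<mu>. emeasure (noise \<epsilon> j) (space (noise \<epsilon> j)) \<le> ennreal 1"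
      using prob_space.emeasure_space_1[OF prob_measuresD(1)[OF kernel_prob[OF \<epsilon>]]] by (intro AE_I2) simp
    show "finite_measure \<mu>" by (rule \<mu>.finite_measure_axioms)
  qed (use B km borel_measurable_continuous_onI[OF \<phi>] in auto)
  show "(\<lambda>x. \<integral>y. \<phi> y \<partial>noise \<epsilon> x) \<in> borel_measurable \<mu>"
    by (rule measurable_compose[OF km integral_measurable_subprob_algebra[OF borel_measurable_continuous_onI[OF \<phi>]]])
qed

lemma integral_kernel_near:
  fixes \<phi> :: "'a \<Rightarrow> real"
  assumes \<phi>: "continuous_on UNIV \<phi>" and \<eta>: "0 < \<eta>"
  obtains \<epsilon>\<^sub>0 where "0 < \<epsilon>\<^sub>0" "\<And>\<epsilon> x. 0 < \<epsilon> \<Longrightarrow> \<epsilon> \<le> \<epsilon>\<^sub>0 \<Longrightarrow> \<bar>(\<integral>y. \<phi> y \<partial>noise \<epsilon> x) - \<phi> (f x)\<bar> \<le> \<eta>"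
proof -
  obtain \<epsilon>\<^sub>0 where \<epsilon>\<^sub>0: "0 < \<epsilon>\<^sub>0" "\<And>\<epsilon> x y. y \<in> riemannian_ball \<A> g x \<epsilon> \<Longrightarrow> \<epsilon> \<le> \<epsilon>\<^sub>0 \<Longrightarrow> \<bar>\<phi> y - \<phi> x\<bar> < \<eta>"
    using small_balls[OF \<phi> \<eta>] by metis
  have "\<bar>(\<integral>y. \<phi> y \<partial>noise \<epsilon> x) - \<phi> (f x)\<bar> \<le> \<eta>" if \<epsilon>: "0 < \<epsilon>" "\<epsilon> \<le> \<epsilon>\<^sub>0" for \<epsilon> x
  proof -
    interpret k: prob_space "noise \<epsilon> x" using kernel_prob[OF \<epsilon>(1)] prob_measuresD by blast
    have int: "integrable (noise \<epsilon> x) \<phi>"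
      by (rule integrable_continuous_prob[OF compact_UNIV kernel_prob[OF \<epsilon>(1)] \<phi>])
    have "(\<integral>y. \<phi> y \<partial>noise \<epsilon> x) - \<phi> (f x) = (\<integral>y. \<phi> y - \<phi> (f x) \<partial>noise \<epsilon> x)"
      using int by (simp add: k.prob_space)
    also have "\<bar>\<dots>\<bar> \<le> (\<integral>y. \<bar>\<phi> y - \<phi> (f x)\<bar> \<partial>noise \<epsilon> x)" by (rule integral_abs_bound)
    also have "\<dots> \<le> (\<integral>y. \<eta> \<partial>noise \<epsilon> x)"
    proof (rule integral_mono_AE)
      show "integrable (noise \<epsilon> x) (\<lambda>y. \<bar>\<phi> y - \<phi> (f x)\<bar>)" using int by auto
      show "AE y in noise \<epsilon> x. \<bar>\<phi> y - \<phi> (f x)\<bar> \<le> \<eta>"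
        using AE_kernel[OF \<epsilon>(1), of x]
      proof eventually_elim
        case (elim y)
        show ?case using \<epsilon>\<^sub>0(2)[OF elim \<epsilon>(2)] by simp
      qed
    qed simp
    also have "\<dots> = \<eta>" by (simp add: k.prob_space)
    finally show ?thesis .
  qed
  then show ?thesis using that \<epsilon>\<^sub>0(1) by blast
qed

text \<open>
  The defining description of the dual operator becomes usable: mixing the kernels over \<open>\<mu>\<close> satisfies
  the integral identity, and no other measure does, since integrals of continuous functions determine a
  measure.
\<close>

lemma dual_eq_bind:
  assumes \<epsilon>: "0 < \<epsilon>" and \<mu>: "\<mu> \<in> prob_measures"
  shows "dual \<epsilon> \<mu> = \<mu> \<bind> noise \<epsilon>"
  unfolding dual_transfer_op_def
proof (rule the_equality)
  interpret \<mu>: prob_space \<mu> using \<mu> prob_measuresD by blast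
  have "(\<integral>x. \<phi> x \<partial>(\<mu> \<bind> noise \<epsilon>)) = (\<integral>x. transfer_op \<A> g m f \<epsilon> \<phi> x \<partial>\<mu>)"
    if \<phi>: "continuous_on UNIV \<phi>" for \<phi> :: "'a \<Rightarrow> complex"
  proof -
    have eq: "(\<integral>x. \<phi> x \<partial>M) = Complex (\<integral>x. Re (\<phi> x) \<partial>M) (\<integral>x. Im (\<phi> x) \<partial>M)" if "M \<in> prob_measures" for M
      using integrable_continuous_prob[OF compact_UNIV that \<phi>] by (simp add: complex_eq_iff)
    have Rc: "continuous_on UNIV (\<lambda>x. Re (\<phi> x))" and Ic: "continuous_on UNIV (\<lambda>x. Im (\<phi> x))"
      using \<phi> by (auto intro!: continuous_intros)
    have int: "integrable \<mu> (\<lambda>x. \<integral>y. \<psi> y \<partial>noise \<epsilon> x)" if \<psi>: "continuous_on UNIV \<psi>" for \<psi> :: "'a \<Rightarrow> real"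
    proof -
      obtain B where B: "0 \<le> B" "\<And>x. norm (\<psi> x) \<le> B" using continuous_bounded_compact_UNIV[OF compact_UNIV \<psi>] by blast
      have "norm (\<integral>y. \<psi> y \<partial>noise \<epsilon> x) \<le> B" for x
      proof -
        interpret k: prob_space "noise \<epsilon> x" using kernel_prob[OF \<epsilon>(1)] prob_measuresD by blast
        have "norm (\<integral>y. \<psi> y \<partial>noise \<epsilon> x) \<le> (\<integral>y. norm (\<psi> y) \<partial>noise \<epsilon> x)" by (rule integral_norm_bound)
        also have "\<dots> \<le> (\<integral>y. B \<partial>noise \<epsilon> x)"
          using integrable_continuous_prob[OF compact_UNIV kernel_prob[OF \<epsilon>] \<psi>] B by (intro integral_mono) auto
        finally show ?thesis by (simp add: k.prob_space)
      qed
      then show ?thesis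
        using measurable_integral_kernel[OF \<epsilon> \<mu> \<psi>] by (intro \<mu>.integrable_const_bound[of _ B]) auto
    qed
    have "(\<integral>x. transfer_op \<A> g m f \<epsilon> \<phi> x \<partial>\<mu>)
        = (\<integral>x. complex_of_real (\<integral>y. Re (\<phi> y) \<partial>noise \<epsilon> x) + \<i> * complex_of_real (\<integral>y. Im (\<phi> y) \<partial>noise \<epsilon> x) \<partial>\<mu>)"
      unfolding transfer_op_def eq[OF kernel_prob[OF \<epsilon>]] by (simp only: Complex_eq)
    also have "\<dots> = complex_of_real (\<integral>x. \<integral>y. Re (\<phi> y) \<partial>noise \<epsilon> x \<partial>\<mu>) + \<i> * complex_of_real (\<integral>x. \<integral>y. Im (\<phi> y) \<partial>noise \<epsilon> x \<partial>\<mu>)"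
      using int[OF Rc] int[OF Ic] by simp
    also have "\<dots> = (\<integral>x. \<phi> x \<partial>(\<mu> \<bind> noise \<epsilon>))"
      unfolding eq[OF bind_kernel_prob[OF \<epsilon> \<mu>]] integral_bind_kernel[OF \<epsilon> \<mu> Rc] integral_bind_kernel[OF \<epsilon> \<mu> Ic]
      by (simp only: Complex_eq)
    finally show ?thesis ..
  qed
  then show E: "\<mu> \<bind> noise \<epsilon> \<in> prob_measures \<and> (\<forall>\<phi>::'a \<Rightarrow> complex. continuous_on UNIV \<phi> \<longrightarrow>
           (\<integral>x. \<phi> x \<partial>(\<mu> \<bind> noise \<epsilon>)) = (\<integral>x. transfer_op \<A> g m f \<epsilon> \<phi> x \<partial>\<mu>))"
    using bind_kernel_prob[OF \<epsilon> \<mu>] by blast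
  fix \<nu> assume \<nu>: "\<nu> \<in> prob_measures \<and> (\<forall>\<phi>::'a \<Rightarrow> complex. continuous_on UNIV \<phi> \<longrightarrow>
           (\<integral>x. \<phi> x \<partial>\<nu>) = (\<integral>x. transfer_op \<A> g m f \<epsilon> \<phi> x \<partial>\<mu>))"
  show "\<nu> = \<mu> \<bind> noise \<epsilon>"
  proof (rule prob_measures_eqI[OF compact_UNIV])
    fix \<phi> :: "'a \<Rightarrow> real" assume "continuous_on UNIV \<phi>"
    then have "continuous_on UNIV (\<lambda>x. complex_of_real (\<phi> x))" by (intro continuous_intros)
    then have "(\<integral>x. complex_of_real (\<phi> x) \<partial>\<nu>) = (\<integral>x. complex_of_real (\<phi> x) \<partial>(\<mu> \<bind> noise \<epsilon>))"
      using \<nu> E by metis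
    then show "(\<integral>x. \<phi> x \<partial>\<nu>) = (\<integral>x. \<phi> x \<partial>(\<mu> \<bind> noise \<epsilon>))" by simp
  qed (use \<nu> E in auto)
qed

lemma dual_prob: "0 < \<epsilon> \<Longrightarrow> \<mu> \<in> prob_measures \<Longrightarrow> dual \<epsilon> \<mu> \<in> prob_measures"
  using dual_eq_bind bind_kernel_prob by simp

lemma measurable_f: "f \<in> measurable borel borel"
  using continuous_f borel_measurable_continuous_onI by blast

lemma integral_distr_f:
  fixes \<phi> :: "'a \<Rightarrow> real"
  assumes \<mu>: "\<mu> \<in> prob_measures" and \<phi>: "continuous_on UNIV \<phi>"
  shows "(\<integral>x. \<phi> x \<partial>distr \<mu> borel f) = (\<integral>x. \<phi> (f x) \<partial>\<mu>)"
  using measurable_f measurable_cong_sets[OF prob_measuresD(2)[OF \<mu>], of borel borel]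
  by (intro integral_distr borel_measurable_continuous_onI[OF \<phi>]) auto

text \<open>
  The key estimate of the small noise limit. By \<open>integral_kernel_near\<close>, averaging a continuous \<open>\<phi>\<close> over
  the balls of radius \<open>\<epsilon>\<close> is uniformly close to evaluating it at \<open>f x\<close>, so one step of the dual operator
  is close to the push-forward by \<open>f\<close>. As the starting measures may vary too, the statement can be
  iterated.
\<close>

lemma limitin_dual:
  assumes \<epsilon>: "\<epsilon> \<longlonglongrightarrow> 0" "\<And>i. 0 < \<epsilon> i" and \<mu>: "\<And>i. \<mu> i \<in> prob_measures"
    and lim: "limitin weak_star \<mu> l sequentially"
  shows "limitin weak_star (\<lambda>i. dual (\<epsilon> i) (\<mu> i)) (distr l borel f) sequentially"
  unfolding limitin_weak_star_iff[OF compact_UNIV]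
proof (intro conjI allI impI)
  have l: "l \<in> prob_measures" using limitin_topspace[OF lim] by simp
  then show "distr l borel f \<in> prob_measures" by (rule prob_measures_distr[OF _ measurable_f])
  show "\<forall>\<^sub>F i in sequentially. dual (\<epsilon> i) (\<mu> i) \<in> prob_measures" using dual_prob \<epsilon>(2) \<mu> by simp
  fix \<phi> :: "'a \<Rightarrow> real" assume \<phi>: "continuous_on UNIV \<phi>"
  have \<phi>f: "continuous_on UNIV (\<lambda>x. \<phi> (f x))" using continuous_on_compose2[OF \<phi> continuous_f] by simp
  have "(\<lambda>i. (\<integral>x. \<phi> x \<partial>dual (\<epsilon> i) (\<mu> i)) - (\<integral>x. \<phi> (f x) \<partial>\<mu> i)) \<longlonglongrightarrow> 0"
  proof (rule LIMSEQ_I)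
    fix r :: real assume "0 < r"
    then have "0 < r/2" by simp
    then obtain \<epsilon>\<^sub>0 where \<epsilon>\<^sub>0: "0 < \<epsilon>\<^sub>0" "\<And>\<epsilon> x. 0 < \<epsilon> \<Longrightarrow> \<epsilon> \<le> \<epsilon>\<^sub>0 \<Longrightarrow> \<bar>(\<integral>y. \<phi> y \<partial>noise \<epsilon> x) - \<phi> (f x)\<bar> \<le> r/2"
      using integral_kernel_near[OF \<phi>] by metis
    obtain N where N: "\<And>i. N \<le> i \<Longrightarrow> \<epsilon> i < \<epsilon>\<^sub>0"
      using order_tendstoD(2)[OF \<epsilon>(1) \<epsilon>\<^sub>0(1)] by (auto simp: eventually_sequentially)
    have "\<bar>(\<integral>x. \<phi> x \<partial>dual (\<epsilon> i) (\<mu> i)) - (\<integral>x. \<phi> (f x) \<partial>\<mu> i)\<bar> < r" if "N \<le> i" for i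
    proof -
      interpret \<mu>: prob_space "\<mu> i" using \<mu> prob_measuresD by blast
      let ?k = "\<lambda>x. \<integral>y. \<phi> y \<partial>noise (\<epsilon> i) x"
      have near: "\<bar>?k x - \<phi> (f x)\<bar> \<le> r/2" for x using \<epsilon>\<^sub>0(2)[OF \<epsilon>(2)] N[OF that] by simp
      have intf: "integrable (\<mu> i) (\<lambda>x. \<phi> (f x))" by (rule integrable_continuous_prob[OF compact_UNIV \<mu> \<phi>f])
      have d: "integrable (\<mu> i) (\<lambda>x. ?k x - \<phi> (f x))"
        using near measurable_integral_kernel[OF \<epsilon>(2) \<mu> \<phi>] intf
        by (intro \<mu>.integrable_const_bound[of _ "r/2"]) auto
      have intk: "integrable (\<mu> i) ?k" using Bochner_Integration.integrable_add[OF d intf] by simp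
      have "(\<integral>x. \<phi> x \<partial>dual (\<epsilon> i) (\<mu> i)) - (\<integral>x. \<phi> (f x) \<partial>\<mu> i) = (\<integral>x. ?k x - \<phi> (f x) \<partial>\<mu> i)"
        using intk intf by (simp add: dual_eq_bind[OF \<epsilon>(2) \<mu>] integral_bind_kernel[OF \<epsilon>(2) \<mu> \<phi>])
      also have "\<bar>\<dots>\<bar> \<le> (\<integral>x. \<bar>?k x - \<phi> (f x)\<bar> \<partial>\<mu> i)" by (rule integral_abs_bound)
      also have "\<dots> \<le> (\<integral>x. r/2 \<partial>\<mu> i)" using d near by (intro integral_mono) auto
      also have "\<dots> = r/2" by (simp add: \<mu>.prob_space)
      finally show ?thesis using \<open>0 < r\<close> by simp
    qed
    then show "\<exists>N. \<forall>i\<ge>N. norm ((\<integral>x. \<phi> x \<partial>dual (\<epsilon> i) (\<mu> i)) - (\<integral>x. \<phi> (f x) \<partial>\<mu> i) - 0) < r" by auto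
  qed
  from tendsto_add[OF this limitin_weak_starD[OF compact_UNIV lim \<phi>f]]
  show "(\<lambda>i. \<integral>x. \<phi> x \<partial>dual (\<epsilon> i) (\<mu> i)) \<longlonglongrightarrow> (\<integral>x. \<phi> x \<partial>distr l borel f)"
    by (simp add: integral_distr_f[OF l \<phi>])
qed

lemma limitin_return:
  assumes "x \<longlonglongrightarrow> (z :: 'a)"
  shows "limitin weak_star (\<lambda>i. return borel (x i)) (return borel z) sequentially"
  unfolding limitin_weak_star_iff[OF compact_UNIV]
  using assms by (auto simp: integral_return_borel intro: continuous_on_tendsto_compose)

lemma dual_iterate_prob: "0 < \<epsilon> \<Longrightarrow> \<mu> \<in> prob_measures \<Longrightarrow> (dual \<epsilon> ^^ j) \<mu> \<in> prob_measures"
  by (induction j) (auto intro: dual_prob)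

lemma limitin_dual_iterate:
  assumes \<epsilon>: "\<epsilon> \<longlonglongrightarrow> 0" "\<And>i. 0 < \<epsilon> i" and x: "x \<longlonglongrightarrow> z"
  shows "limitin weak_star (\<lambda>i. (dual (\<epsilon> i) ^^ j) (return borel (x i))) (return borel ((f ^^ j) z)) sequentially"
proof (induction j)
  case 0
  then show ?case using limitin_return[OF x] by simp
next
  case (Suc j)
  have "distr (return borel ((f ^^ j) z)) borel f = return borel ((f ^^ Suc j) z)"
    using measurable_f by (simp add: distr_return)
  then show ?case
    using limitin_dual[OF \<epsilon> dual_iterate_prob[OF \<epsilon>(2) return_prob_measures] Suc] by simp
qed

lemma empiric_stochastic_prob: "1 \<le> n \<Longrightarrow> 0 < \<epsilon> \<Longrightarrow> empiric_stochastic \<A> g m f \<epsilon> n x \<in> prob_measures"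
  unfolding empiric_stochastic_def by (intro average_measure_prob dual_iterate_prob return_prob_measures)

lemma empiric_measure_prob: "1 \<le> n \<Longrightarrow> empiric_measure f n x \<in> prob_measures"
  unfolding empiric_measure_def by (intro average_measure_prob return_prob_measures)

text \<open>
  The starting point varies together with the noise; this is what later yields uniformity in the
  starting point.
\<close>

lemma limitin_empiric_stochastic:
  assumes \<epsilon>: "\<epsilon> \<longlonglongrightarrow> 0" "\<And>i. 0 < \<epsilon> i" and x: "x \<longlonglongrightarrow> z" and n: "1 \<le> n"
  shows "limitin weak_star (\<lambda>i. empiric_stochastic \<A> g m f (\<epsilon> i) n (x i)) (empiric_measure f n z) sequentially"
  unfolding empiric_stochastic_def empiric_measure_def
  by (intro limitin_average_measure compact_UNIV n limitin_dual_iterate \<epsilon> x dual_iterate_prob return_prob_measures)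

lemma continuous_iterate: "continuous_on UNIV (f ^^ j)"
proof (induction j)
  case (Suc j)
  then show ?case using continuous_on_compose2[OF continuous_f Suc] by (simp add: o_def)
qed (simp add: id_def)

lemma limitin_empiric_measure:
  assumes x: "x \<longlonglongrightarrow> z" and n: "1 \<le> n"
  shows "limitin weak_star (\<lambda>i. empiric_measure f n (x i)) (empiric_measure f n z) sequentially"
  unfolding empiric_measure_def
  by (intro limitin_average_measure compact_UNIV n limitin_return return_prob_measures
      continuous_on_tendsto_compose[OF continuous_iterate x]) auto

text \<open>
  The Krylov-Bogoliubov argument: the integrals of \<open>\<phi> \<circ> f\<close> and \<open>\<phi>\<close> over an orbit segment of length \<open>n\<close>
  telescope to two boundary terms, so they differ by at most \<open>2 * B / n\<close>.
\<close>

lemma p_omega_invariant: "p_omega f x \<subseteq> invariant_measures f"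
proof
  fix l assume "l \<in> p_omega f x"
  then obtain r where r: "strict_mono (r :: nat \<Rightarrow> nat)"
    and lim: "limitin weak_star (\<lambda>i. empiric_measure f (r i) x) l sequentially"
    unfolding p_omega_def by blast
  have l: "l \<in> prob_measures" using limitin_topspace[OF lim] by simp
  have "distr l borel f = l"
  proof (rule prob_measures_eqI[OF compact_UNIV prob_measures_distr[OF l measurable_f] l])
    fix \<phi> :: "'a \<Rightarrow> real" assume \<phi>: "continuous_on UNIV \<phi>"
    have \<phi>f: "continuous_on UNIV (\<lambda>x. \<phi> (f x))" using continuous_on_compose2[OF \<phi> continuous_f] by simp
    obtain B where B: "0 \<le> B" "\<And>x. norm (\<phi> x) \<le> B" using continuous_bounded_compact_UNIV[OF compact_UNIV \<phi>] by blast
    have int: "(\<integral>y. \<psi> y \<partial>empiric_measure f n x) = (\<Sum>j=1..n. \<psi> ((f ^^ j) x)) / n"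
      if "1 \<le> n" "continuous_on UNIV \<psi>" for n and \<psi> :: "'a \<Rightarrow> real"
      unfolding empiric_measure_def
      by (simp add: integral_average_measure[OF compact_UNIV that(1) _ that(2)] integral_return_borel[OF that(2)])
    have diff: "\<bar>(\<integral>y. \<phi> (f y) \<partial>empiric_measure f n x) - (\<integral>y. \<phi> y \<partial>empiric_measure f n x)\<bar> \<le> 2 * B / n" if n: "1 \<le> n" for n
    proof -
      have "(\<Sum>j=1..n. \<phi> (f ((f ^^ j) x)) - \<phi> ((f ^^ j) x)) = \<phi> ((f ^^ Suc n) x) - \<phi> ((f ^^ 1) x)"
        using sum_Suc_diff[of 1 n "\<lambda>j. \<phi> ((f ^^ j) x)"] n by simp
      then have "(\<integral>y. \<phi> (f y) \<partial>empiric_measure f n x) - (\<integral>y. \<phi> y \<partial>empiric_measure f n x) = (\<phi> ((f ^^ Suc n) x) - \<phi> ((f ^^ 1) x)) / n"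
        unfolding int[OF n \<phi>] int[OF n \<phi>f] by (simp add: sum_subtractf flip: diff_divide_distrib)
      moreover have "\<bar>\<phi> ((f ^^ Suc n) x) - \<phi> ((f ^^ 1) x)\<bar> \<le> 2 * B"
        using B(2)[of "(f ^^ Suc n) x"] B(2)[of "(f ^^ 1) x"] unfolding real_norm_def by linarith
      ultimately show ?thesis by (simp add: divide_right_mono)
    qed
    have rge: "i \<le> r i" for i by (rule seq_suble[OF r])
    have "(\<lambda>i. (\<integral>y. \<phi> (f y) \<partial>empiric_measure f (r i) x) - (\<integral>y. \<phi> y \<partial>empiric_measure f (r i) x)) \<longlonglongrightarrow> 0"
    proof (rule Lim_null_comparison[where g="\<lambda>i. 2 * B / real i"])
      show "\<forall>\<^sub>F i in sequentially. norm ((\<integral>y. \<phi> (f y) \<partial>empiric_measure f (r i) x) - (\<integral>y. \<phi> y \<partial>empiric_measure f (r i) x)) \<le> 2 * B / real i"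
        using eventually_ge_at_top[of 1]
      proof eventually_elim
        case (elim i)
        have "1 \<le> r i" using elim rge[of i] by simp
        from diff[OF this] have "norm ((\<integral>y. \<phi> (f y) \<partial>empiric_measure f (r i) x) - (\<integral>y. \<phi> y \<partial>empiric_measure f (r i) x)) \<le> 2 * B / r i" by simp
        also have "\<dots> \<le> 2 * B / real i" using rge[of i] elim B(1) by (intro divide_left_mono) auto
        finally show ?case .
      qed
      show "(\<lambda>i. 2 * B / real i) \<longlonglongrightarrow> 0" by (rule lim_const_over_n)
    qed
    moreover have "(\<lambda>i. (\<integral>y. \<phi> (f y) \<partial>empiric_measure f (r i) x) - (\<integral>y. \<phi> y \<partial>empiric_measure f (r i) x)) \<longlonglongrightarrow> (\<integral>y. \<phi> (f y) \<partial>l) - (\<integral>y. \<phi> y \<partial>l)"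
      by (intro tendsto_diff limitin_weak_starD[OF compact_UNIV lim] \<phi> \<phi>f)
    ultimately show "(\<integral>x. \<phi> x \<partial>distr l borel f) = (\<integral>x. \<phi> x \<partial>l)"
      using LIMSEQ_unique by (fastforce simp: integral_distr_f[OF l \<phi>])
  qed
  then show "l \<in> invariant_measures f" using l by (simp add: invariant_measures_def)
qed

end

section \<open>Limit sets and stability basins\<close>

locale metrized_noisy_dynamics = noisy_dynamics +
  fixes ds :: "'a measure \<Rightarrow> 'a measure \<Rightarrow> real"
  assumes metrizes: "metrizes_weak_star ds"
begin

sublocale ds: Metric_space prob_measures ds
  using metrizes by (simp add: metrizes_weak_star_def)

lemma mtopology_eq: "ds.mtopology = weak_star"
  using metrizes by (simp add: metrizes_weak_star_def)

abbreviation \<sigma> :: "nat \<Rightarrow> 'a \<Rightarrow> 'a measure" where "\<sigma> \<equiv> empiric_measure f"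
abbreviation \<sigma>\<^sub>\<epsilon> :: "real \<Rightarrow> nat \<Rightarrow> 'a \<Rightarrow> 'a measure" where "\<sigma>\<^sub>\<epsilon> \<equiv> empiric_stochastic \<A> g m f"

lemma weak_star_limit_dist:
  assumes "limitin weak_star \<mu> l F"
  shows "((\<lambda>i. ds (\<mu> i) l) \<longlongrightarrow> 0) F"
  using assms unfolding mtopology_eq[symmetric] ds.limitin_metric_dist_null by blast

lemma tendsto_ds:
  assumes "limitin weak_star \<mu> l F" "\<nu> \<in> prob_measures"
  shows "((\<lambda>i. ds (\<mu> i) \<nu>) \<longlongrightarrow> ds l \<nu>) F"
proof -
  have "((\<lambda>i. ds (\<mu> i) \<nu> - ds l \<nu>) \<longlongrightarrow> 0) F"
  proof (rule Lim_null_comparison[OF _ weak_star_limit_dist[OF assms(1)]])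
    have l: "l \<in> prob_measures" using limitin_topspace[OF assms(1)] by simp
    have "\<forall>\<^sub>F i in F. \<mu> i \<in> prob_measures"
      using assms(1) unfolding limitin_weak_star_iff[OF compact_UNIV] by blast
    then show "\<forall>\<^sub>F i in F. norm (ds (\<mu> i) \<nu> - ds l \<nu>) \<le> ds (\<mu> i) l"
    proof eventually_elim
      case (elim i)
      show ?case using ds.mdist_reverse_triangle[OF elim assms(2) l] ds.commute
        by (simp add: ds.commute)
    qed
  qed
  then show ?thesis by (rule LIM_zero_cancel)
qed

lemma compactin_prob_measures: "compactin weak_star (prob_measures :: 'a measure set)"
  unfolding mtopology_eq[symmetric] ds.compactin_sequentially
proof (intro conjI allI impI order_refl)
  fix \<mu> :: "nat \<Rightarrow> 'a measure" assume "range \<mu> \<subseteq> prob_measures"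
  then obtain l r where "l \<in> prob_measures" "strict_mono (r :: nat \<Rightarrow> nat)" "limitin weak_star (\<mu> \<circ> r) l sequentially"
    using prob_measures_convergent_subsequence[OF compact_UNIV, of \<mu>] by blast
  then show "\<exists>l r. l \<in> prob_measures \<and> strict_mono r \<and> limitin ds.mtopology (\<mu> \<circ> r) l sequentially"
    unfolding mtopology_eq by blast
qed

lemma closedin_sequential:
  assumes "closedin weak_star C" "limitin weak_star \<mu> l sequentially" "\<And>i. \<mu> i \<in> C"
  shows "l \<in> C"
  using limitin_closedin[OF assms(2,1)] assms(3) by simp

lemma closedin_if_sequentially_closed:
  fixes C :: "'a measure set"
  assumes "C \<subseteq> prob_measures"
    and "\<And>\<mu> l. (\<And>i. \<mu> i \<in> C) \<Longrightarrow> limitin weak_star \<mu> l sequentially \<Longrightarrow> l \<in> C"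
  shows "closedin weak_star C"
  unfolding ds.metric_closedin_iff_sequentially_closed[unfolded mtopology_eq]
proof (intro conjI allI impI assms(1))
  fix \<mu> l assume lim: "range \<mu> \<subseteq> C \<and> limitin weak_star \<mu> l sequentially"
  show "l \<in> C"
  proof (rule assms(2))
    show "limitin weak_star \<mu> l sequentially" using lim by (rule conjunct2)
    show "\<mu> i \<in> C" for i using conjunct1[OF lim] by (rule range_subsetD)
  qed
qed

lemma compactin_closed_subset: "closedin weak_star (C :: 'a measure set) \<Longrightarrow> compactin weak_star C"
  by (rule closed_compactin[OF compactin_prob_measures]) (use closedin_subset[of weak_star C] in simp)

lemma closedin_compact: "compactin weak_star (C :: 'a measure set) \<Longrightarrow> closedin weak_star C"
  by (rule compactin_imp_closedin[OF ds.Hausdorff_space_mtopology[unfolded mtopology_eq]])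

lemma p_omega_prob: "l \<in> p_omega f x \<Longrightarrow> l \<in> prob_measures"
  using p_omega_invariant unfolding invariant_measures_def by blast

text \<open>
  The form in which compactness is used: a property of the orbit that recurs at arbitrarily late times
  is realized along a subsequence converging to a point of the limit set.
\<close>

lemma p_omega_limit_of_frequent:
  assumes "\<And>N. \<exists>n\<ge>N. P n"
  shows "\<exists>l r. l \<in> p_omega f x \<and> (\<forall>i::nat. P (r i)) \<and> limitin weak_star (\<lambda>i. \<sigma> (r i) x) l sequentially"
proof -
  have "infinite {n. 1 \<le> n \<and> P n}"
    unfolding infinite_nat_iff_unbounded_le
  proof
    fix N
    obtain n where "n \<ge> max N 1" "P n" using assms by blast
    then show "\<exists>n\<ge>N. n \<in> {n. 1 \<le> n \<and> P n}" by auto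
  qed
  then obtain q :: "nat \<Rightarrow> nat" where q: "strict_mono q" "\<And>i. q i \<in> {n. 1 \<le> n \<and> P n}"
    using infinite_enumerate by blast
  have "\<sigma> (q i) x \<in> prob_measures" for i using q(2)[of i] empiric_measure_prob by simp
  then obtain l r where l: "l \<in> prob_measures" "strict_mono (r :: nat \<Rightarrow> nat)"
      "limitin weak_star ((\<lambda>i. \<sigma> (q i) x) \<circ> r) l sequentially"
    using prob_measures_convergent_subsequence[OF compact_UNIV, of "\<lambda>i. \<sigma> (q i) x"] by blast
  have qr: "strict_mono (q \<circ> r)" using q(1) l(2) by (rule strict_mono_o)
  have lim: "limitin weak_star (\<lambda>i. \<sigma> ((q \<circ> r) i) x) l sequentially" using l(3) by (simp add: o_def)
  have "l \<in> p_omega f x" unfolding p_omega_def using qr lim by blast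
  moreover have "P ((q \<circ> r) i)" for i using q(2) by simp
  ultimately show ?thesis using lim by blast
qed

lemma p_omega_nonempty: "p_omega f x \<noteq> {}"
proof -
  have "\<exists>n\<ge>N. True" for N :: nat by blast
  from p_omega_limit_of_frequent[OF this, of x] show ?thesis by blast
qed

lemma measure_set_dist_less_iff:
  assumes "P \<noteq> {}" "Q \<noteq> {}"
  shows "measure_set_dist ds P Q < \<rho> \<longleftrightarrow> (\<exists>\<mu>\<in>P. \<exists>\<nu>\<in>Q. ds \<mu> \<nu> < \<rho>)"
proof -
  let ?S = "{ds \<mu> \<nu> |\<mu> \<nu>. \<mu> \<in> P \<and> \<nu> \<in> Q}"
  have bdd: "bdd_below ?S" by (rule bdd_belowI[of _ 0]) auto
  have ne: "?S \<noteq> {}" using assms by auto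
  have "Inf ?S < \<rho> \<longleftrightarrow> (\<exists>d\<in>?S. d < \<rho>)" by (rule cInf_less_iff[OF ne bdd])
  also have "\<dots> \<longleftrightarrow> (\<exists>\<mu>\<in>P. \<exists>\<nu>\<in>Q. ds \<mu> \<nu> < \<rho>)" by auto
  finally show ?thesis unfolding measure_set_dist_def .
qed

text \<open>
  If uniformity failed, there would be starting points \<open>x i\<close> and noise levels \<open>\<epsilon> i \<rightarrow> 0\<close> with a distance
  of at least \<open>\<rho>\<close>. Along a subsequence with \<open>x i \<rightarrow> z\<close>, both measures converge to \<open>\<sigma> n z\<close>.
\<close>

lemma empiric_stochastic_uniformly_close:
  assumes n: "1 \<le> n" and \<rho>: "0 < \<rho>"
  shows "\<exists>\<epsilon>\<^sub>0>0. \<forall>\<epsilon> x. 0 < \<epsilon> \<and> \<epsilon> \<le> \<epsilon>\<^sub>0 \<longrightarrow> ds (\<sigma>\<^sub>\<epsilon> \<epsilon> n x) (\<sigma> n x) < \<rho>"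
proof (rule ccontr)
  assume neg: "\<not> ?thesis"
  have "\<exists>\<epsilon> x. 0 < \<epsilon> \<and> \<epsilon> \<le> inverse (Suc i) \<and> \<rho> \<le> ds (\<sigma>\<^sub>\<epsilon> \<epsilon> n x) (\<sigma> n x)" for i :: nat
  proof -
    have "0 < inverse (real (Suc i))" by simp
    then show ?thesis using neg by (meson not_less)
  qed
  then obtain \<epsilon> x where ex: "\<And>i. 0 < \<epsilon> i" "\<And>i. \<epsilon> i \<le> inverse (Suc i)"
      "\<And>i. \<rho> \<le> ds (\<sigma>\<^sub>\<epsilon> (\<epsilon> i) n (x i)) (\<sigma> n (x i))" by metis
  have "seq_compact (UNIV :: 'a set)" using compact_UNIV compact_imp_seq_compact by blast
  then obtain z q where q: "strict_mono (q :: nat \<Rightarrow> nat)" "(x \<circ> q) \<longlonglongrightarrow> z"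
    unfolding seq_compact_def by blast
  have "\<epsilon> \<longlonglongrightarrow> 0"
    by (rule tendsto_sandwich[OF _ _ tendsto_const LIMSEQ_inverse_real_of_nat])
      (use ex in \<open>auto intro!: always_eventually less_imp_le\<close>)
  then have \<epsilon>q: "(\<epsilon> \<circ> q) \<longlonglongrightarrow> 0" using q(1) by (rule LIMSEQ_subseq_LIMSEQ)
  have pos: "0 < (\<epsilon> \<circ> q) i" for i using ex(1) by simp
  have "(\<lambda>i. ds (\<sigma>\<^sub>\<epsilon> ((\<epsilon> \<circ> q) i) n ((x \<circ> q) i)) (\<sigma> n z) + ds (\<sigma> n ((x \<circ> q) i)) (\<sigma> n z)) \<longlonglongrightarrow> 0 + 0"
    by (intro tendsto_add weak_star_limit_dist limitin_empiric_stochastic[OF \<epsilon>q pos q(2) n]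
        limitin_empiric_measure[OF q(2) n])
  then have "\<forall>\<^sub>F i in sequentially. ds (\<sigma>\<^sub>\<epsilon> ((\<epsilon> \<circ> q) i) n ((x \<circ> q) i)) (\<sigma> n z) + ds (\<sigma> n ((x \<circ> q) i)) (\<sigma> n z) < \<rho>"
    using \<rho> by (auto dest: order_tendstoD)
  then obtain i where i: "ds (\<sigma>\<^sub>\<epsilon> (\<epsilon> (q i)) n (x (q i))) (\<sigma> n z) + ds (\<sigma> n (x (q i))) (\<sigma> n z) < \<rho>"
    by (auto simp: eventually_sequentially)
  have "ds (\<sigma>\<^sub>\<epsilon> (\<epsilon> (q i)) n (x (q i))) (\<sigma> n (x (q i))) \<le> ds (\<sigma>\<^sub>\<epsilon> (\<epsilon> (q i)) n (x (q i))) (\<sigma> n z) + ds (\<sigma> n (x (q i))) (\<sigma> n z)"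
    by (intro ds.triangle' empiric_stochastic_prob empiric_measure_prob n ex(1))
  then show False using ex(3)[of "q i"] i by linarith
qed

lemma p_omega_subset_iff:
  assumes K: "compactin weak_star K" "K \<noteq> {}"
  shows "p_omega f x \<subseteq> K \<longleftrightarrow> (\<forall>\<rho>>0. \<exists>N>0. \<forall>n\<ge>N. \<exists>\<nu>\<in>K. ds (\<sigma> n x) \<nu> < \<rho>)"
proof (intro iffI allI impI subsetI)
  fix \<rho> :: real assume sub: "p_omega f x \<subseteq> K" and \<rho>: "0 < \<rho>"
  show "\<exists>N>0. \<forall>n\<ge>N. \<exists>\<nu>\<in>K. ds (\<sigma> n x) \<nu> < \<rho>"
  proof (rule ccontr)
    assume neg: "\<not> ?thesis"
    have "\<exists>n\<ge>N. \<forall>\<nu>\<in>K. \<not> ds (\<sigma> n x) \<nu> < \<rho>" for N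
      using neg by (metis Suc_le_D Suc_leD zero_less_Suc)
    from p_omega_limit_of_frequent[OF this, of x] obtain l r where
      l: "l \<in> p_omega f x" "\<forall>i::nat. \<forall>\<nu>\<in>K. \<not> ds (\<sigma> (r i) x) \<nu> < \<rho>"
        "limitin weak_star (\<lambda>i. \<sigma> (r i) x) l sequentially" by blast
    have "l \<in> K" using sub l(1) by blast
    have "\<forall>\<^sub>F i in sequentially. ds (\<sigma> (r i) x) l < \<rho>"
      using order_tendstoD(2)[OF weak_star_limit_dist[OF l(3)] \<rho>] .
    then obtain i where "ds (\<sigma> (r i) x) l < \<rho>" by (auto simp: eventually_sequentially)
    then show False using l(2) \<open>l \<in> K\<close> by blast
  qed
next
  fix l assume approx: "\<forall>\<rho>>0. \<exists>N>0. \<forall>n\<ge>N. \<exists>\<nu>\<in>K. ds (\<sigma> n x) \<nu> < \<rho>" and l: "l \<in> p_omega f x"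
  then obtain r where r: "strict_mono (r :: nat \<Rightarrow> nat)"
    and lim: "limitin weak_star (\<lambda>i. \<sigma> (r i) x) l sequentially"
    unfolding p_omega_def by blast
  have Kp: "K \<subseteq> prob_measures" using compactin_subset_topspace[OF K(1)] by simp
  show "l \<in> K"
  proof (rule ccontr)
    assume "l \<notin> K"
    then obtain \<rho> where \<rho>: "0 < \<rho>" "disjnt K (ds.mball l \<rho>)"
      using closedin_compact[OF K(1)] p_omega_prob[OF l]
      unfolding mtopology_eq[symmetric] ds.closedin_metric by blast
    then have "0 < \<rho>/2" by simp
    then obtain N where N: "0 < N" "\<And>n. n \<ge> N \<Longrightarrow> \<exists>\<nu>\<in>K. ds (\<sigma> n x) \<nu> < \<rho>/2" using approx by blast
    have "\<forall>\<^sub>F i in sequentially. ds (\<sigma> (r i) x) l < \<rho>/2"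
      using order_tendstoD(2)[OF weak_star_limit_dist[OF lim] \<open>0 < \<rho>/2\<close>] .
    then have "\<forall>\<^sub>F i in sequentially. i \<ge> N \<and> ds (\<sigma> (r i) x) l < \<rho>/2"
      using eventually_ge_at_top[of N] by eventually_elim simp
    then obtain i where i: "i \<ge> N" "ds (\<sigma> (r i) x) l < \<rho>/2"
      using eventually_happens'[OF sequentially_bot] by blast
    have ri: "r i \<ge> N" using seq_suble[OF r, of i] i(1) by simp
    then obtain \<nu> where \<nu>: "\<nu> \<in> K" "ds (\<sigma> (r i) x) \<nu> < \<rho>/2" using N(2) by blast
    have "ds l \<nu> \<le> ds (\<sigma> (r i) x) l + ds (\<sigma> (r i) x) \<nu>"
      using ds.triangle''[OF p_omega_prob[OF l] empiric_measure_prob[of "r i" x], of \<nu>] \<nu>(1) Kp ri N(1) by auto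
    then have "\<nu> \<in> ds.mball l \<rho>" using i(2) \<nu> p_omega_prob[OF l] Kp by (auto simp: ds.in_mball)
    then show False using \<rho>(2) \<nu>(1) by (auto simp: disjnt_def)
  qed
qed

text \<open>
  In the definition of the basin \<open>\<epsilon>\<close> may depend on \<open>n\<close>, so each noisy average may be replaced by the
  deterministic one at the cost of \<open>\<rho>/2\<close>, in both directions.
\<close>

lemma stability_basin_iff:
  assumes K: "compactin weak_star K" "K \<noteq> {}"
  shows "x \<in> stability_basin \<A> g m f ds K \<longleftrightarrow> p_omega f x \<subseteq> K"
proof -
  have Kp: "K \<subseteq> prob_measures" using compactin_subset_topspace[OF K(1)] by simp
  have dist: "measure_set_dist ds {\<mu>} K < \<rho> \<longleftrightarrow> (\<exists>\<nu>\<in>K. ds \<mu> \<nu> < \<rho>)" for \<mu> \<rho>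
    by (subst measure_set_dist_less_iff) (use K in auto)
  show ?thesis
    unfolding p_omega_subset_iff[OF K] stability_basin_def mem_Collect_eq dist
  proof (intro iffI allI impI)
    fix \<rho> :: real assume L: "\<forall>\<rho>>0. \<exists>N>0. \<forall>n\<ge>N. \<exists>\<epsilon>\<^sub>0>0. \<forall>\<epsilon>. 0 < \<epsilon> \<and> \<epsilon> \<le> \<epsilon>\<^sub>0 \<longrightarrow> (\<exists>\<nu>\<in>K. ds (\<sigma>\<^sub>\<epsilon> \<epsilon> n x) \<nu> < \<rho>)"
      and \<rho>: "0 < \<rho>"
    then have \<rho>2: "0 < \<rho>/2" by simp
    with L obtain N where N: "N > 0" "\<And>n. n \<ge> N \<Longrightarrow> \<exists>\<epsilon>\<^sub>0>0. \<forall>\<epsilon>. 0 < \<epsilon> \<and> \<epsilon> \<le> \<epsilon>\<^sub>0 \<longrightarrow> (\<exists>\<nu>\<in>K. ds (\<sigma>\<^sub>\<epsilon> \<epsilon> n x) \<nu> < \<rho>/2)"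
      by blast
    have "\<exists>\<nu>\<in>K. ds (\<sigma> n x) \<nu> < \<rho>" if nN: "n \<ge> N" for n
    proof -
      have n: "1 \<le> n" using nN N(1) by simp
      obtain a where a: "0 < a" "\<And>\<epsilon>. 0 < \<epsilon> \<and> \<epsilon> \<le> a \<Longrightarrow> (\<exists>\<nu>\<in>K. ds (\<sigma>\<^sub>\<epsilon> \<epsilon> n x) \<nu> < \<rho>/2)" using N(2)[OF nN] by blast
      obtain b where b: "0 < b" "\<And>\<epsilon> x. 0 < \<epsilon> \<and> \<epsilon> \<le> b \<Longrightarrow> ds (\<sigma>\<^sub>\<epsilon> \<epsilon> n x) (\<sigma> n x) < \<rho>/2"
        using empiric_stochastic_uniformly_close[OF n \<rho>2] by blast
      define \<epsilon> where "\<epsilon> = min a b"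
      have \<epsilon>: "0 < \<epsilon>" "\<epsilon> \<le> a" "\<epsilon> \<le> b" using a(1) b(1) by (auto simp: \<epsilon>_def)
      obtain \<nu> where \<nu>: "\<nu> \<in> K" "ds (\<sigma>\<^sub>\<epsilon> \<epsilon> n x) \<nu> < \<rho>/2" using a(2)[of \<epsilon>] \<epsilon> by blast
      have "ds (\<sigma> n x) \<nu> \<le> ds (\<sigma>\<^sub>\<epsilon> \<epsilon> n x) (\<sigma> n x) + ds (\<sigma>\<^sub>\<epsilon> \<epsilon> n x) \<nu>"
        using ds.triangle''[OF empiric_measure_prob[OF n] empiric_stochastic_prob[OF n \<epsilon>(1)]] \<nu>(1) Kp by blast
      then show ?thesis using \<nu> b(2)[OF conjI[OF \<epsilon>(1,3)], of x] by (intro bexI[of _ \<nu>]) linarith+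
    qed
    then show "\<exists>N>0. \<forall>n\<ge>N. \<exists>\<nu>\<in>K. ds (\<sigma> n x) \<nu> < \<rho>" using N(1) by blast
  next
    fix \<rho> :: real assume R: "\<forall>\<rho>>0. \<exists>N>0. \<forall>n\<ge>N. \<exists>\<nu>\<in>K. ds (\<sigma> n x) \<nu> < \<rho>" and \<rho>: "0 < \<rho>"
    then have \<rho>2: "0 < \<rho>/2" by simp
    with R obtain N where N: "N > 0" "\<And>n. n \<ge> N \<Longrightarrow> \<exists>\<nu>\<in>K. ds (\<sigma> n x) \<nu> < \<rho>/2" by blast
    have "\<exists>\<epsilon>\<^sub>0>0. \<forall>\<epsilon>. 0 < \<epsilon> \<and> \<epsilon> \<le> \<epsilon>\<^sub>0 \<longrightarrow> (\<exists>\<nu>\<in>K. ds (\<sigma>\<^sub>\<epsilon> \<epsilon> n x) \<nu> < \<rho>)" if nN: "n \<ge> N" for n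
    proof -
      have n: "1 \<le> n" using nN N(1) by simp
      obtain \<nu> where \<nu>: "\<nu> \<in> K" "ds (\<sigma> n x) \<nu> < \<rho>/2" using N(2)[OF nN] by blast
      obtain b where b: "0 < b" "\<And>\<epsilon> x. 0 < \<epsilon> \<and> \<epsilon> \<le> b \<Longrightarrow> ds (\<sigma>\<^sub>\<epsilon> \<epsilon> n x) (\<sigma> n x) < \<rho>/2"
        using empiric_stochastic_uniformly_close[OF n \<rho>2] by blast
      have "\<exists>\<nu>\<in>K. ds (\<sigma>\<^sub>\<epsilon> \<epsilon> n x) \<nu> < \<rho>" if \<epsilon>: "0 < \<epsilon> \<and> \<epsilon> \<le> b" for \<epsilon>
      proof -
        have "ds (\<sigma>\<^sub>\<epsilon> \<epsilon> n x) \<nu> \<le> ds (\<sigma>\<^sub>\<epsilon> \<epsilon> n x) (\<sigma> n x) + ds (\<sigma> n x) \<nu>"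
          using ds.triangle[OF empiric_stochastic_prob[OF n] empiric_measure_prob[OF n], of \<epsilon> \<nu> x x] \<epsilon> \<nu>(1) Kp by blast
        then show ?thesis using \<nu> b(2)[OF \<epsilon>, of x] by (intro bexI[of _ \<nu>]) linarith+
      qed
      then show ?thesis using b(1) by blast
    qed
    then show "\<exists>N>0. \<forall>n\<ge>N. \<exists>\<epsilon>\<^sub>0>0. \<forall>\<epsilon>. 0 < \<epsilon> \<and> \<epsilon> \<le> \<epsilon>\<^sub>0 \<longrightarrow> (\<exists>\<nu>\<in>K. ds (\<sigma>\<^sub>\<epsilon> \<epsilon> n x) \<nu> < \<rho>)"
      using N(1) by blast
  qed
qed

lemma continuous_ds_empiric:
  assumes "1 \<le> n" "\<nu> \<in> prob_measures"
  shows "continuous_on UNIV (\<lambda>x. ds (\<sigma> n x) \<nu>)"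
  by (rule continuous_on_sequentiallyI) (intro tendsto_ds limitin_empiric_measure assms)

lemma weak_basin_iff: "x \<in> weak_basin f ds \<mu> \<rho> \<longleftrightarrow> (\<exists>l\<in>p_omega f x. ds l \<mu> < \<rho>)"
  unfolding weak_basin_def using measure_set_dist_less_iff[OF p_omega_nonempty, of "{\<mu>}"] by simp

text \<open>
  Being in the weak basin means that, for some \<open>k\<close>, the empiric measure comes closer to \<open>\<mu>\<close> than
  \<open>\<rho> - 1/(k+1)\<close> infinitely often; the margin keeps the limit strictly inside. This is a countable
  combination of open sets, as \<open>\<sigma> n x\<close> depends continuously on \<open>x\<close>.
\<close>

lemma weak_basin_measurable:
  assumes \<mu>: "\<mu> \<in> prob_measures"
  shows "weak_basin f ds \<mu> \<rho> \<in> sets m"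
proof -
  let ?S = "\<lambda>n k. {x. ds (\<sigma> n x) \<mu> < \<rho> - inverse (Suc k)}"
  have "weak_basin f ds \<mu> \<rho> = (\<Union>k. \<Inter>N. \<Union>n\<in>{max N 1..}. ?S n k)"
  proof (intro set_eqI iffI)
    fix x assume "x \<in> weak_basin f ds \<mu> \<rho>"
    then obtain l where l: "l \<in> p_omega f x" "ds l \<mu> < \<rho>" unfolding weak_basin_iff by blast
    obtain k where k: "inverse (Suc k) < \<rho> - ds l \<mu>" using reals_Archimedean[of "\<rho> - ds l \<mu>"] l(2) by auto
    obtain r where r: "strict_mono (r :: nat \<Rightarrow> nat)"
      and lim: "limitin weak_star (\<lambda>i. \<sigma> (r i) x) l sequentially"
      using l(1) unfolding p_omega_def by blast
    have "\<forall>\<^sub>F i in sequentially. ds (\<sigma> (r i) x) \<mu> < \<rho> - inverse (Suc k)"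
      by (rule order_tendstoD(2)[OF tendsto_ds[OF lim \<mu>]]) (use k in simp)
    then obtain M where M: "\<And>i. i \<ge> M \<Longrightarrow> ds (\<sigma> (r i) x) \<mu> < \<rho> - inverse (Suc k)" by (auto simp: eventually_sequentially)
    have "\<exists>n\<in>{max N 1..}. x \<in> ?S n k" for N
    proof (rule bexI[of _ "r (max M (max N 1))"])
      show "x \<in> ?S (r (max M (max N 1))) k" using M by simp
      show "r (max M (max N 1)) \<in> {max N 1..}" using seq_suble[OF r, of "max M (max N 1)"] by auto
    qed
    then show "x \<in> (\<Union>k. \<Inter>N. \<Union>n\<in>{max N 1..}. ?S n k)" by blast
  next
    fix x assume "x \<in> (\<Union>k. \<Inter>N. \<Union>n\<in>{max N 1..}. ?S n k)"
    then obtain k where k: "x \<in> (\<Inter>N. \<Union>n\<in>{max N 1..}. ?S n k)" by (rule UN_E)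
    have "\<exists>n\<ge>N. ds (\<sigma> n x) \<mu> < \<rho> - inverse (Suc k)" for N
    proof -
      have "x \<in> (\<Union>n\<in>{max N 1..}. ?S n k)" using k by (rule INT_D) simp
      then obtain n where "n \<in> {max N 1..}" "x \<in> ?S n k" by (rule UN_E)
      then show ?thesis by (intro exI[of _ n]) simp
    qed
    from p_omega_limit_of_frequent[OF this, of x] obtain l r where
      l: "l \<in> p_omega f x" "\<forall>i::nat. ds (\<sigma> (r i) x) \<mu> < \<rho> - inverse (Suc k)"
        "limitin weak_star (\<lambda>i. \<sigma> (r i) x) l sequentially" by blast
    have "ds l \<mu> \<le> \<rho> - inverse (Suc k)"
      by (rule LIMSEQ_le_const2[OF tendsto_ds[OF l(3) \<mu>]]) (rule exI[of _ 0], use l(2) in \<open>simp add: less_imp_le\<close>)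
    also have "\<dots> < \<rho>" by simp
    finally show "x \<in> weak_basin f ds \<mu> \<rho>" unfolding weak_basin_iff using l(1) by blast
  qed
  moreover have S: "?S n k \<in> sets m" if "n \<in> {max N 1..}" for n k N
    unfolding sets_m using that
    by (intro borel_open open_Collect_less continuous_ds_empiric \<mu> continuous_on_const) auto
  define T where "T N k = (\<Union>n\<in>{max N 1..}. ?S n k)" for N k
  have T: "T N k \<in> sets m" for N k
    unfolding T_def by (rule sets.countable_UN''[OF _ S]) auto
  have I: "(\<Inter>N. T N k) \<in> sets m" for k
    by (rule sets.countable_INT''[OF _ _ T]) (simp_all add: sets_m)
  have "(\<Union>k. \<Inter>N. T N k) \<in> sets m"
    by (rule sets.countable_UN''[OF _ I]) simp
  ultimately show ?thesis by (simp add: T_def)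
qed

section \<open>Pseudo-physical measures\<close>


abbreviation pseudo_physical_measures :: "'a measure set" where
  "pseudo_physical_measures \<equiv> {\<mu>. pseudo_physical m f ds \<mu>}"

lemma pseudo_physical_prob: "pseudo_physical m f ds \<mu> \<Longrightarrow> \<mu> \<in> prob_measures"
  unfolding pseudo_physical_def invariant_measures_def by blast

lemma closedin_invariant: "closedin weak_star (invariant_measures f)"
proof (rule closedin_if_sequentially_closed)
  fix \<mu> l assume \<mu>: "\<And>i. \<mu> i \<in> invariant_measures f" and lim: "limitin weak_star \<mu> l sequentially"
  have l: "l \<in> prob_measures" using limitin_topspace[OF lim] by simp
  have "distr l borel f = l"
  proof (rule prob_measures_eqI[OF compact_UNIV prob_measures_distr[OF l measurable_f] l])
    fix \<phi> :: "'a \<Rightarrow> real" assume \<phi>: "continuous_on UNIV \<phi>"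
    have \<phi>f: "continuous_on UNIV (\<lambda>x. \<phi> (f x))" using continuous_on_compose2[OF \<phi> continuous_f] by simp
    have "(\<integral>x. \<phi> (f x) \<partial>\<mu> i) = (\<integral>x. \<phi> x \<partial>\<mu> i)" for i
      using integral_distr_f[of "\<mu> i" \<phi>] \<mu>[of i] \<phi> by (simp add: invariant_measures_def)
    then show "(\<integral>x. \<phi> x \<partial>distr l borel f) = (\<integral>x. \<phi> x \<partial>l)"
      using limitin_weak_starD[OF compact_UNIV lim \<phi>f] limitin_weak_starD[OF compact_UNIV lim \<phi>]
      by (simp add: integral_distr_f[OF l \<phi>] LIMSEQ_unique)
  qed
  then show "l \<in> invariant_measures f" using l by (simp add: invariant_measures_def)
next
  show "invariant_measures f \<subseteq> prob_measures" unfolding invariant_measures_def by blast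
qed

text \<open>
  The weak basin of radius \<open>\<rho>\<close> around the limit contains that of radius \<open>\<rho>/2\<close> around a late term of the
  sequence.
\<close>

lemma closedin_pseudo_physical: "closedin weak_star pseudo_physical_measures"
proof (rule closedin_if_sequentially_closed)
  fix \<mu> l assume \<mu>: "\<And>i. \<mu> i \<in> pseudo_physical_measures" and lim: "limitin weak_star \<mu> l sequentially"
  have l: "l \<in> prob_measures" using limitin_topspace[OF lim] by simp
  have inv: "l \<in> invariant_measures f"
    using closedin_sequential[OF closedin_invariant lim] \<mu> by (auto simp: pseudo_physical_def)
  have "0 < emeasure m (weak_basin f ds l \<rho>)" if "0 < \<rho>" for \<rho>
  proof -
    have "\<forall>\<^sub>F i in sequentially. ds (\<mu> i) l < \<rho>/2"
      by (rule order_tendstoD(2)[OF weak_star_limit_dist[OF lim]]) (use that in simp)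
    then obtain i where i: "ds (\<mu> i) l < \<rho>/2" by (auto simp: eventually_sequentially)
    have "weak_basin f ds (\<mu> i) (\<rho>/2) \<subseteq> weak_basin f ds l \<rho>"
    proof
      fix x assume "x \<in> weak_basin f ds (\<mu> i) (\<rho>/2)"
      then obtain k where k: "k \<in> p_omega f x" "ds k (\<mu> i) < \<rho>/2" unfolding weak_basin_iff by blast
      have "ds k l \<le> ds k (\<mu> i) + ds (\<mu> i) l"
        using \<mu>[of i] by (intro ds.triangle p_omega_prob[OF k(1)] l pseudo_physical_prob) simp
      then have "ds k l < \<rho>" using i k(2) by simp
      then show "x \<in> weak_basin f ds l \<rho>" unfolding weak_basin_iff using k(1) by blast
    qed
    then have "emeasure m (weak_basin f ds (\<mu> i) (\<rho>/2)) \<le> emeasure m (weak_basin f ds l \<rho>)"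
      by (rule emeasure_mono) (rule weak_basin_measurable[OF l])
    moreover have "0 < emeasure m (weak_basin f ds (\<mu> i) (\<rho>/2))"
      using \<mu>[of i] that by (simp add: pseudo_physical_def)
    ultimately show ?thesis by simp
  qed
  then show "l \<in> pseudo_physical_measures" using inv by (simp add: pseudo_physical_def)
next
  show "pseudo_physical_measures \<subseteq> prob_measures" using pseudo_physical_prob by blast
qed

text \<open>
  Each point of \<open>C\<close> has a ball with a null weak basin; by compactness finitely many of them cover \<open>C\<close>, and
  an orbit accumulating in \<open>C\<close> starts in one of the finitely many null sets.
\<close>

lemma AE_p_omega_disjoint:
  assumes C: "compactin weak_star C" "C \<subseteq> invariant_measures f" "C \<inter> pseudo_physical_measures = {}"
  shows "AE x in m. p_omega f x \<inter> C = {}"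
proof -
  have Cp: "C \<subseteq> prob_measures" using compactin_subset_topspace[OF C(1)] by simp
  have "\<forall>\<mu>\<in>C. \<exists>\<rho>>0. emeasure m (weak_basin f ds \<mu> \<rho>) = 0"
  proof
    fix \<mu> assume "\<mu> \<in> C"
    then have "\<not> pseudo_physical m f ds \<mu>" "\<mu> \<in> invariant_measures f" using C(2,3) by auto
    then show "\<exists>\<rho>>0. emeasure m (weak_basin f ds \<mu> \<rho>) = 0"
      unfolding pseudo_physical_def by (auto simp: not_less)
  qed
  from bchoice[OF this] obtain \<rho> where \<rho>: "\<And>\<mu>. \<mu> \<in> C \<Longrightarrow> 0 < \<rho> \<mu>"
      "\<And>\<mu>. \<mu> \<in> C \<Longrightarrow> emeasure m (weak_basin f ds \<mu> (\<rho> \<mu>)) = 0" by blast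
  have "\<exists>\<F>. finite \<F> \<and> \<F> \<subseteq> (\<lambda>\<mu>. ds.mball \<mu> (\<rho> \<mu>)) ` C \<and> C \<subseteq> \<Union>\<F>"
  proof (rule compactinD[OF C(1)])
    show "\<And>U. U \<in> (\<lambda>\<mu>. ds.mball \<mu> (\<rho> \<mu>)) ` C \<Longrightarrow> openin weak_star U"
      unfolding mtopology_eq[symmetric] by auto
    show "C \<subseteq> \<Union>((\<lambda>\<mu>. ds.mball \<mu> (\<rho> \<mu>)) ` C)" using \<rho>(1) Cp by (auto simp: ds.in_mball)
  qed
  then obtain \<F> where \<F>: "finite \<F>" "\<F> \<subseteq> (\<lambda>\<mu>. ds.mball \<mu> (\<rho> \<mu>)) ` C" "C \<subseteq> \<Union>\<F>" by blast
  from finite_subset_image[OF this(1,2)] \<F>(3)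
  obtain F where F: "F \<subseteq> C" "finite F" "C \<subseteq> (\<Union>\<mu>\<in>F. ds.mball \<mu> (\<rho> \<mu>))" by auto
  have "AE x in m. \<forall>\<mu>\<in>F. x \<notin> weak_basin f ds \<mu> (\<rho> \<mu>)"
  proof (rule AE_finite_allI[OF F(2)])
    fix \<mu> assume "\<mu> \<in> F"
    then have "weak_basin f ds \<mu> (\<rho> \<mu>) \<in> null_sets m"
      using F(1) \<rho>(2) Cp weak_basin_measurable by (intro null_setsI) auto
    then show "AE x in m. x \<notin> weak_basin f ds \<mu> (\<rho> \<mu>)" by (rule AE_not_in)
  qed
  then show ?thesis
  proof (rule AE_mp[OF _ AE_I2], intro impI)
    fix x assume x: "\<forall>\<mu>\<in>F. x \<notin> weak_basin f ds \<mu> (\<rho> \<mu>)"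
    show "p_omega f x \<inter> C = {}"
    proof (rule ccontr)
      assume "p_omega f x \<inter> C \<noteq> {}"
      then obtain l where l: "l \<in> p_omega f x" "l \<in> C" by blast
      then obtain \<mu> where "\<mu> \<in> F" "l \<in> ds.mball \<mu> (\<rho> \<mu>)" using F(3) by blast
      then have "ds l \<mu> < \<rho> \<mu>" using ds.commute[of l \<mu>] by (simp add: ds.in_mball)
      then show False using x l(1) \<open>\<mu> \<in> F\<close> unfolding weak_basin_iff by blast
    qed
  qed
qed

lemma emeasure_zero_if_AE_not_in:
  assumes "A \<in> sets m" "AE x in m. x \<notin> A"
  shows "emeasure m A = 0"
  using AE_iff_measurable[OF assms(1), of "\<lambda>x. x \<notin> A"] assms(2) by (simp add: space_m)

lemma not_AE_False: "\<not> (AE x in m. False)"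
proof
  assume "AE x in m. False"
  then have "emeasure m UNIV = 0" by (intro emeasure_zero_if_AE_not_in) (simp_all add: sets_m)
  then show False using positive_m[of UNIV] by simp
qed

lemma pseudo_physical_nonempty: "pseudo_physical_measures \<noteq> {}"
proof
  assume "pseudo_physical_measures = {}"
  then have "AE x in m. p_omega f x \<inter> invariant_measures f = {}"
    by (intro AE_p_omega_disjoint compactin_closed_subset closedin_invariant) auto
  then have "AE x in m. False"
    by (rule AE_mp[OF _ AE_I2]) (use p_omega_nonempty p_omega_invariant in blast)
  then show False using not_AE_False by simp
qed

text \<open>
  The invariant measures outside the union \<open>?V k\<close> of the balls of radius \<open>1/(k+1)\<close> around the
  pseudo-physical ones form a compact set that misses the latter; these neighbourhoods shrink to the
  closed set of pseudo-physical measures.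
\<close>

lemma AE_p_omega_pseudo_physical: "AE x in m. p_omega f x \<subseteq> pseudo_physical_measures"
proof -
  let ?K = pseudo_physical_measures
  let ?V = "\<lambda>k. \<Union>\<mu>\<in>?K. ds.mball \<mu> (inverse (Suc k))"
  have "AE x in m. p_omega f x \<inter> (invariant_measures f - ?V k) = {}" for k
  proof (rule AE_p_omega_disjoint)
    have "openin weak_star (?V k)" unfolding mtopology_eq[symmetric] by (intro openin_Union) auto
    then show "compactin weak_star (invariant_measures f - ?V k)"
      by (intro compactin_closed_subset closedin_diff closedin_invariant)
    show "(invariant_measures f - ?V k) \<inter> ?K = {}"
      using pseudo_physical_prob by (force simp: ds.in_mball)
  qed auto
  then have "AE x in m. \<forall>k. p_omega f x \<inter> (invariant_measures f - ?V k) = {}"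
    by (simp add: AE_all_countable)
  then show ?thesis
  proof (rule AE_mp[OF _ AE_I2], intro impI subsetI)
    fix x l assume x: "\<forall>k. p_omega f x \<inter> (invariant_measures f - ?V k) = {}" and l: "l \<in> p_omega f x"
    have near: "l \<in> ?V k" for k using x l p_omega_invariant by blast
    show "l \<in> ?K"
    proof (rule ccontr)
      assume "l \<notin> ?K"
      then obtain \<rho> where \<rho>: "0 < \<rho>" "disjnt ?K (ds.mball l \<rho>)"
        using closedin_pseudo_physical p_omega_prob[OF l]
        unfolding mtopology_eq[symmetric] ds.closedin_metric by blast
      obtain k where k: "inverse (real (Suc k)) < \<rho>" using reals_Archimedean[OF \<rho>(1)] by blast
      obtain \<mu> where \<mu>: "\<mu> \<in> ?K" "l \<in> ds.mball \<mu> (inverse (Suc k))" using near[of k] by blast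
      then have "\<mu> \<in> ds.mball l \<rho>" using k ds.commute[of l \<mu>] by (auto simp: ds.in_mball)
      then show False using \<rho>(2) \<mu>(1) by (auto simp: disjnt_def)
    qed
  qed
qed

text \<open>
  A pseudo-physical measure outside \<open>K\<close> would have a ball disjoint from \<open>K\<close> that meets the limit sets
  of a set of points of positive measure.
\<close>

lemma pseudo_physical_minimal:
  assumes K: "compactin weak_star K" and AE: "AE x in m. p_omega f x \<subseteq> K"
  shows "pseudo_physical_measures \<subseteq> K"
proof (rule ccontr)
  assume "\<not> ?thesis"
  then obtain \<mu> where \<mu>: "pseudo_physical m f ds \<mu>" "\<mu> \<notin> K" by blast
  then obtain \<rho> where \<rho>: "0 < \<rho>" "disjnt K (ds.mball \<mu> \<rho>)"
    using closedin_compact[OF K] pseudo_physical_prob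
    unfolding mtopology_eq[symmetric] ds.closedin_metric by blast
  have "AE x in m. x \<notin> weak_basin f ds \<mu> \<rho>"
    using AE
  proof (rule AE_mp[OF _ AE_I2], intro impI notI)
    fix x assume x: "p_omega f x \<subseteq> K" "x \<in> weak_basin f ds \<mu> \<rho>"
    then obtain l where l: "l \<in> p_omega f x" "ds l \<mu> < \<rho>" unfolding weak_basin_iff by blast
    then have "l \<in> ds.mball \<mu> \<rho>"
      using p_omega_prob pseudo_physical_prob[OF \<mu>(1)] ds.commute[of l \<mu>] by (simp add: ds.in_mball)
    then show False using \<rho>(2) x(1) l(1) by (auto simp: disjnt_def)
  qed
  then have "emeasure m (weak_basin f ds \<mu> \<rho>) = 0"
    by (intro emeasure_zero_if_AE_not_in weak_basin_measurable pseudo_physical_prob[OF \<mu>(1)])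
  moreover have "0 < emeasure m (weak_basin f ds \<mu> \<rho>)"
    using \<mu>(1) \<rho>(1) by (simp add: pseudo_physical_def)
  ultimately show False by simp
qed

text \<open>
  Egorov's argument. The set \<open>E k N\<close> of the points that are still \<open>1/(k+1)\<close> away from \<open>K\<close> at some time
  after \<open>N\<close> decreases to a null set as \<open>N\<close> grows. Removing for each \<open>k\<close> such a set of measure below
  \<open>(1/2)^(k+1)\<close> times half the total volume leaves a set of positive measure.
\<close>

lemma uniformly_attracted_set:
  assumes K: "compactin weak_star K" "K \<noteq> {}" and AE: "AE x in m. p_omega f x \<subseteq> K"
  obtains A where "A \<in> sets m" "0 < emeasure m A"
    "\<And>\<rho>. 0 < \<rho> \<Longrightarrow> \<exists>N>0. \<forall>n\<ge>N. \<forall>x\<in>A. \<exists>\<nu>\<in>K. ds (\<sigma> n x) \<nu> < \<rho>"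
proof -
  have Kp: "K \<subseteq> prob_measures" using compactin_subset_topspace[OF K(1)] by simp
  define G where "G k n = (\<Union>\<nu>\<in>K. {x. ds (\<sigma> n x) \<nu> < inverse (real (Suc k))})" for k n
  have Gopen: "open (G k n)" if "1 \<le> n" for k n
    unfolding G_def using that Kp
    by (intro open_UN ballI open_Collect_less continuous_ds_empiric continuous_on_const) auto
  define E where "E k N = (\<Union>n\<in>{Suc N..}. - G k n)" for k N
  have Esets: "E k N \<in> sets m" for k N
    unfolding E_def sets_m using Gopen by (intro sets.countable_UN'') auto
  have Elim: "(\<lambda>N. measure m (E k N)) \<longlonglongrightarrow> 0" for k
  proof -
    have dec: "decseq (E k)" unfolding E_def decseq_def by fastforce
    have "(\<lambda>N. measure m (E k N)) \<longlonglongrightarrow> measure m (\<Inter>N. E k N)"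
      using Esets dec by (intro m.finite_Lim_measure_decseq) auto
    moreover have AEn: "AE x in m. x \<notin> (\<Inter>N. E k N)"
      using AE
    proof (rule AE_mp[OF _ AE_I2], intro impI)
      fix x assume "p_omega f x \<subseteq> K"
      then obtain N where N: "\<forall>n\<ge>N. \<exists>\<nu>\<in>K. ds (\<sigma> n x) \<nu> < inverse (real (Suc k))"
        unfolding p_omega_subset_iff[OF K] by (metis inverse_positive_iff_positive of_nat_0_less_iff zero_less_Suc)
      then have "x \<notin> E k N" by (auto simp: E_def G_def)
      then show "x \<notin> (\<Inter>N. E k N)" by blast
    qed
    moreover have "(\<Inter>N. E k N) \<in> sets m" using Esets by auto
    from emeasure_zero_if_AE_not_in[OF this AEn] have "measure m (\<Inter>N. E k N) = 0"
      by (simp add: measure_def)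
    ultimately show ?thesis by simp
  qed
  have Mpos: "0 < measure m UNIV"
    using positive_m[of UNIV] by (simp add: m.emeasure_eq_measure)
  have "\<exists>N. measure m (E k N) < measure m UNIV / 2 * (1/2)^Suc k" for k
  proof -
    have "\<forall>\<^sub>F N in sequentially. measure m (E k N) < measure m UNIV / 2 * (1/2)^Suc k"
      using Mpos by (intro order_tendstoD(2)[OF Elim]) simp
    then show ?thesis by (auto simp: eventually_sequentially)
  qed
  then obtain N where N: "\<And>k. measure m (E k (N k)) < measure m UNIV / 2 * (1/2)^Suc k" by metis
  define A where "A = UNIV - (\<Union>k. E k (N k))"
  have half: "(\<lambda>k. measure m UNIV / 2 * (1/2)^Suc k) sums (measure m UNIV / 2)"
    using sums_mult[OF power_half_series, of "measure m UNIV / 2"] by simp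
  have Usets: "(\<Union>k. E k (N k)) \<in> sets m" using Esets by auto
  have summ: "summable (\<lambda>k. measure m (E k (N k)))"
    by (rule summable_comparison_test'[OF sums_summable[OF half], of 0]) (use N in \<open>auto intro: less_imp_le\<close>)
  have "measure m (\<Union>k. E k (N k)) \<le> (\<Sum>k. measure m (E k (N k)))"
    using Esets summ by (intro m.finite_measure_subadditive_countably) auto
  also have "\<dots> \<le> (\<Sum>k. measure m UNIV / 2 * (1/2)^Suc k)"
    using N by (intro suminf_le summ sums_summable[OF half]) (auto intro: less_imp_le)
  also have "\<dots> = measure m UNIV / 2" using sums_unique[OF half] by simp
  finally have "measure m (\<Union>k. E k (N k)) < measure m UNIV" using Mpos by simp
  then have "0 < measure m A"
    unfolding A_def using m.finite_measure_compl[OF Usets] by (simp add: space_m)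
  then have pos: "0 < emeasure m A" by (simp add: m.emeasure_eq_measure)
  have Asets: "A \<in> sets m" unfolding A_def using sets.compl_sets[OF Usets] by (simp add: space_m)
  have "\<exists>N>0. \<forall>n\<ge>N. \<forall>x\<in>A. \<exists>\<nu>\<in>K. ds (\<sigma> n x) \<nu> < \<rho>" if \<rho>: "0 < \<rho>" for \<rho>
  proof -
    obtain k where k: "inverse (real (Suc k)) < \<rho>" using reals_Archimedean[OF \<rho>] by blast
    have "\<exists>\<nu>\<in>K. ds (\<sigma> n x) \<nu> < \<rho>" if "n \<ge> Suc (N k)" "x \<in> A" for n x
    proof -
      have "x \<in> G k n" using that by (auto simp: A_def E_def)
      then show ?thesis using k unfolding G_def by force
    qed
    then show ?thesis by (intro exI[of _ "Suc (N k)"]) auto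
  qed
  then show ?thesis by (rule that[OF Asets pos])
qed

text \<open>
  The right side is the least compact set whose basin has full measure. A globally stable \<open>K\<close> has a basin
  of full measure, so it contains this set, and by the minimality in its own definition it is
  contained in it.
\<close>

lemma globally_stable_iff:
  "globally_empirically_stochastically_stable \<A> g m f ds K \<longleftrightarrow> K = pseudo_physical_measures"
proof -
  let ?P = pseudo_physical_measures
  have P: "compactin weak_star ?P" "?P \<noteq> {}" "?P \<subseteq> invariant_measures f"
    using compactin_closed_subset[OF closedin_pseudo_physical] pseudo_physical_nonempty
    by (auto simp: pseudo_physical_def)
  have basinP: "AE x in m. x \<in> stability_basin \<A> g m f ds ?P"
    unfolding stability_basin_iff[OF P(1,2)] by (rule AE_p_omega_pseudo_physical)
  have min: "?P \<subseteq> K'" if K': "K' \<noteq> {}" "compactin weak_star K'" and AE: "AE x in m. x \<in> stability_basin \<A> g m f ds K'" for K'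
    by (rule pseudo_physical_minimal[OF K'(2)]) (use AE in \<open>simp add: stability_basin_iff[OF K'(2,1)]\<close>)
  obtain A where A: "A \<in> sets m" "0 < emeasure m A"
    "\<And>\<rho>. 0 < \<rho> \<Longrightarrow> \<exists>N>0. \<forall>n\<ge>N. \<forall>x\<in>A. \<exists>\<nu>\<in>?P. ds (\<sigma> n x) \<nu> < \<rho>"
    using uniformly_attracted_set[OF P(1,2) AE_p_omega_pseudo_physical] by blast
  have unif: "\<exists>N>0. \<forall>n\<ge>N. \<exists>\<epsilon>\<^sub>0>0. \<forall>\<epsilon>. 0 < \<epsilon> \<and> \<epsilon> \<le> \<epsilon>\<^sub>0 \<longrightarrow>
           (\<forall>x\<in>A. measure_set_dist ds {\<sigma>\<^sub>\<epsilon> \<epsilon> n x} ?P < \<rho>)" if \<rho>: "0 < \<rho>" for \<rho>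
  proof -
    have \<rho>2: "0 < \<rho>/2" using \<rho> by simp
    obtain N where N: "0 < N" "\<And>n x. n \<ge> N \<Longrightarrow> x \<in> A \<Longrightarrow> \<exists>\<nu>\<in>?P. ds (\<sigma> n x) \<nu> < \<rho>/2" using A(3)[OF \<rho>2] by blast
    have "\<exists>\<epsilon>\<^sub>0>0. \<forall>\<epsilon>. 0 < \<epsilon> \<and> \<epsilon> \<le> \<epsilon>\<^sub>0 \<longrightarrow> (\<forall>x\<in>A. measure_set_dist ds {\<sigma>\<^sub>\<epsilon> \<epsilon> n x} ?P < \<rho>)" if nN: "n \<ge> N" for n
    proof -
      have n: "1 \<le> n" using nN N(1) by simp
      obtain b where b: "0 < b" "\<And>\<epsilon> x. 0 < \<epsilon> \<and> \<epsilon> \<le> b \<Longrightarrow> ds (\<sigma>\<^sub>\<epsilon> \<epsilon> n x) (\<sigma> n x) < \<rho>/2"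
        using empiric_stochastic_uniformly_close[OF n \<rho>2] by blast
      have "measure_set_dist ds {\<sigma>\<^sub>\<epsilon> \<epsilon> n x} ?P < \<rho>" if \<epsilon>: "0 < \<epsilon> \<and> \<epsilon> \<le> b" and x: "x \<in> A" for \<epsilon> x
      proof -
        obtain \<nu> where \<nu>: "\<nu> \<in> ?P" "ds (\<sigma> n x) \<nu> < \<rho>/2" using N(2)[OF nN x] by blast
        have "ds (\<sigma>\<^sub>\<epsilon> \<epsilon> n x) \<nu> \<le> ds (\<sigma>\<^sub>\<epsilon> \<epsilon> n x) (\<sigma> n x) + ds (\<sigma> n x) \<nu>"
          using ds.triangle[OF empiric_stochastic_prob[OF n] empiric_measure_prob[OF n], of \<epsilon> \<nu> x x] \<epsilon> \<nu>(1) pseudo_physical_prob by blast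
        then have "ds (\<sigma>\<^sub>\<epsilon> \<epsilon> n x) \<nu> < \<rho>" using \<nu> b(2)[OF \<epsilon>, of x] by linarith
        then show ?thesis using measure_set_dist_less_iff[of "{\<sigma>\<^sub>\<epsilon> \<epsilon> n x}" ?P \<rho>] P(2) \<nu>(1) by blast
      qed
      then show ?thesis using b(1) by blast
    qed
    then show ?thesis using N(1) by blast
  qed
  have stable: "empirically_stochastically_stable \<A> g m f ds ?P"
    unfolding empirically_stochastically_stable_def
  proof (intro conjI allI impI P)
    show "\<exists>A\<in>sets m. emeasure m A > 0 \<and>
        (\<forall>\<rho>>0. \<exists>N>0. \<forall>n\<ge>N. \<exists>\<epsilon>\<^sub>0>0. \<forall>\<epsilon>. 0 < \<epsilon> \<and> \<epsilon> \<le> \<epsilon>\<^sub>0 \<longrightarrow>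
           (\<forall>x\<in>A. measure_set_dist ds {\<sigma>\<^sub>\<epsilon> \<epsilon> n x} ?P < \<rho>))"
      using A(1,2) unif by blast
    fix K' assume K': "K' \<noteq> {} \<and> compactin weak_star K' \<and> K' \<subseteq> invariant_measures f \<and>
        (AE x in m. x \<in> stability_basin \<A> g m f ds ?P \<longrightarrow> x \<in> stability_basin \<A> g m f ds K')"
    then have "AE x in m. x \<in> stability_basin \<A> g m f ds K'" using basinP by (auto elim: AE_mp)
    then show "?P \<subseteq> K'" using min K' by blast
  qed
  show ?thesis
  proof
    assume glob: "globally_empirically_stochastically_stable \<A> g m f ds K"
    then have K: "K \<noteq> {}" "compactin weak_star K" and basin: "AE x in m. x \<in> stability_basin \<A> g m f ds K"
      and mini: "\<And>K'. K' \<noteq> {} \<and> compactin weak_star K' \<and> K' \<subseteq> invariant_measures f \<and>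
        (AE x in m. x \<in> stability_basin \<A> g m f ds K \<longrightarrow> x \<in> stability_basin \<A> g m f ds K') \<Longrightarrow> K \<subseteq> K'"
      unfolding globally_empirically_stochastically_stable_def empirically_stochastically_stable_def by blast+
    have "AE x in m. x \<in> stability_basin \<A> g m f ds K \<longrightarrow> x \<in> stability_basin \<A> g m f ds ?P"
      using basinP by (auto elim: AE_mp)
    then have "K \<subseteq> ?P" using mini[of ?P] P by blast
    moreover have "?P \<subseteq> K" using min[OF K basin] .
    ultimately show "K = ?P" by (rule equalityI)
  next
    assume "K = ?P"
    then show "globally_empirically_stochastically_stable \<A> g m f ds K"
      unfolding globally_empirically_stochastically_stable_def using stable basinP by simp
  qed
qed

end

section \<open>Charts, the metric and the speed of curves\<close>

lemma smooth_on_local_extension: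
  assumes "smooth_on F S" "x \<in> S"
  shows "\<exists>W G. open W \<and> x \<in> W \<and> (\<forall>y\<in>W. G differentiable (at y)) \<and>
    (\<forall>v. continuous_on W (\<lambda>y. frechet_derivative G (at y) v)) \<and> (\<forall>y\<in>W \<inter> S. G y = F y)"
proof -
  obtain W G where W: "open W" "x \<in> W" "\<forall>k. Ck_on k G W" "\<forall>y\<in>W \<inter> S. G y = F y"
    using assms unfolding smooth_on_def by blast
  have "Ck_on (Suc 0) G W" using W(3) by blast
  then have "(\<forall>y\<in>W. G differentiable (at y)) \<and> (\<forall>v. continuous_on W (\<lambda>y. frechet_derivative G (at y) v))"
    by simp
  then show ?thesis using W(1,2,4) by blast
qed

lemma smooth_on_continuous_on:
  assumes "smooth_on F S"
  shows "continuous_on S F"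
  unfolding continuous_on_eq_continuous_within
proof
  fix x assume x: "x \<in> S"
  obtain W G where W: "open W" "x \<in> W" "\<forall>y\<in>W. G differentiable (at y)" "\<forall>y\<in>W \<inter> S. G y = F y"
    using smooth_on_local_extension[OF assms x] by blast
  have "isCont G x" using W(2,3) by (simp add: differentiable_imp_continuous_within)
  then have "(G \<longlongrightarrow> G x) (at x within S)"
    unfolding continuous_at by (rule tendsto_within_subset) simp
  moreover have "G x = F x" using W(2,4) x by blast
  moreover have "\<forall>\<^sub>F y in at x within S. G y = F y"
    unfolding eventually_at_topological using W(1,2,4) by (intro exI[of _ W]) simp
  ultimately have "(F \<longlongrightarrow> F x) (at x within S)" by (metis Lim_transform_eventually)
  then show "continuous (at x within S) F" by (simp add: continuous_within)
qed

lemma continuous_on_det: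
  fixes A :: "'b::topological_space \<Rightarrow> real ^ 'n ^ 'n::finite"
  assumes "continuous_on S A"
  shows "continuous_on S (\<lambda>x. det (A x))"
proof -
  have "continuous_on S (\<lambda>x. A x $ i $ j)" for i j using assms by (intro continuous_intros)
  then show ?thesis unfolding det_def
    by (intro continuous_on_sum continuous_on_mult continuous_on_const continuous_on_prod)
qed

text \<open>
  The matrices on the segment from \<open>A\<close> to the identity are positive definite and hence invertible, so
  their determinants do not change sign.
\<close>

lemma positive_definite_det_pos:
  fixes A :: "real ^ 'n ^ 'n::finite"
  assumes A: "\<And>v. v \<noteq> 0 \<Longrightarrow> 0 < v \<bullet> (A *v v)"
  shows "0 < det A"
proof (rule ccontr)
  assume "\<not> 0 < det A"
  define B where "B t = (1 - t) *\<^sub>R A + t *\<^sub>R mat 1" for t :: real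
  have "continuous_on {0..1} (\<lambda>t. det (B t))"
    unfolding B_def by (intro continuous_on_det continuous_intros)
  moreover have "det (B 0) \<le> 0" "0 \<le> det (B 1)" using \<open>\<not> 0 < det A\<close> by (simp_all add: B_def)
  ultimately obtain t where t: "0 \<le> t" "t \<le> 1" "det (B t) = 0"
    using IVT'[of "\<lambda>t. det (B t)" 0 0 1] by auto
  have "v = 0" if "B t *v v = 0" for v
  proof (rule ccontr)
    assume v: "v \<noteq> 0"
    have "B t *v v = (1 - t) *\<^sub>R (A *v v) + t *\<^sub>R v"
      by (simp add: B_def matrix_vector_mult_add_rdistrib scaleR_matrix_vector_assoc[symmetric])
    then have "v \<bullet> (B t *v v) = (1 - t) * (v \<bullet> (A *v v)) + t * (v \<bullet> v)" by (simp add: inner_add_right)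
    moreover have "0 < (1 - t) * (v \<bullet> (A *v v)) + t * (v \<bullet> v)"
    proof (cases "t = 1")
      case False
      then have "0 < (1 - t) * (v \<bullet> (A *v v))" using t A[OF v] by simp
      then show ?thesis using t by (simp add: add_pos_nonneg)
    qed (use v in simp)
    ultimately show False using that by simp
  qed
  then have "invertible (B t)" unfolding invertible_left_inverse matrix_left_invertible_ker by blast
  then show False using t(3) by (simp add: invertible_det_nz)
qed

locale riemannian_atlas =
  fixes \<A> :: "('a::{t2_space, second_countable_topology}, 'n::finite) chart set"
    and g :: "('a, 'n) chart \<Rightarrow> real ^ 'n \<Rightarrow> real ^ 'n ^ 'n"
  assumes atlas: "smooth_atlas \<A>" and metric: "riemannian_metric \<A> g"
begin

definition quad :: "('a, 'n) chart \<Rightarrow> real ^ 'n \<Rightarrow> real ^ 'n \<Rightarrow> real" where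
  "quad c q v = v \<bullet> (g c q *v v)"

lemma chart_cover: "\<exists>c\<in>\<A>. x \<in> fst c"
  using atlas unfolding smooth_atlas_def by blast

lemma chart_properties:
  assumes "c \<in> \<A>"
  shows "open (fst c)" "\<exists>\<psi>. homeomorphism (fst c) (snd c ` fst c) (snd c) \<psi>"
    "\<exists>b. openin (top_of_set {x. 0 \<le> b \<bullet> x}) (snd c ` fst c)"
proof -
  have "\<forall>(U, \<phi>)\<in>\<A>. open U \<and> (\<exists>\<psi>. homeomorphism U (\<phi> ` U) \<phi> \<psi>) \<and>
        (\<exists>b. openin (top_of_set {x. 0 \<le> b \<bullet> x}) (\<phi> ` U))"
    using atlas unfolding smooth_atlas_def by blast
  from bspec[OF this assms]
  show "open (fst c)" "\<exists>\<psi>. homeomorphism (fst c) (snd c ` fst c) (snd c) \<psi>"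
    "\<exists>b. openin (top_of_set {x. 0 \<le> b \<bullet> x}) (snd c ` fst c)"
    by (simp_all add: case_prod_unfold)
qed

lemmas open_chart = chart_properties(1)

lemma chart_homeomorphism:
  assumes "c \<in> \<A>"
  shows "homeomorphism (fst c) (snd c ` fst c) (snd c) (inv_into (fst c) (snd c))"
proof -
  obtain \<psi> where h: "homeomorphism (fst c) (snd c ` fst c) (snd c) \<psi>"
    using chart_properties(2)[OF assms] by blast
  have inj: "inj_on (snd c) (fst c)" using h unfolding homeomorphism_def by (auto intro: inj_on_inverseI)
  have eq: "inv_into (fst c) (snd c) q = \<psi> q" if "q \<in> snd c ` fst c" for q
    using that h inj unfolding homeomorphism_def by (auto simp: inv_into_f_f)
  have "continuous_on (snd c ` fst c) \<psi>" using h unfolding homeomorphism_def by blast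
  then have "continuous_on (snd c ` fst c) (inv_into (fst c) (snd c))"
    by (rule continuous_on_eq) (simp add: eq)
  then show ?thesis
    using h inj unfolding homeomorphism_def by (auto simp: inv_into_into f_inv_into_f image_iff)
qed

lemma chart_half_space:
  assumes "c \<in> \<A>"
  obtains b where "openin (top_of_set {x. 0 \<le> b \<bullet> x}) (snd c ` fst c)"
  using chart_properties(3)[OF assms] by blast

lemma chart_inj: "c \<in> \<A> \<Longrightarrow> inj_on (snd c) (fst c)"
  using chart_homeomorphism[of c] unfolding homeomorphism_def by (auto intro: inj_on_inverseI)

lemma continuous_chart: "c \<in> \<A> \<Longrightarrow> continuous_on (fst c) (snd c)"
  using chart_homeomorphism[of c] unfolding homeomorphism_def by blast

lemma continuous_chart_inverse: "c \<in> \<A> \<Longrightarrow> continuous_on (snd c ` fst c) (inv_into (fst c) (snd c))"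
  using chart_homeomorphism[of c] unfolding homeomorphism_def by blast

lemma openin_chart_image:
  assumes c: "c \<in> \<A>" and V: "open V" "V \<subseteq> fst c"
    and b: "openin (top_of_set {x. 0 \<le> b \<bullet> x}) (snd c ` fst c)"
  shows "openin (top_of_set {x. 0 \<le> b \<bullet> x}) (snd c ` V)"
proof -
  have "openin (top_of_set (snd c ` fst c)) (snd c ` V)"
    by (rule homeomorphism_imp_open_map[OF chart_homeomorphism[OF c]])
      (use V in \<open>auto simp: openin_open\<close>)
  then show ?thesis by (rule openin_trans[OF _ b])
qed

lemma chart_relative_ball:
  assumes c: "c \<in> \<A>" and x: "x \<in> fst c" and V: "open V" "x \<in> V"
  obtains b r where "0 < r" "snd c ` fst c \<subseteq> {q. 0 \<le> b \<bullet> q}"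
    "cball (snd c x) r \<inter> {q. 0 \<le> b \<bullet> q} \<subseteq> snd c ` (fst c \<inter> V)"
proof -
  obtain b where b: "openin (top_of_set {x. 0 \<le> b \<bullet> x}) (snd c ` fst c)"
    using chart_half_space[OF c] .
  have "openin (top_of_set {x. 0 \<le> b \<bullet> x}) (snd c ` (fst c \<inter> V))"
    by (rule openin_chart_image[OF c _ _ b]) (use open_chart[OF c] V in auto)
  then obtain r where "0 < r" "cball (snd c x) r \<inter> {q. 0 \<le> b \<bullet> q} \<subseteq> snd c ` (fst c \<inter> V)"
    unfolding openin_contains_cball using x V by blast
  then show ?thesis using that openin_imp_subset[OF b] by blast
qed

text \<open>
  A small closed ball cut by the half-space of the chart: compact for uniform bounds on the metric,
  convex so that segments stay in the chart even at the boundary of the manifold.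
\<close>

lemma chart_compact_convex_neighbourhood:
  assumes c: "c \<in> \<A>" and x: "x \<in> fst c" and V: "open V" "x \<in> V"
  shows "\<exists>r Q. 0 < r \<and> compact Q \<and> convex Q \<and> Q \<subseteq> snd c ` (fst c \<inter> V) \<and>
    snd c ` fst c \<inter> cball (snd c x) r \<subseteq> Q"
proof -
  obtain b r where r: "0 < r" "snd c ` fst c \<subseteq> {q. 0 \<le> b \<bullet> q}"
    "cball (snd c x) r \<inter> {q. 0 \<le> b \<bullet> q} \<subseteq> snd c ` (fst c \<inter> V)"
    by (rule chart_relative_ball[OF c x V])
  let ?Q = "cball (snd c x) r \<inter> {q. 0 \<le> b \<bullet> q}"
  have "compact ?Q" by (intro compact_Int_closed compact_cball closed_halfspace_ge)
  moreover have "convex ?Q" by (intro convex_Int convex_cball convex_halfspace_ge)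
  moreover have "snd c ` fst c \<inter> cball (snd c x) r \<subseteq> ?Q" using r(2) by blast
  ultimately show ?thesis using r(1,3) by (intro exI[of _ r] exI[of _ ?Q]) simp
qed

lemma open_chart_preimage:
  assumes "c \<in> \<A>" "open W"
  shows "open (fst c \<inter> snd c -` W)"
  using continuous_open_preimage[OF continuous_chart[OF assms(1)] open_chart[OF assms(1)] assms(2)] .

lemma metric_continuous: "c \<in> \<A> \<Longrightarrow> continuous_on (snd c ` fst c) (g c)"
  using metric smooth_on_continuous_on unfolding riemannian_metric_def by blast

lemma quad_pos: "c \<in> \<A> \<Longrightarrow> q \<in> snd c ` fst c \<Longrightarrow> v \<noteq> 0 \<Longrightarrow> 0 < quad c q v"
  using metric unfolding riemannian_metric_def quad_def by blast

lemma quad_nonneg: "c \<in> \<A> \<Longrightarrow> q \<in> snd c ` fst c \<Longrightarrow> 0 \<le> quad c q v"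
  using quad_pos[of c q v] by (cases "v = 0") (auto simp: quad_def)

lemma quad_scale: "quad c q (a *\<^sub>R v) = a\<^sup>2 * quad c q v"
  by (simp add: quad_def matrix_vector_mult_scaleR power2_eq_square)

lemma continuous_quad:
  assumes "c \<in> \<A>" "continuous_on T q" "q ` T \<subseteq> snd c ` fst c" "continuous_on T w"
  shows "continuous_on T (\<lambda>t. quad c (q t) (w t))"
proof -
  have "continuous_on T (\<lambda>t. g c (q t))"
    by (rule continuous_on_compose2[OF metric_continuous[OF assms(1)] assms(2,3)])
  then have g: "continuous_on T (\<lambda>t. g c (q t) $ i $ j)" for i j by (intro continuous_intros)
  have w: "continuous_on T (\<lambda>t. w t $ i)" for i using assms(4) by (intro continuous_intros)
  show ?thesis
    unfolding quad_def inner_vec_def matrix_vector_mult_def inner_real_def vec_lambda_beta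
    by (intro continuous_on_sum continuous_on_mult g w)
qed

text \<open>
  By homogeneity it suffices to consider unit vectors, and on the compact product of \<open>Q\<close> with the unit
  sphere the positive continuous function \<open>quad\<close> attains its bounds.
\<close>

lemma quad_bounds:
  assumes c: "c \<in> \<A>" and Q: "compact Q" "Q \<noteq> {}" "Q \<subseteq> snd c ` fst c"
  shows "\<exists>l L. 0 < l \<and> 0 \<le> L \<and>
    (\<forall>q\<in>Q. \<forall>v. l * norm v \<le> sqrt (quad c q v) \<and> sqrt (quad c q v) \<le> L * norm v)"
proof -
  let ?S = "Q \<times> sphere (0 :: real ^ 'n) 1"
  have S: "compact ?S" "?S \<noteq> {}"
  proof -
    show "compact ?S" using Q(1) by (intro compact_Times compact_sphere)
    obtain e :: "real ^ 'n" where "e \<in> Basis" using nonempty_Basis by blast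
    then have "e \<in> sphere 0 1" by simp
    then show "?S \<noteq> {}" using Q(2) by auto
  qed
  have cont: "continuous_on ?S (\<lambda>z. quad c (fst z) (snd z))"
    by (rule continuous_quad[OF c]) (use Q(3) in \<open>auto intro!: continuous_intros\<close>)
  obtain z1 where z1: "z1 \<in> ?S" "\<forall>z\<in>?S. quad c (fst z1) (snd z1) \<le> quad c (fst z) (snd z)"
    using continuous_attains_inf[OF S cont] by blast
  obtain z2 where z2: "z2 \<in> ?S" "\<forall>z\<in>?S. quad c (fst z) (snd z) \<le> quad c (fst z2) (snd z2)"
    using continuous_attains_sup[OF S cont] by blast
  have n1: "snd z1 \<noteq> 0" using z1(1) by auto
  have p1: "0 < quad c (fst z1) (snd z1)" using z1(1) Q(3) by (intro quad_pos[OF c _ n1]) auto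
  have p2: "0 \<le> quad c (fst z2) (snd z2)" using z2(1) Q(3) by (intro quad_nonneg[OF c]) auto
  have eq: "sqrt (quad c q v) = norm v * sqrt (quad c q (v /\<^sub>R norm v))" if "v \<noteq> 0" for q v
  proof -
    have "quad c q v = quad c q (norm v *\<^sub>R (v /\<^sub>R norm v))" using that by simp
    also have "\<dots> = (norm v)\<^sup>2 * quad c q (v /\<^sub>R norm v)" by (rule quad_scale)
    finally show ?thesis by (simp add: real_sqrt_mult)
  qed
  have sph: "v /\<^sub>R norm v \<in> sphere 0 1" if "v \<noteq> 0" for v :: "real ^ 'n" using that by simp
  have lower: "sqrt (quad c (fst z1) (snd z1)) * norm v \<le> sqrt (quad c q v)" if q: "q \<in> Q" for q v
  proof (cases "v = 0")
    case False
    then show ?thesis unfolding eq[OF False]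
      using bspec[OF z1(2), of "(q, v /\<^sub>R norm v)"] q sph[OF False] by (simp add: mult.commute)
  qed (simp add: quad_def)
  have upper: "sqrt (quad c q v) \<le> sqrt (quad c (fst z2) (snd z2)) * norm v" if q: "q \<in> Q" for q v
  proof (cases "v = 0")
    case False
    then show ?thesis unfolding eq[OF False]
      using bspec[OF z2(2), of "(q, v /\<^sub>R norm v)"] q sph[OF False] by (simp add: mult.commute)
  qed (simp add: quad_def)
  have "0 < sqrt (quad c (fst z1) (snd z1))" "0 \<le> sqrt (quad c (fst z2) (snd z2))" using p1 p2 by simp_all
  then show ?thesis using lower upper by blast
qed

lemma transition_apply: "d \<in> \<A> \<Longrightarrow> c \<in> \<A> \<Longrightarrow> x \<in> fst c \<Longrightarrow> transition c d (snd c x) = snd d x"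
  unfolding transition_def using chart_inj by simp

lemma smooth_transition: "c \<in> \<A> \<Longrightarrow> d \<in> \<A> \<Longrightarrow> smooth_on (transition c d) (snd c ` (fst c \<inter> fst d))"
  using atlas unfolding smooth_atlas_def by blast

lemma transition_has_derivative:
  assumes c: "c \<in> \<A>" and d: "d \<in> \<A>" and x: "x \<in> fst c \<inter> fst d"
  shows "\<exists>T. (transition c d has_derivative T) (at (snd c x) within snd c ` (fst c \<inter> fst d))"
proof -
  let ?S = "snd c ` (fst c \<inter> fst d)"
  have xS: "snd c x \<in> ?S" using x by blast
  obtain W G where W: "open W" "snd c x \<in> W" "\<forall>y\<in>W. G differentiable (at y)"
    "\<forall>y\<in>W \<inter> ?S. G y = transition c d y"
    using smooth_on_local_extension[OF smooth_transition[OF c d] xS] by blast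
  obtain T where "(G has_derivative T) (at (snd c x))" using W(2,3) unfolding differentiable_def by blast
  then have GT: "(G has_derivative T) (at (snd c x) within ?S)" by (rule has_derivative_at_withinI)
  obtain e where e: "0 < e" "ball (snd c x) e \<subseteq> W" using W(1,2) open_contains_ball by blast
  have "(transition c d has_derivative T) (at (snd c x) within ?S)"
  proof (rule has_derivative_transform_within[OF GT e(1) xS])
    fix y assume "y \<in> ?S" "dist y (snd c x) < e"
    then show "G y = transition c d y" using e(2) W(4) by (auto simp: dist_commute subset_iff)
  qed
  then show ?thesis by blast
qed

lemma chart_choice: "(SOME c. c \<in> \<A> \<and> x \<in> fst c) \<in> \<A> \<and> x \<in> fst (SOME c. c \<in> \<A> \<and> x \<in> fst c)"
proof -
  have "\<exists>c. c \<in> \<A> \<and> x \<in> fst c" using chart_cover[of x] by blast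
  from someI_ex[OF this] show ?thesis .
qed

lemma speed_nonneg: "0 \<le> speed \<A> g \<gamma> t"
proof -
  define c where "c = (SOME c. c \<in> \<A> \<and> \<gamma> t \<in> fst c)"
  have c: "c \<in> \<A>" "\<gamma> t \<in> fst c" using chart_choice[of "\<gamma> t"] unfolding c_def by auto
  have "0 \<le> quad c (snd c (\<gamma> t)) v" for v using c by (intro quad_nonneg) auto
  then show ?thesis
    unfolding speed_def Let_def c_def[symmetric] quad_def by simp
qed

text \<open>
  The speed is defined through an arbitrarily selected chart \<open>d\<close>. Near \<open>t\<close>, the curve in \<open>d\<close> is the curve
  in \<open>c\<close> followed by the coordinate change, whose derivative \<open>T\<close> is an isometry for the two Gram
  matrices.
\<close>

lemma speed_eq:
  assumes c: "c \<in> \<A>" and \<gamma>t: "\<gamma> t \<in> fst c" and cont: "isCont \<gamma> t"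
    and v: "((snd c \<circ> \<gamma>) has_vector_derivative v) (at t)"
  shows "speed \<A> g \<gamma> t = sqrt (quad c (snd c (\<gamma> t)) v)"
proof -
  define d where "d = (SOME c. c \<in> \<A> \<and> \<gamma> t \<in> fst c)"
  have d: "d \<in> \<A>" "\<gamma> t \<in> fst d" using chart_choice[of "\<gamma> t"] unfolding d_def by auto
  let ?S = "snd c ` (fst c \<inter> fst d)"
  obtain T where T: "(transition c d has_derivative T) (at (snd c (\<gamma> t)) within ?S)"
    using transition_has_derivative[OF c d(1), of "\<gamma> t"] \<gamma>t d(2) by auto
  have "open (fst c \<inter> fst d)" by (intro open_Int open_chart c d(1))
  moreover have "\<gamma> t \<in> fst c \<inter> fst d" using \<gamma>t d(2) by simp
  ultimately have "\<exists>N. open N \<and> t \<in> N \<and> (\<forall>s\<in>N. \<gamma> s \<in> fst c \<inter> fst d)"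
    using cont unfolding continuous_at_open by meson
  then obtain N where N: "open N" "t \<in> N" "\<And>s. s \<in> N \<Longrightarrow> \<gamma> s \<in> fst c \<inter> fst d" by auto
  have "((snd c \<circ> \<gamma>) has_derivative (\<lambda>h. h *\<^sub>R v)) (at t within N)"
    using v unfolding has_vector_derivative_def by (rule has_derivative_at_withinI)
  moreover have "(transition c d has_derivative T) (at ((snd c \<circ> \<gamma>) t) within (snd c \<circ> \<gamma>) ` N)"
  proof -
    have "(snd c \<circ> \<gamma>) ` N \<subseteq> ?S" using N(3) by auto
    from has_derivative_subset[OF T this] show ?thesis by simp
  qed
  ultimately have "((\<lambda>s. transition c d ((snd c \<circ> \<gamma>) s)) has_derivative (\<lambda>h. T (h *\<^sub>R v))) (at t within N)"
    by (rule has_derivative_in_compose)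
  then have "((\<lambda>s. transition c d ((snd c \<circ> \<gamma>) s)) has_derivative (\<lambda>h. T (h *\<^sub>R v))) (at t)"
    unfolding at_within_open[OF N(2,1)] .
  moreover have "T (h *\<^sub>R v) = h *\<^sub>R T v" for h
    using has_derivative_linear[OF T] by (rule linear_cmul)
  ultimately have "((\<lambda>s. transition c d ((snd c \<circ> \<gamma>) s)) has_vector_derivative T v) (at t)"
    by (simp add: has_vector_derivative_def)
  then have "((snd d \<circ> \<gamma>) has_vector_derivative T v) (at t)"
    by (rule has_vector_derivative_transform_within_open[OF _ N(1,2)])
      (use N(3) transition_apply[OF d(1) c] in simp)
  then have "vector_derivative (snd d \<circ> \<gamma>) (at t) = T v" by (rule vector_derivative_at)
  then have "speed \<A> g \<gamma> t = sqrt (T v \<bullet> (g d (snd d (\<gamma> t)) *v T v))"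
    unfolding speed_def Let_def d_def[symmetric] by simp
  also have "T v \<bullet> (g d (snd d (\<gamma> t)) *v T v) = v \<bullet> (g c (snd c (\<gamma> t)) *v v)"
  proof -
    have "\<forall>c\<in>\<A>. \<forall>d\<in>\<A>. \<forall>p\<in>fst c \<inter> fst d. \<forall>T.
        (transition c d has_derivative T) (at (snd c p) within snd c ` (fst c \<inter> fst d)) \<longrightarrow>
        (\<forall>u v. u \<bullet> (g c (snd c p) *v v) = T u \<bullet> (g d (snd d p) *v T v))"
      using metric unfolding riemannian_metric_def by blast
    from this[rule_format, OF c d(1) _ T] show ?thesis using \<gamma>t d(2) by simp
  qed
  finally show ?thesis by (simp add: quad_def)
qed

text \<open>
  What the definition of piecewise \<open>C\<^sup>1\<close> curves says for pieces that stay in one chart domain, so that the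
  set of parameters mapped into it is the whole interval.
\<close>

definition smooth_off_breakpoints :: "real set \<Rightarrow> (real \<Rightarrow> 'a) \<Rightarrow> bool" where
  "smooth_off_breakpoints S \<gamma> \<longleftrightarrow> (\<forall>c a b. c \<in> \<A> \<longrightarrow> 0 \<le> a \<longrightarrow> a < b \<longrightarrow> b \<le> 1 \<longrightarrow> {a<..<b} \<inter> S = {} \<longrightarrow> \<gamma> ` {a..b} \<subseteq> fst c \<longrightarrow>
     (\<exists>w. continuous_on {a..b} w \<and> (\<forall>t\<in>{a..b}. ((snd c \<circ> \<gamma>) has_vector_derivative w t) (at t within {a..b}))))"

lemma smooth_off_breakpointsD:
  assumes "smooth_off_breakpoints S \<gamma>" "c \<in> \<A>" "0 \<le> a" "a < b" "b \<le> 1" "{a<..<b} \<inter> S = {}" "\<gamma> ` {a..b} \<subseteq> fst c"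
  shows "\<exists>w. continuous_on {a..b} w \<and> (\<forall>t\<in>{a..b}. ((snd c \<circ> \<gamma>) has_vector_derivative w t) (at t within {a..b}))"
  using assms(1)[unfolded smooth_off_breakpoints_def, rule_format, OF assms(2-7)] .

lemma piecewise_C1_curveD:
  assumes "piecewise_C1_curve \<A> \<gamma>"
  shows "\<exists>S. finite S \<and> {0, 1} \<subseteq> S \<and> smooth_off_breakpoints S \<gamma>"
proof -
  obtain S where S: "finite S" "\<And>a b. 0 \<le> a \<and> a < b \<and> b \<le> 1 \<and> {a<..<b} \<inter> S = {} \<Longrightarrow> C1_curve_on \<A> \<gamma> a b"
    using assms unfolding piecewise_C1_curve_def by blast
  have "smooth_off_breakpoints (S \<union> {0, 1}) \<gamma>"
    unfolding smooth_off_breakpoints_def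
  proof (intro allI impI)
    fix c a b assume c: "c \<in> \<A>" and ab: "0 \<le> a" "a < b" "b \<le> 1" "{a<..<b} \<inter> (S \<union> {0, 1}) = {}"
      and sub: "\<gamma> ` {a..b} \<subseteq> fst c"
    have C1: "C1_curve_on \<A> \<gamma> a b" using ab by (intro S(2)) auto
    have D: "{t \<in> {a..b}. \<gamma> t \<in> fst c} = {a..b}" using sub by auto
    have "\<exists>w. continuous_on {t \<in> {a..b}. \<gamma> t \<in> fst c} w \<and>
        (\<forall>t\<in>{t \<in> {a..b}. \<gamma> t \<in> fst c}. ((snd c \<circ> \<gamma>) has_vector_derivative w t) (at t within {t \<in> {a..b}. \<gamma> t \<in> fst c}))"
      using bspec[OF C1[unfolded C1_curve_on_def Let_def] c] by (simp only: case_prod_unfold)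
    then show "\<exists>w. continuous_on {a..b} w \<and> (\<forall>t\<in>{a..b}. ((snd c \<circ> \<gamma>) has_vector_derivative w t) (at t within {a..b}))"
      unfolding D .
  qed
  then show ?thesis using S(1) by (intro exI[of _ "S \<union> {0, 1}"]) simp
qed

lemma curve_isCont:
  assumes "piecewise_C1_curve \<A> \<gamma>" "0 < t" "t < 1"
  shows "isCont \<gamma> t"
  using assms continuous_on_interior[of "{0..1}" \<gamma> t] unfolding piecewise_C1_curve_def path_def by simp

lemma curve_piece_in_chart:
  assumes \<gamma>: "piecewise_C1_curve \<A> \<gamma>" and c: "c \<in> \<A>" and t: "t \<in> {0..1}" "\<gamma> t \<in> fst c"
  shows "\<exists>e>0. \<forall>s\<in>{0..1}. \<bar>s - t\<bar> < e \<longrightarrow> \<gamma> s \<in> fst c"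
proof -
  have cont: "continuous_on {0..1} \<gamma>" using \<gamma> unfolding piecewise_C1_curve_def path_def by simp
  obtain A where A: "open A" "A \<inter> {0..1} = \<gamma> -` fst c \<inter> {0..1}"
    using cont open_chart[OF c] unfolding continuous_on_open_invariant by blast
  then have "t \<in> A" using t by blast
  then obtain e where "0 < e" "ball t e \<subseteq> A" using A(1) open_contains_ball by blast
  then have "\<gamma> s \<in> fst c" if "s \<in> {0..1}" "\<bar>s - t\<bar> < e" for s
    using that A(2) by (auto simp: dist_real_def abs_minus_commute subset_iff)
  then show ?thesis using \<open>0 < e\<close> by blast
qed

lemma curve_differentiable:
  assumes \<gamma>: "piecewise_C1_curve \<A> \<gamma>"
  shows "\<exists>S. finite S \<and> {0, 1} \<subseteq> S \<and> (\<forall>c t. c \<in> \<A> \<longrightarrow> t \<in> {0..1} - S \<longrightarrow> \<gamma> t \<in> fst c \<longrightarrow>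
      ((snd c \<circ> \<gamma>) has_vector_derivative vector_derivative (snd c \<circ> \<gamma>) (at t)) (at t))"
proof -
  obtain S where S: "finite S" "{0, 1} \<subseteq> S" "smooth_off_breakpoints S \<gamma>"
    using piecewise_C1_curveD[OF \<gamma>] by blast
  have "((snd c \<circ> \<gamma>) has_vector_derivative vector_derivative (snd c \<circ> \<gamma>) (at t)) (at t)"
    if c: "c \<in> \<A>" and t: "t \<in> {0..1} - S" "\<gamma> t \<in> fst c" for c t
  proof -
    have t01: "t \<in> {0..1}" "t \<in> {0<..<1}" using t S(2) by (auto simp: less_le)
    obtain e where e: "0 < e" "\<And>s. s \<in> {0..1} \<Longrightarrow> \<bar>s - t\<bar> < e \<Longrightarrow> \<gamma> s \<in> fst c"
      using curve_piece_in_chart[OF \<gamma> c t01(1) t(2)] by blast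
    have "open ({0<..<1} - S)" using S(1) by (intro open_Diff finite_imp_closed) auto
    then obtain e' where e': "0 < e'" "ball t e' \<subseteq> {0<..<1} - S"
      using t01 t(1) open_contains_ball by blast
    define h where "h = min e e' / 2"
    have h: "0 < h" "h < e" "h < e'" using e(1) e'(1) by (auto simp: h_def)
    define a b where "a = t - h" and "b = t + h"
    have ab: "{a..b} \<subseteq> ball t e'" using h by (auto simp: a_def b_def dist_real_def)
    then have ab': "{a..b} \<subseteq> {0<..<1} - S" using e'(2) by blast
    have "a \<in> {a..b}" "b \<in> {a..b}" using h by (auto simp: a_def b_def)
    then have "a \<in> {0<..<1}" "b \<in> {0<..<1}" using ab' by blast+
    moreover have "a < b" using h(1) by (simp add: a_def b_def)
    ultimately have ends: "0 \<le> a" "a < b" "b \<le> 1" by simp_all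
    have "{a<..<b} \<subseteq> {a..b}" by auto
    then have "{a<..<b} \<inter> S = {}" using ab' by blast
    moreover have "\<gamma> ` {a..b} \<subseteq> fst c"
    proof
      fix y assume "y \<in> \<gamma> ` {a..b}"
      then obtain s where s: "s \<in> {a..b}" "y = \<gamma> s" by blast
      have "s \<in> {0<..<1}" using s(1) ab' by blast
      then have "s \<in> {0..1}" by simp
      moreover have "\<bar>s - t\<bar> < e" using s(1) h by (auto simp: a_def b_def)
      ultimately show "y \<in> fst c" using e(2) s(2) by blast
    qed
    ultimately obtain w where w: "\<forall>t\<in>{a..b}. ((snd c \<circ> \<gamma>) has_vector_derivative w t) (at t within {a..b})"
      using smooth_off_breakpointsD[OF S(3) c ends] by blast
    have "t \<in> interior {a..b}" using h by (simp add: a_def b_def)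
    then have "at t within {a..b} = at t" by (rule at_within_interior)
    moreover have "t \<in> {a..b}" using h by (simp add: a_def b_def)
    ultimately have "((snd c \<circ> \<gamma>) has_vector_derivative w t) (at t)" using w by metis
    then show ?thesis by (simp add: vector_derivative_at)
  qed
  then show ?thesis using S(1,2) by blast
qed

text \<open>
  On such a piece the speed agrees, except at the two end points, with the continuous function
  \<open>sqrt (quad c (snd c (\<gamma> t)) (w t))\<close>; at the end points the two-sided derivative in its definition need
  not exist.
\<close>

lemma speed_integrable_piece:
  assumes \<gamma>: "piecewise_C1_curve \<A> \<gamma>" and c: "c \<in> \<A>" and ab: "0 \<le> a" "a < b" "b \<le> 1"
    and w: "continuous_on {a..b} w" "\<forall>t\<in>{a..b}. ((snd c \<circ> \<gamma>) has_vector_derivative w t) (at t within {a..b})"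
    and sub: "\<gamma> ` {a..b} \<subseteq> fst c"
  shows "speed \<A> g \<gamma> integrable_on {a..b}"
proof -
  have "continuous_on {0..1} \<gamma>" using \<gamma> unfolding piecewise_C1_curve_def path_def by simp
  then have "continuous_on {a..b} \<gamma>" by (rule continuous_on_subset) (use ab in auto)
  then have q: "continuous_on {a..b} (\<lambda>t. snd c (\<gamma> t))"
    by (rule continuous_on_compose2[OF continuous_chart[OF c]]) (rule sub)
  have "continuous_on {a..b} (\<lambda>t. sqrt (quad c (snd c (\<gamma> t)) (w t)))"
    by (intro continuous_on_real_sqrt continuous_quad[OF c q _ w(1)]) (use sub in auto)
  then have "(\<lambda>t. sqrt (quad c (snd c (\<gamma> t)) (w t))) integrable_on {a..b}"
    by (rule integrable_continuous_interval)
  then show ?thesis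
  proof (rule integrable_spike_finite[of "{a, b}", rotated 2])
    fix t assume t: "t \<in> {a..b} - {a, b}"
    then have "t \<in> interior {a..b}" by auto
    then have "at t within {a..b} = at t" by (rule at_within_interior)
    then have "((snd c \<circ> \<gamma>) has_vector_derivative w t) (at t)" using w(2) t by (metis DiffD1)
    moreover have "isCont \<gamma> t" using t ab by (intro curve_isCont[OF \<gamma>]) auto
    ultimately show "speed \<A> g \<gamma> t = sqrt (quad c (snd c (\<gamma> t)) (w t))"
      using t sub by (intro speed_eq[OF c]) auto
  qed simp
qed

text \<open>
  Without this, the length, being defined as a Henstock-Kurzweil integral, could be the default value 0
  for a long curve. Around each parameter \<open>x\<close> a short interval meets no break point except possibly
  \<open>x\<close> itself and is mapped into one chart domain, so both of its halves are pieces as above.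
\<close>

lemma speed_integrable:
  assumes \<gamma>: "piecewise_C1_curve \<A> \<gamma>"
  shows "speed \<A> g \<gamma> integrable_on {0..1}"
proof -
  obtain S where S: "finite S" "{0, 1} \<subseteq> S" "smooth_off_breakpoints S \<gamma>"
    using piecewise_C1_curveD[OF \<gamma>] by blast
  have "\<exists>d>0. \<forall>u v. x \<in> cbox u v \<and> cbox u v \<subseteq> ball x d \<and> cbox u v \<subseteq> cbox 0 1 \<longrightarrow>
        speed \<A> g \<gamma> integrable_on cbox u v" if x: "x \<in> cbox 0 (1::real)" for x
  proof -
    obtain c where c: "c \<in> \<A>" "\<gamma> x \<in> fst c" using chart_cover by blast
    have x01: "x \<in> {0..1}" using x by simp
    obtain e where e: "0 < e" "\<And>s. s \<in> {0..1} \<Longrightarrow> \<bar>s - x\<bar> < e \<Longrightarrow> \<gamma> s \<in> fst c"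
      using curve_piece_in_chart[OF \<gamma> c(1) x01 c(2)] by blast
    have "open (- (S - {x}))" using S(1) by (intro open_Compl finite_imp_closed) auto
    then obtain e' where e': "0 < e'" "ball x e' \<subseteq> - (S - {x})"
      using open_contains_ball by blast
    define d where "d = min e e'"
    have piece: "speed \<A> g \<gamma> integrable_on {a..b}"
      if ab: "a \<le> b" "{a..b} \<subseteq> ball x d" "{a..b} \<subseteq> {0..1}" "x \<notin> {a<..<b}" for a b
    proof (cases "a = b")
      case True
      then show ?thesis using integrable_on_refl[of "speed \<A> g \<gamma>" a] by simp
    next
      case False
      have inball: "\<bar>s - x\<bar> < d" if "s \<in> {a..b}" for s
        using ab(2) that by (auto simp: dist_real_def abs_minus_commute subset_iff)
      have ends: "0 \<le> a" "a < b" "b \<le> 1" using False ab(1,3) by auto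
      have sub: "\<gamma> ` {a..b} \<subseteq> fst c"
      proof
        fix y assume "y \<in> \<gamma> ` {a..b}"
        then obtain s where s: "s \<in> {a..b}" "y = \<gamma> s" by blast
        have "\<bar>s - x\<bar> < e" using inball[OF s(1)] by (simp add: d_def)
        then show "y \<in> fst c" using e(2)[of s] s ab(3) by blast
      qed
      have "{a<..<b} \<inter> S = {}"
      proof (rule ccontr)
        assume "{a<..<b} \<inter> S \<noteq> {}"
        then obtain s where s: "s \<in> {a<..<b}" "s \<in> S" by blast
        have "s \<in> ball x e'" using inball[of s] s(1) by (simp add: d_def dist_real_def abs_minus_commute)
        then have "s = x" using e'(2) s(2) by blast
        then show False using s(1) ab(4) by simp
      qed
      then obtain w where "continuous_on {a..b} w"
          "\<forall>t\<in>{a..b}. ((snd c \<circ> \<gamma>) has_vector_derivative w t) (at t within {a..b})"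
        using smooth_off_breakpointsD[OF S(3) c(1) ends _ sub] by blast
      then show ?thesis by (rule speed_integrable_piece[OF \<gamma> c(1) ends _ _ sub])
    qed
    have "speed \<A> g \<gamma> integrable_on cbox u v"
      if uv: "x \<in> cbox u v \<and> cbox u v \<subseteq> ball x d \<and> cbox u v \<subseteq> cbox 0 1" for u v
    proof -
      have xuv: "u \<le> x" "x \<le> v" and sub: "{u..v} \<subseteq> ball x d" "{u..v} \<subseteq> {0..1}" using uv by auto
      have "{u..x} \<subseteq> {u..v}" "{x..v} \<subseteq> {u..v}" using xuv by auto
      then have "speed \<A> g \<gamma> integrable_on {u..x}" "speed \<A> g \<gamma> integrable_on {x..v}"
        using xuv sub by (auto intro!: piece)
      then show ?thesis using Henstock_Kurzweil_Integration.integrable_combine[OF xuv] by simp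
    qed
    moreover have "0 < d" using e(1) e'(1) by (simp add: d_def)
    ultimately show ?thesis by blast
  qed
  then have "speed \<A> g \<gamma> integrable_on cbox 0 1"
    by (intro integrable_on_little_subintervals ballI)
  then show ?thesis by simp
qed

lemma curve_length_nonneg: "0 \<le> curve_length \<A> g \<gamma>"
  unfolding curve_length_def using speed_nonneg by (cases "speed \<A> g \<gamma> integrable_on {0..1}") (auto intro: integral_nonneg simp: not_integrable_integral)

section \<open>Short curves stay close\<close>


text \<open>
  The displacement in the chart is the integral of the derivative, and \<open>l\<close> times the Euclidean norm of
  the derivative is at most the speed.
\<close>

lemma chart_displacement_le_length:
  assumes \<gamma>: "piecewise_C1_curve \<A> \<gamma>" and c: "c \<in> \<A>" and \<tau>: "0 \<le> \<tau>" "\<tau> \<le> 1"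
    and sub: "\<gamma> ` {0..\<tau>} \<subseteq> fst c" and l: "0 < l"
    and bound: "\<And>t v. t \<in> {0..\<tau>} \<Longrightarrow> l * norm v \<le> sqrt (quad c (snd c (\<gamma> t)) v)"
  shows "l * norm (snd c (\<gamma> \<tau>) - snd c (\<gamma> 0)) \<le> curve_length \<A> g \<gamma>"
proof -
  let ?F = "snd c \<circ> \<gamma>"
  let ?F' = "\<lambda>t. vector_derivative ?F (at t)"
  obtain S where S: "finite S" "{0, 1} \<subseteq> S"
    "\<forall>c t. c \<in> \<A> \<longrightarrow> t \<in> {0..1} - S \<longrightarrow> \<gamma> t \<in> fst c \<longrightarrow>
      ((snd c \<circ> \<gamma>) has_vector_derivative vector_derivative (snd c \<circ> \<gamma>) (at t)) (at t)"
    using curve_differentiable[OF \<gamma>] by blast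
  have sub': "\<gamma> t \<in> fst c" if "t \<in> {0..\<tau>}" for t using sub that by blast
  have der: "(?F has_vector_derivative ?F' t) (at t)" if "t \<in> {0..\<tau>} - S" for t
    by (rule S(3)[rule_format, OF c]) (use sub'[of t] that \<tau> in auto)
  have "continuous_on {0..1} \<gamma>" using \<gamma> unfolding piecewise_C1_curve_def path_def by simp
  then have "continuous_on {0..\<tau>} \<gamma>" by (rule continuous_on_subset) (use \<tau> in auto)
  then have cont: "continuous_on {0..\<tau>} ?F"
    by (intro continuous_on_compose continuous_on_subset[OF continuous_chart[OF c] sub])
  have "(?F' has_integral (?F \<tau> - ?F 0)) {0..\<tau>}"
    by (rule fundamental_theorem_of_calculus_interior_strong[OF S(1) \<tau>(1) der cont]) auto
  \<comment> \<open>At the break points the derivative has an arbitrary default value, so it is replaced by 0 there.\<close>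
  then have int: "((\<lambda>t. if t \<in> S then 0 else ?F' t) has_integral (?F \<tau> - ?F 0)) {0..\<tau>}"
    by (rule has_integral_spike_finite[OF S(1), rotated]) auto
  have sp1: "speed \<A> g \<gamma> integrable_on {0..1}" by (rule speed_integrable[OF \<gamma>])
  have sp: "speed \<A> g \<gamma> integrable_on {0..\<tau>}"
    by (rule integrable_on_subinterval[OF sp1]) (use \<tau> in auto)
  have "norm (integral {0..\<tau>} (\<lambda>t. if t \<in> S then 0 else ?F' t)) \<le> integral {0..\<tau>} (\<lambda>t. speed \<A> g \<gamma> t / l)"
  proof (rule integral_norm_bound_integral)
    show "(\<lambda>t. if t \<in> S then 0 else ?F' t) integrable_on {0..\<tau>}" using int by (rule has_integral_integrable)
    show "(\<lambda>t. speed \<A> g \<gamma> t / l) integrable_on {0..\<tau>}" using sp by (rule integrable_on_divide)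
    fix t assume t: "t \<in> {0..\<tau>}"
    show "norm (if t \<in> S then 0 else ?F' t) \<le> speed \<A> g \<gamma> t / l"
    proof (cases "t \<in> S")
      case True
      then show ?thesis using speed_nonneg[of \<gamma> t] l by simp
    next
      case False
      then have "t \<noteq> 0" "t \<noteq> 1" using S(2) by auto
      then have "isCont \<gamma> t" using t \<tau> by (intro curve_isCont[OF \<gamma>]) auto
      then have "speed \<A> g \<gamma> t = sqrt (quad c (snd c (\<gamma> t)) (?F' t))"
        by (rule speed_eq[where \<gamma>=\<gamma> and t=t, OF c sub'[OF t] _ der]) (use t False in simp)
      then have "l * norm (?F' t) \<le> speed \<A> g \<gamma> t" using bound[OF t] by simp
      then show ?thesis using False l by (simp add: pos_le_divide_eq mult.commute)
    qed
  qed
  also have "integral {0..\<tau>} (\<lambda>t. speed \<A> g \<gamma> t / l) = integral {0..\<tau>} (speed \<A> g \<gamma>) / l" by simp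
  also have "\<dots> \<le> curve_length \<A> g \<gamma> / l"
    unfolding curve_length_def
    by (intro divide_right_mono integral_subset_le sp sp1) (use \<tau> l speed_nonneg in auto)
  finally have "norm (?F \<tau> - ?F 0) \<le> curve_length \<A> g \<gamma> / l"
    using integral_unique[OF int] by simp
  then show ?thesis using l by (simp add: pos_le_divide_eq mult.commute)
qed

text \<open>
  Let \<open>\<tau>\<close> be the first time at which a curve that starts in the chart ball of radius \<open>r/2\<close> is outside the
  chart ball of radius \<open>r\<close>. Up to then the metric dominates \<open>l\<^sup>2\<close> times the Euclidean one, so a curve shorter than
  \<open>l * (r/4)\<close> moves by less than \<open>r/4\<close> in the chart and stays in the closed ball of radius \<open>3*r/4\<close>. This
  ball is compact, hence closed in the manifold, and so also contains the point at time \<open>\<tau>\<close>.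
\<close>

lemma short_curves_stay_near:
  assumes U: "open U" "x\<^sub>0 \<in> U"
  shows "\<exists>V \<epsilon>. open V \<and> x\<^sub>0 \<in> V \<and> 0 < \<epsilon> \<and> (\<forall>\<gamma>. piecewise_C1_curve \<A> \<gamma> \<longrightarrow> pathstart \<gamma> \<in> V \<longrightarrow>
    curve_length \<A> g \<gamma> < \<epsilon> \<longrightarrow> pathfinish \<gamma> \<in> U)"
proof -
  obtain c where c: "c \<in> \<A>" "x\<^sub>0 \<in> fst c" using chart_cover by blast
  obtain r Q where r: "0 < r" and Q: "compact Q" "Q \<subseteq> snd c ` (fst c \<inter> U)"
    "snd c ` fst c \<inter> cball (snd c x\<^sub>0) r \<subseteq> Q"
    using chart_compact_convex_neighbourhood[OF c U] by blast
  let ?\<psi> = "inv_into (fst c) (snd c)"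
  have Qsub: "Q \<subseteq> snd c ` fst c" using Q(2) by blast
  have "snd c x\<^sub>0 \<in> snd c ` fst c \<inter> cball (snd c x\<^sub>0) r" using c(2) r by simp
  then have Qne: "Q \<noteq> {}" using Q(3) by blast
  obtain l where l: "0 < l" "\<And>q v. q \<in> Q \<Longrightarrow> l * norm v \<le> sqrt (quad c q v)"
    using quad_bounds[OF c(1) Q(1) Qne Qsub] by blast
  define V where "V \<rho> = fst c \<inter> snd c -` ball (snd c x\<^sub>0) \<rho>" for \<rho>
  have Vopen: "open (V \<rho>)" for \<rho> unfolding V_def by (rule open_chart_preimage[OF c(1) open_ball])
  have VQ: "snd c x \<in> Q" if "x \<in> V r" for x
  proof -
    have "snd c x \<in> snd c ` fst c \<inter> cball (snd c x\<^sub>0) r" using that unfolding V_def by auto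
    then show ?thesis using Q(3) by blast
  qed
  have VU: "x \<in> U" if "x \<in> V r" for x
  proof -
    have "snd c x \<in> snd c ` (fst c \<inter> U)" using VQ[OF that] Q(2) by blast
    then show ?thesis using chart_inj[OF c(1)] that unfolding V_def by (auto dest: inj_onD)
  qed
  have "pathfinish \<gamma> \<in> U" if \<gamma>: "piecewise_C1_curve \<A> \<gamma>" and start: "pathstart \<gamma> \<in> V (r/2)"
      and len: "curve_length \<A> g \<gamma> < l * (r/4)" for \<gamma>
  proof (rule ccontr)
    assume fin: "pathfinish \<gamma> \<notin> U"
    have cont: "continuous_on {0..1} \<gamma>" using \<gamma> unfolding piecewise_C1_curve_def path_def by simp
    let ?T = "{t \<in> {0..1}. \<gamma> t \<notin> V r}"
    have "closedin (top_of_set {0..1}) ({0..1} \<inter> \<gamma> -` (- V r))"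
      by (rule continuous_closedin_preimage[OF cont]) (use Vopen in auto)
    moreover have "{0..1} \<inter> \<gamma> -` (- V r) = ?T" by auto
    ultimately have "closed ?T" using closedin_closed_trans[of "{0..1}" ?T] by simp
    moreover have "?T \<noteq> {}" using fin VU unfolding pathfinish_def by force
    moreover have "bdd_below ?T" by (rule bdd_belowI[of _ 0]) auto
    ultimately have \<tau>T: "Inf ?T \<in> ?T" by (intro closed_contains_Inf)
    define \<tau> where "\<tau> = Inf ?T"
    have \<tau>: "\<tau> \<in> {0..1}" "\<gamma> \<tau> \<notin> V r" using \<tau>T unfolding \<tau>_def by auto
    have before: "\<gamma> t \<in> V r" if "0 \<le> t" "t < \<tau>" for t
    proof (rule ccontr)
      assume "\<gamma> t \<notin> V r"
      then have "t \<in> ?T" using that \<tau>(1) by auto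
      then have "\<tau> \<le> t" unfolding \<tau>_def using \<open>bdd_below ?T\<close> by (rule cInf_lower)
      then show False using that by simp
    qed
    have \<gamma>0: "\<gamma> 0 \<in> fst c" "dist (snd c x\<^sub>0) (snd c (\<gamma> 0)) < r/2" using start unfolding pathstart_def V_def by auto
    have "\<gamma> 0 \<in> V r" using \<gamma>0 r unfolding V_def by auto
    then have "\<tau> \<noteq> 0" using \<tau>(2) by metis
    then have \<tau>pos: "0 < \<tau>" using \<tau>(1) by simp
    let ?Z = "?\<psi> ` (Q \<inter> cball (snd c x\<^sub>0) (3*r/4))"
    have near: "\<gamma> t \<in> ?Z" if t: "0 \<le> t" "t < \<tau>" for t
    proof -
      have inV: "\<gamma> s \<in> V r" if "s \<in> {0..t}" for s using before[of s] that t by simp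
      have "l * norm (snd c (\<gamma> t) - snd c (\<gamma> 0)) \<le> curve_length \<A> g \<gamma>"
      proof (rule chart_displacement_le_length[OF \<gamma> c(1) t(1) _ _ l(1)])
        show "t \<le> 1" using t \<tau>(1) by simp
        show "\<gamma> ` {0..t} \<subseteq> fst c" using inV unfolding V_def by auto
        show "l * norm v \<le> sqrt (quad c (snd c (\<gamma> s)) v)" if "s \<in> {0..t}" for s v
          by (rule l(2)[OF VQ[OF inV[OF that]]])
      qed
      then have "l * norm (snd c (\<gamma> t) - snd c (\<gamma> 0)) < l * (r/4)" using len by simp
      then have "dist (snd c (\<gamma> t)) (snd c (\<gamma> 0)) < r/4" using l(1) by (simp add: dist_norm)
      then have "dist (snd c x\<^sub>0) (snd c (\<gamma> t)) \<le> 3*r/4"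
        using \<gamma>0(2) dist_triangle[of "snd c x\<^sub>0" "snd c (\<gamma> t)" "snd c (\<gamma> 0)"] by (simp add: dist_commute)
      moreover have \<gamma>t: "\<gamma> t \<in> fst c" using before[OF t] unfolding V_def by simp
      ultimately have "snd c (\<gamma> t) \<in> Q \<inter> cball (snd c x\<^sub>0) (3*r/4)" using VQ[OF before[OF t]] by simp
      then have "?\<psi> (snd c (\<gamma> t)) \<in> ?Z" by (rule imageI)
      then show ?thesis using chart_inj[OF c(1)] \<gamma>t by simp
    qed
    have "compact ?Z"
      using Qsub by (intro compact_continuous_image compact_Int_closed Q(1) closed_cball
          continuous_on_subset[OF continuous_chart_inverse[OF c(1)]]) auto
    then have Zcl: "closed ?Z" by (rule compact_imp_closed)
    have "((\<gamma>) \<longlongrightarrow> \<gamma> \<tau>) (at \<tau> within {0..<\<tau>})"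
    proof -
      have "(\<gamma> \<longlongrightarrow> \<gamma> \<tau>) (at \<tau> within {0..1})" using cont \<tau>(1) unfolding continuous_on_def by blast
      then show ?thesis by (rule tendsto_within_subset) (use \<tau>(1) in auto)
    qed
    moreover have "\<forall>\<^sub>F t in at \<tau> within {0..<\<tau>}. \<gamma> t \<in> ?Z"
      unfolding eventually_at_filter by (rule always_eventually) (use near in auto)
    moreover have "at \<tau> within {0..<\<tau>} \<noteq> bot"
      using \<tau>pos by (simp add: trivial_limit_within islimpt_Ico)
    ultimately have "\<gamma> \<tau> \<in> ?Z" using Lim_in_closed_set[OF Zcl] by blast
    then obtain q where q: "q \<in> Q \<inter> cball (snd c x\<^sub>0) (3*r/4)" "\<gamma> \<tau> = ?\<psi> q" by blast
    have qi: "q \<in> snd c ` fst c" using q(1) Qsub by blast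
    have "\<gamma> \<tau> \<in> fst c" "snd c (\<gamma> \<tau>) = q" unfolding q(2) using inv_into_into[OF qi] f_inv_into_f[OF qi] by auto
    then have "\<gamma> \<tau> \<in> V r" using q(1) r unfolding V_def by auto
    then show False using \<tau>(2) by simp
  qed
  moreover have "x\<^sub>0 \<in> V (r/2)" using c(2) r unfolding V_def by simp
  moreover have "0 < l * (r/4)" using l(1) r by simp
  ultimately show ?thesis using Vopen[of "r/2"]
    by (intro exI[of _ "V (r/2)"] exI[of _ "l * (r/4)"]) blast
qed

section \<open>Segments in charts\<close>


text \<open>
  In another chart the segment is a line followed by a coordinate change. A coordinate change has
  differentiable extensions only locally, near boundary points without a canonical choice, so the
  derivative \<open>w\<close> is taken to be the derivative within \<open>D\<close>; it agrees with the chain rule for every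
  local extension, because no point of \<open>D\<close> is isolated in \<open>D\<close>.
\<close>

lemma C1_curve_on_chart_segment:
  assumes c: "c \<in> \<A>" and pq: "closed_segment p q \<subseteq> snd c ` fst c" and ab: "0 \<le> a" "a < b" "b \<le> 1"
  shows "C1_curve_on \<A> (\<lambda>t. inv_into (fst c) (snd c) (linepath p q t)) a b"
  unfolding C1_curve_on_def Let_def
proof
  let ?\<gamma> = "\<lambda>t. inv_into (fst c) (snd c) (linepath p q t)"
  let ?L = "linepath p q"
  fix d assume d: "d \<in> \<A>"
  define D where "D = {t \<in> {a..b}. ?\<gamma> t \<in> fst d}"
  have Lin: "?L t \<in> snd c ` fst c" if "t \<in> {a..b}" for t
  proof -
    have "?L t \<in> closed_segment p q" using that ab by (intro linepath_in_path) auto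
    then show ?thesis using pq by blast
  qed
  have inc: "?\<gamma> t \<in> fst c" "snd c (?\<gamma> t) = ?L t" if "t \<in> {a..b}" for t
    using inv_into_into[OF Lin[OF that]] f_inv_into_f[OF Lin[OF that]] by auto
  have "continuous_on {a..b} ?\<gamma>"
    by (rule continuous_on_compose2[OF continuous_chart_inverse[OF c] continuous_on_linepath]) (use Lin in auto)
  then obtain V where V: "open V" "V \<inter> {a..b} = ?\<gamma> -` fst d \<inter> {a..b}"
    using open_chart[OF d] unfolding continuous_on_open_invariant by blast
  have DV: "D = {a..b} \<inter> V" using V(2) unfolding D_def by blast
  have limpt: "at t within D \<noteq> bot" if "t \<in> D" for t
  proof -
    have "t islimpt {a..b}" using that ab unfolding D_def by simp
    moreover have "\<forall>\<^sub>F s in at t. s \<in> V"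
      by (rule eventually_at_in_open'[OF V(1)]) (use that DV in blast)
    ultimately have "t islimpt D" unfolding DV by (rule islimpt_Int_eventually)
    then show ?thesis by (simp add: trivial_limit_within)
  qed
  let ?S = "snd c ` (fst c \<inter> fst d)"
  have LS: "?L t \<in> ?S" if "t \<in> D" for t
  proof -
    have t: "t \<in> {a..b}" "?\<gamma> t \<in> fst d" using that unfolding D_def by auto
    then have "snd c (?\<gamma> t) \<in> ?S" using inc(1)[OF t(1)] by (intro imageI IntI)
    then show ?thesis unfolding inc(2)[OF t(1)] .
  qed
  have eq: "snd d (?\<gamma> t) = transition c d (?L t)" if "t \<in> D" for t
    unfolding transition_def by simp
  define w where "w t = vector_derivative (snd d \<circ> ?\<gamma>) (at t within D)" for t
  have local: "\<exists>W G. open W \<and> t \<in> W \<and> continuous_on W G \<and>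
      (\<forall>s\<in>W \<inter> D. ((snd d \<circ> ?\<gamma>) has_vector_derivative G s) (at s within D))" if t: "t \<in> D" for t
  proof -
    obtain W G where W: "open W" "?L t \<in> W" "\<forall>y\<in>W. G differentiable (at y)"
      "\<forall>v. continuous_on W (\<lambda>y. frechet_derivative G (at y) v)" "\<forall>y\<in>W \<inter> ?S. G y = transition c d y"
      using smooth_on_local_extension[OF smooth_transition[OF c d] LS[OF t]] by blast
    have oW: "open (?L -` W)" by (intro open_vimage W(1) continuous_on_linepath)
    have "continuous_on (?L -` W) (\<lambda>s. frechet_derivative G (at (?L s)) (q - p))"
      by (rule continuous_on_compose2[OF W(4)[rule_format] continuous_on_linepath]) auto
    moreover have "((snd d \<circ> ?\<gamma>) has_vector_derivative frechet_derivative G (at (?L s)) (q - p)) (at s within D)"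
      if s: "s \<in> ?L -` W \<inter> D" for s
    proof -
      have G': "(G has_derivative frechet_derivative G (at (?L s))) (at (?L s))"
        using W(3) s by (simp add: frechet_derivative_works[symmetric])
      have "(?L has_vector_derivative (q - p)) (at s within D)" by (rule has_vector_derivative_linepath_within)
      then have "(?L has_derivative (\<lambda>h. h *\<^sub>R (q - p))) (at s within D)" by (simp add: has_vector_derivative_def)
      from has_derivative_compose[OF this G']
      have "((\<lambda>s. G (?L s)) has_derivative (\<lambda>h. frechet_derivative G (at (?L s)) (h *\<^sub>R (q - p)))) (at s within D)" .
      moreover have "frechet_derivative G (at (?L s)) (h *\<^sub>R (q - p)) = h *\<^sub>R frechet_derivative G (at (?L s)) (q - p)" for h
        using has_derivative_linear[OF G'] by (rule linear_cmul)
      ultimately have GL: "((\<lambda>s. G (?L s)) has_vector_derivative frechet_derivative G (at (?L s)) (q - p)) (at s within D)"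
        by (simp add: has_vector_derivative_def)
      obtain e where e: "0 < e" "ball s e \<subseteq> ?L -` W" using oW s open_contains_ball by blast
      show ?thesis
      proof (rule has_vector_derivative_transform_within[OF GL e(1)])
        show "s \<in> D" using s by simp
        fix s' assume s': "s' \<in> D" "dist s' s < e"
        then have "s' \<in> ball s e" by (simp add: dist_commute)
        then have "?L s' \<in> W" using e(2) by blast
        then show "G (?L s') = (snd d \<circ> ?\<gamma>) s'" using W(5) LS[OF s'(1)] eq[OF s'(1)] by simp
      qed
    qed
    ultimately show ?thesis using oW W(2)
      by (intro exI[of _ "?L -` W"] exI[of _ "\<lambda>s. frechet_derivative G (at (?L s)) (q - p)"]) auto
  qed
  have der: "((snd d \<circ> ?\<gamma>) has_vector_derivative w t) (at t within D)" if t: "t \<in> D" for t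
  proof -
    obtain y where y: "((snd d \<circ> ?\<gamma>) has_vector_derivative y) (at t within D)"
      using local[OF t] t by blast
    then show ?thesis unfolding w_def by (simp add: vector_derivative_within[OF limpt[OF t] y])
  qed
  have "continuous_on D w"
    unfolding continuous_on_eq_continuous_within
  proof
    fix t assume t: "t \<in> D"
    obtain W G where W: "open W" "t \<in> W" "continuous_on W G"
      "\<forall>s\<in>W \<inter> D. ((snd d \<circ> ?\<gamma>) has_vector_derivative G s) (at s within D)"
      using local[OF t] by blast
    have Gw: "G s = w s" if "s \<in> W \<inter> D" for s
      using vector_derivative_within[OF limpt W(4)[rule_format, OF that]] that unfolding w_def by simp
    have "isCont G t" using W(1,2,3) continuous_on_eq_continuous_at by blast
    then have "(G \<longlongrightarrow> G t) (at t within D)"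
      unfolding continuous_at by (rule tendsto_within_subset) simp
    moreover have "\<forall>\<^sub>F s in at t within D. G s = w s"
      unfolding eventually_at_topological using W(1,2) Gw by (intro exI[of _ W]) simp
    ultimately have "(w \<longlongrightarrow> G t) (at t within D)" by (rule Lim_transform_eventually)
    then show "continuous (at t within D) w" using Gw[of t] W(2) t by (simp add: continuous_within)
  qed
  then show "case d of (U, \<phi>) \<Rightarrow> \<exists>w. continuous_on {t \<in> {a..b}. ?\<gamma> t \<in> U} w \<and>
      (\<forall>t\<in>{t \<in> {a..b}. ?\<gamma> t \<in> U}. ((\<phi> \<circ> ?\<gamma>) has_vector_derivative w t) (at t within {t \<in> {a..b}. ?\<gamma> t \<in> U}))"
    using der unfolding case_prod_unfold D_def[symmetric] by blast
qed

lemma chart_segment_curve: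
  assumes c: "c \<in> \<A>" and pq: "closed_segment p q \<subseteq> snd c ` fst c"
    and bound: "\<And>z v. z \<in> closed_segment p q \<Longrightarrow> sqrt (quad c z v) \<le> L * norm v"
  shows "\<exists>\<gamma>. piecewise_C1_curve \<A> \<gamma> \<and> pathstart \<gamma> = inv_into (fst c) (snd c) p \<and>
    pathfinish \<gamma> = inv_into (fst c) (snd c) q \<and> curve_length \<A> g \<gamma> \<le> L * norm (q - p)"
proof -
  let ?\<psi> = "inv_into (fst c) (snd c)"
  let ?L = "linepath p q"
  define \<gamma> where "\<gamma> t = ?\<psi> (?L t)" for t
  have Lin: "?L t \<in> closed_segment p q" if "t \<in> {0..1}" for t
    using that by (rule linepath_in_path)
  have "continuous_on {0..1} \<gamma>" unfolding \<gamma>_def[abs_def]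
    by (rule continuous_on_compose2[OF continuous_chart_inverse[OF c] continuous_on_linepath]) (use Lin pq in auto)
  moreover have "C1_curve_on \<A> \<gamma> a b" if "0 \<le> a \<and> a < b \<and> b \<le> 1 \<and> {a<..<b} \<inter> {} = {}" for a b
    unfolding \<gamma>_def[abs_def] using that by (intro C1_curve_on_chart_segment[OF c pq]) auto
  ultimately have C: "piecewise_C1_curve \<A> \<gamma>"
    unfolding piecewise_C1_curve_def path_def by blast
  have inc: "\<gamma> t \<in> fst c" "snd c (\<gamma> t) = ?L t" if "t \<in> {0..1}" for t
  proof -
    have "?L t \<in> snd c ` fst c" using Lin[OF that] pq by blast
    then show "\<gamma> t \<in> fst c" "snd c (\<gamma> t) = ?L t" unfolding \<gamma>_def
      by (rule inv_into_into, rule f_inv_into_f)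
  qed
  have sp: "speed \<A> g \<gamma> t \<le> L * norm (q - p)" if t: "t \<in> {0<..<1}" for t
  proof -
    have t01: "t \<in> {0..1}" using t by simp
    have "(?L has_vector_derivative (q - p)) (at t)" by (rule has_vector_derivative_linepath_within)
    then have "((snd c \<circ> \<gamma>) has_vector_derivative (q - p)) (at t)"
      by (rule has_vector_derivative_transform_within_open[OF _ open_greaterThanLessThan t]) (use inc in simp)
    then have "speed \<A> g \<gamma> t = sqrt (quad c (snd c (\<gamma> t)) (q - p))"
      using t by (intro speed_eq[where \<gamma>=\<gamma> and t=t, OF c inc(1)[OF t01]] curve_isCont[OF C]) auto
    then show ?thesis using bound[OF Lin[OF t01]] inc(2)[OF t01] by simp
  qed
  have "curve_length \<A> g \<gamma> \<le> L * norm (q - p)"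
  proof -
    have "(speed \<A> g \<gamma> has_integral curve_length \<A> g \<gamma>) {0..1}"
      unfolding curve_length_def by (rule integrable_integral[OF speed_integrable[OF C]])
    then have "((\<lambda>t. if t \<in> {0, 1} then L * norm (q - p) else speed \<A> g \<gamma> t) has_integral curve_length \<A> g \<gamma>) {0..1}"
      by (rule has_integral_spike_finite[of "{0, 1}", rotated 2]) auto
    moreover have "((\<lambda>t::real. L * norm (q - p)) has_integral L * norm (q - p)) {0..1}"
      using has_integral_const_real[of "L * norm (q - p)" 0 1] by simp
    ultimately show ?thesis
    proof (rule has_integral_le)
      fix t :: real assume "t \<in> {0..1}"
      then show "(if t \<in> {0, 1} then L * norm (q - p) else speed \<A> g \<gamma> t) \<le> L * norm (q - p)"
        using sp[of t] by (cases "t = 0 \<or> t = 1") auto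
    qed
  qed
  then show ?thesis using C
    by (intro exI[of _ \<gamma>]) (simp add: pathstart_def pathfinish_def \<gamma>_def linepath_def)
qed

section \<open>Concatenation of curves\<close>


lemma C1_curve_on_affine:
  assumes C: "C1_curve_on \<A> \<gamma> (m * a + k) (m * b + k)" and m: "0 < m"
    and eq: "\<And>t. t \<in> {a..b} \<Longrightarrow> \<eta> t = \<gamma> (m * t + k)"
  shows "C1_curve_on \<A> \<eta> a b"
  unfolding C1_curve_on_def Let_def
proof
  fix d assume d: "d \<in> \<A>"
  let ?h = "\<lambda>t. m * t + k"
  define D where "D = {t \<in> {m * a + k..m * b + k}. \<gamma> t \<in> fst d}"
  define D' where "D' = {t \<in> {a..b}. \<eta> t \<in> fst d}"
  obtain w where w: "continuous_on D w" "\<forall>t\<in>D. ((snd d \<circ> \<gamma>) has_vector_derivative w t) (at t within D)"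
    using bspec[OF C[unfolded C1_curve_on_def Let_def] d] unfolding D_def by (auto simp: case_prod_unfold)
  have hD: "?h t \<in> D" if "t \<in> D'" for t
    using that eq[of t] m unfolding D_def D'_def by (auto intro: mult_left_mono)
  have "continuous_on D' (\<lambda>t. m *\<^sub>R w (?h t))"
    by (intro continuous_on_scaleR continuous_on_const continuous_on_compose2[OF w(1)] continuous_intros)
      (use hD in auto)
  moreover have "((snd d \<circ> \<eta>) has_vector_derivative m *\<^sub>R w (?h t)) (at t within D')" if t: "t \<in> D'" for t
  proof -
    have h: "(?h has_vector_derivative m) (at t within D')"
      by (auto intro!: derivative_eq_intros simp: has_real_derivative_iff_has_vector_derivative[symmetric])
    have "((snd d \<circ> \<gamma>) has_vector_derivative w (?h t)) (at (?h t) within ?h ` D')"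
      by (rule has_vector_derivative_within_subset[OF w(2)[rule_format, OF hD[OF t]]]) (use hD in blast)
    from vector_diff_chain_within[OF h this]
    have "((snd d \<circ> \<gamma> \<circ> ?h) has_vector_derivative m *\<^sub>R w (?h t)) (at t within D')" .
    then show ?thesis
      by (rule has_vector_derivative_transform_within[OF _ zero_less_one t])
        (use eq in \<open>simp add: D'_def\<close>)
  qed
  ultimately show "case d of (U, \<phi>) \<Rightarrow> \<exists>w. continuous_on {t \<in> {a..b}. \<eta> t \<in> U} w \<and>
      (\<forall>t\<in>{t \<in> {a..b}. \<eta> t \<in> U}. ((\<phi> \<circ> \<eta>) has_vector_derivative w t) (at t within {t \<in> {a..b}. \<eta> t \<in> U}))"
    unfolding case_prod_unfold D'_def[symmetric]
    by (intro exI[of _ "\<lambda>t. m *\<^sub>R w (?h t)"]) blast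
qed

text \<open>
  By the chain rule, away from the finitely many parameters at which the reparametrized curve may fail to
  be differentiable. The curve \<open>\<eta>\<close> need agree with the reparametrization only near \<open>t\<close>, as is the case
  for each half of a concatenation.
\<close>

lemma speed_affine:
  assumes \<gamma>: "piecewise_C1_curve \<A> \<gamma>" and m: "0 < m"
  shows "\<exists>S. finite S \<and> (\<forall>\<eta> N t. open N \<longrightarrow> t \<in> N \<longrightarrow> (\<forall>s\<in>N. \<eta> s = \<gamma> (m * s + k)) \<longrightarrow>
    m * t + k \<in> {0..1} \<longrightarrow> t \<notin> S \<longrightarrow> speed \<A> g \<eta> t = m * speed \<A> g \<gamma> (m * t + k))"
proof -
  obtain S where S: "finite S" "{0, 1} \<subseteq> S"
    "\<forall>c t. c \<in> \<A> \<longrightarrow> t \<in> {0..1} - S \<longrightarrow> \<gamma> t \<in> fst c \<longrightarrow>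
      ((snd c \<circ> \<gamma>) has_vector_derivative vector_derivative (snd c \<circ> \<gamma>) (at t)) (at t)"
    using curve_differentiable[OF \<gamma>] by blast
  let ?h = "\<lambda>t. m * t + k"
  have "speed \<A> g \<eta> t = m * speed \<A> g \<gamma> (?h t)"
    if N: "open N" "t \<in> N" "\<forall>s\<in>N. \<eta> s = \<gamma> (?h s)" and t: "?h t \<in> {0..1}" "t \<notin> ?h -` S" for \<eta> N t
  proof -
    define c where "c = (SOME c. c \<in> \<A> \<and> \<gamma> (?h t) \<in> fst c)"
    have c: "c \<in> \<A>" "\<gamma> (?h t) \<in> fst c" using chart_choice[of "\<gamma> (?h t)"] unfolding c_def by auto
    define v where "v = vector_derivative (snd c \<circ> \<gamma>) (at (?h t))"
    have v: "((snd c \<circ> \<gamma>) has_vector_derivative v) (at (?h t))"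
      unfolding v_def by (rule S(3)[rule_format, OF c(1) _ c(2)]) (use t in simp)
    have h: "(?h has_vector_derivative m) (at t)"
      by (auto intro!: derivative_eq_intros simp: has_real_derivative_iff_has_vector_derivative[symmetric])
    from vector_diff_chain_at[OF h v]
    have "((snd c \<circ> \<gamma> \<circ> ?h) has_vector_derivative m *\<^sub>R v) (at t)" .
    then have "((snd c \<circ> \<eta>) has_vector_derivative m *\<^sub>R v) (at t)"
      by (rule has_vector_derivative_transform_within_open[OF _ N(1,2)]) (use N(3) in simp)
    then have vd: "vector_derivative (snd c \<circ> \<eta>) (at t) = m *\<^sub>R v" by (rule vector_derivative_at)
    have \<eta>t: "\<eta> t = \<gamma> (?h t)" using N(2,3) by blast
    have "speed \<A> g \<eta> t = sqrt (quad c (snd c (\<gamma> (?h t))) (m *\<^sub>R v))"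
      unfolding speed_def Let_def \<eta>t c_def[symmetric] vd quad_def ..
    also have "\<dots> = m * sqrt (quad c (snd c (\<gamma> (?h t))) v)"
      using m unfolding quad_scale by (simp add: real_sqrt_mult)
    also have "sqrt (quad c (snd c (\<gamma> (?h t))) v) = speed \<A> g \<gamma> (?h t)"
      unfolding speed_def Let_def c_def[symmetric] v_def quad_def ..
    finally show ?thesis .
  qed
  moreover have "finite (?h -` S)"
    by (rule finite_vimageI[OF S(1)]) (use m in \<open>simp add: inj_def\<close>)
  ultimately show ?thesis by (intro exI[of _ "?h -` S"]) blast
qed

lemma speed_has_integral: "piecewise_C1_curve \<A> \<gamma> \<Longrightarrow> (speed \<A> g \<gamma> has_integral curve_length \<A> g \<gamma>) {0..1}"
  unfolding curve_length_def by (rule integrable_integral[OF speed_integrable])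

lemma speed_affine_has_integral:
  assumes \<gamma>: "piecewise_C1_curve \<A> \<gamma>" and m: "0 < m"
    and ab: "m * a + k = 0" "m * b + k = 1" and eq: "\<And>t. t \<in> {a<..<b} \<Longrightarrow> \<eta> t = \<gamma> (m * t + k)"
  shows "(speed \<A> g \<eta> has_integral curve_length \<A> g \<gamma>) {a..b}"
proof -
  let ?h = "\<lambda>t. m * t + k"
  obtain S where S: "finite S" "\<forall>\<eta> N t. open N \<longrightarrow> t \<in> N \<longrightarrow> (\<forall>s\<in>N. \<eta> s = \<gamma> (?h s)) \<longrightarrow>
    ?h t \<in> {0..1} \<longrightarrow> t \<notin> S \<longrightarrow> speed \<A> g \<eta> t = m * speed \<A> g \<gamma> (?h t)"
    using speed_affine[OF \<gamma> m, of k] by (elim exE conjE) (rule that)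
  have "(0 - k) / m = a" "(1 - k) / m = b" using m ab by (auto simp: field_simps)
  moreover have "((\<lambda>t. speed \<A> g \<gamma> (m *\<^sub>R t + k)) has_integral (curve_length \<A> g \<gamma> /\<^sub>R m ^ DIM(real)))
      (cbox ((0 - k) /\<^sub>R m) ((1 - k) /\<^sub>R m))"
    by (rule has_integral_affinity'[OF _ m]) (use speed_has_integral[OF \<gamma>] in simp)
  ultimately have "((\<lambda>t. speed \<A> g \<gamma> (?h t)) has_integral (curve_length \<A> g \<gamma> / m)) {a..b}"
    by (simp add: divide_inverse mult.commute)
  then have "((\<lambda>t. m * speed \<A> g \<gamma> (?h t)) has_integral (m * (curve_length \<A> g \<gamma> / m))) {a..b}"
    by (rule has_integral_mult_right)
  then have "((\<lambda>t. m * speed \<A> g \<gamma> (?h t)) has_integral curve_length \<A> g \<gamma>) {a..b}" using m by simp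
  then show ?thesis
  proof (rule has_integral_spike_finite[of "S \<union> {a, b}", rotated 2])
    fix t assume t: "t \<in> {a..b} - (S \<union> {a, b})"
    then have t': "t \<in> {a<..<b}" "t \<notin> S" by auto
    have "m * a \<le> m * t" "m * t \<le> m * b" using t' m by simp_all
    then have "?h t \<in> {0..1}" using ab by simp
    then show "speed \<A> g \<eta> t = m * speed \<A> g \<gamma> (?h t)"
      using S(2)[rule_format, OF open_greaterThanLessThan t'(1) _ _ t'(2), of \<eta>] eq by blast
  qed (use S(1) in simp)
qed

text \<open>
  Each half of the concatenation is an affine reparametrization of one curve; the junction \<open>1/2\<close> becomes
  a break point.
\<close>

lemma
  assumes \<gamma>: "piecewise_C1_curve \<A> \<gamma>" and \<eta>: "piecewise_C1_curve \<A> \<eta>" and join: "pathfinish \<gamma> = pathstart \<eta>"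
  shows piecewise_C1_join: "piecewise_C1_curve \<A> (\<gamma> +++ \<eta>)"
    and curve_length_join: "curve_length \<A> g (\<gamma> +++ \<eta>) = curve_length \<A> g \<gamma> + curve_length \<A> g \<eta>"
proof -
  obtain S where S: "finite S" "\<And>a b. 0 \<le> a \<and> a < b \<and> b \<le> 1 \<and> {a<..<b} \<inter> S = {} \<Longrightarrow> C1_curve_on \<A> \<gamma> a b"
    using \<gamma> unfolding piecewise_C1_curve_def by blast
  obtain S' where S': "finite S'" "\<And>a b. 0 \<le> a \<and> a < b \<and> b \<le> 1 \<and> {a<..<b} \<inter> S' = {} \<Longrightarrow> C1_curve_on \<A> \<eta> a b"
    using \<eta> unfolding piecewise_C1_curve_def by blast
  let ?j = "\<gamma> +++ \<eta>"
  have left: "?j t = \<gamma> (2 * t + 0)" if "t \<le> 1/2" for t using that by (simp add: joinpaths_def)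
  have right: "?j t = \<eta> (2 * t + (-1))" if "1/2 \<le> t" for t
  proof (cases "t = 1/2")
    case True
    show ?thesis unfolding True using join by (simp add: joinpaths_def pathfinish_def pathstart_def)
  next
    case False
    then show ?thesis using that by (simp add: joinpaths_def)
  qed
  let ?T = "(\<lambda>t. 2 * t + 0) -` S \<union> {1/2} \<union> (\<lambda>t. 2 * t + (-1)) -` S'"
  have inj: "inj (\<lambda>t::real. 2 * t + k)" for k by (simp add: inj_def)
  have finT: "finite ?T" by (intro finite_UnI finite_vimageI S(1) S'(1) inj finite.intros)
  have C1j: "C1_curve_on \<A> ?j a b" if ab: "0 \<le> a \<and> a < b \<and> b \<le> 1 \<and> {a<..<b} \<inter> ?T = {}" for a b
  proof -
    have "1/2 \<notin> {a<..<b}" using ab by blast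
    then consider "b \<le> 1/2" | "1/2 \<le> a" by (meson greaterThanLessThan_iff not_le)
    then show ?thesis
    proof cases
      case 1
      have "{2 * a + 0<..<2 * b + 0} \<inter> S = {}"
      proof (rule ccontr)
        assume "\<not> ?thesis"
        then obtain s where "s \<in> {2 * a + 0<..<2 * b + 0}" "s \<in> S" by blast
        then have "s/2 \<in> {a<..<b}" "s/2 \<in> ?T" by auto
        then show False using ab by blast
      qed
      then have "C1_curve_on \<A> \<gamma> (2 * a + 0) (2 * b + 0)" using ab 1 by (intro S(2)) auto
      then show ?thesis by (rule C1_curve_on_affine) (use left 1 in auto)
    next
      case 2
      have "{2 * a + (-1)<..<2 * b + (-1)} \<inter> S' = {}"
      proof (rule ccontr)
        assume "\<not> ?thesis"
        then obtain s where "s \<in> {2 * a + (-1)<..<2 * b + (-1)}" "s \<in> S'" by blast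
        then have "(s + 1)/2 \<in> {a<..<b}" "(s + 1)/2 \<in> ?T" by (auto simp: field_simps)
        then show False using ab by blast
      qed
      then have "C1_curve_on \<A> \<eta> (2 * a + (-1)) (2 * b + (-1))" using ab 2 by (intro S'(2)) auto
      then show ?thesis by (rule C1_curve_on_affine) (use right 2 in auto)
    qed
  qed
  have pj: "path ?j" using \<gamma> \<eta> join unfolding piecewise_C1_curve_def by (intro path_join_imp) auto
  show "piecewise_C1_curve \<A> ?j" unfolding piecewise_C1_curve_def
    by (intro conjI exI[of _ ?T] allI impI pj finT) (rule C1j)
  have "(speed \<A> g ?j has_integral curve_length \<A> g \<gamma>) {0..1/2}"
    by (rule speed_affine_has_integral[OF \<gamma>, of 2 _ 0]) (use left in auto)
  moreover have "(speed \<A> g ?j has_integral curve_length \<A> g \<eta>) {1/2..1}"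
    by (rule speed_affine_has_integral[OF \<eta>, of 2 _ "-1"]) (use right in auto)
  ultimately have "(speed \<A> g ?j has_integral (curve_length \<A> g \<gamma> + curve_length \<A> g \<eta>)) {0..1}"
    by (rule has_integral_combine[rotated 2]) auto
  then show "curve_length \<A> g ?j = curve_length \<A> g \<gamma> + curve_length \<A> g \<eta>"
    unfolding curve_length_def[of _ _ ?j] by (rule integral_unique)
qed

section \<open>Riemannian balls and the Riemannian volume\<close>


text \<open>
  Segments in a compact convex part of a chart are at most \<open>L\<close> times as long as in Euclidean space. Both
  directions are needed to attach such segments to either end of a curve.
\<close>

lemma short_curves_nearby:
  assumes \<epsilon>: "0 < \<epsilon>"
  shows "\<exists>V. open V \<and> x\<^sub>0 \<in> V \<and> (\<forall>x\<in>V.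
    (\<exists>\<gamma>. piecewise_C1_curve \<A> \<gamma> \<and> pathstart \<gamma> = x\<^sub>0 \<and> pathfinish \<gamma> = x \<and> curve_length \<A> g \<gamma> < \<epsilon>) \<and>
    (\<exists>\<gamma>. piecewise_C1_curve \<A> \<gamma> \<and> pathstart \<gamma> = x \<and> pathfinish \<gamma> = x\<^sub>0 \<and> curve_length \<A> g \<gamma> < \<epsilon>))"
proof -
  obtain c where c: "c \<in> \<A>" "x\<^sub>0 \<in> fst c" using chart_cover by blast
  obtain r Q where r: "0 < r" and Q: "compact Q" "convex Q" "Q \<subseteq> snd c ` fst c"
    "snd c ` fst c \<inter> cball (snd c x\<^sub>0) r \<subseteq> Q"
    using chart_compact_convex_neighbourhood[OF c open_UNIV UNIV_I] by auto
  have "snd c x\<^sub>0 \<in> snd c ` fst c \<inter> cball (snd c x\<^sub>0) r" using c(2) r by simp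
  then have x0Q: "snd c x\<^sub>0 \<in> Q" using Q(4) by blast
  then have Qne: "Q \<noteq> {}" by blast
  obtain L where L: "0 \<le> L" "\<And>q v. q \<in> Q \<Longrightarrow> sqrt (quad c q v) \<le> L * norm v"
    using quad_bounds[OF c(1) Q(1) Qne Q(3)] by blast
  define \<delta> where "\<delta> = min r (\<epsilon> / (L + 1))"
  have \<delta>: "0 < \<delta>" "\<delta> \<le> r" using r \<epsilon> L(1) by (simp_all add: \<delta>_def)
  have "(L + 1) * \<delta> \<le> (L + 1) * (\<epsilon> / (L + 1))" using L(1) by (intro mult_left_mono) (simp_all add: \<delta>_def)
  then have \<delta>\<epsilon>: "(L + 1) * \<delta> \<le> \<epsilon>" using L(1) by simp
  let ?V = "fst c \<inter> snd c -` ball (snd c x\<^sub>0) \<delta>"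
  have seg: "\<exists>\<gamma>. piecewise_C1_curve \<A> \<gamma> \<and> pathstart \<gamma> = x \<and> pathfinish \<gamma> = y \<and> curve_length \<A> g \<gamma> < \<epsilon>"
    if xy: "x \<in> fst c" "y \<in> fst c" "snd c x \<in> Q" "snd c y \<in> Q" "dist (snd c x) (snd c y) < \<delta>" for x y
  proof -
    have sub: "closed_segment (snd c x) (snd c y) \<subseteq> Q" using xy(3,4) Q(2) by (rule closed_segment_subset)
    have "sqrt (quad c z v) \<le> L * norm v" if "z \<in> closed_segment (snd c x) (snd c y)" for z v
      using L(2) sub that by blast
    from chart_segment_curve[OF c(1) order_trans[OF sub Q(3)] this]
    obtain \<gamma> where \<gamma>: "piecewise_C1_curve \<A> \<gamma>" "pathstart \<gamma> = inv_into (fst c) (snd c) (snd c x)"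
      "pathfinish \<gamma> = inv_into (fst c) (snd c) (snd c y)" "curve_length \<A> g \<gamma> \<le> L * norm (snd c y - snd c x)" by blast
    have "L * norm (snd c y - snd c x) \<le> L * \<delta>"
      using L(1) xy(5) by (intro mult_left_mono) (auto simp: dist_norm norm_minus_commute)
    also have "\<dots> < (L + 1) * \<delta>" using \<delta>(1) by (simp add: distrib_right)
    finally have "curve_length \<A> g \<gamma> < \<epsilon>" using \<gamma>(4) \<delta>\<epsilon> by linarith
    then show ?thesis using \<gamma>(1,2,3) xy(1,2) chart_inj[OF c(1)] by auto
  qed
  have VQ: "snd c x \<in> Q" if "x \<in> ?V" for x
  proof -
    have "snd c x \<in> snd c ` fst c \<inter> cball (snd c x\<^sub>0) r" using that \<delta>(2) by auto
    then show ?thesis using Q(4) by blast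
  qed
  show ?thesis
  proof (intro exI[of _ ?V] conjI ballI)
    show "open ?V" by (rule open_chart_preimage[OF c(1) open_ball])
    show "x\<^sub>0 \<in> ?V" using c(2) \<delta>(1) by simp
    fix x assume x: "x \<in> ?V"
    then have d: "x \<in> fst c" "dist (snd c x\<^sub>0) (snd c x) < \<delta>" by auto
    show "\<exists>\<gamma>. piecewise_C1_curve \<A> \<gamma> \<and> pathstart \<gamma> = x\<^sub>0 \<and> pathfinish \<gamma> = x \<and> curve_length \<A> g \<gamma> < \<epsilon>"
      by (rule seg[OF c(2) d(1) x0Q VQ[OF x] d(2)])
    show "\<exists>\<gamma>. piecewise_C1_curve \<A> \<gamma> \<and> pathstart \<gamma> = x \<and> pathfinish \<gamma> = x\<^sub>0 \<and> curve_length \<A> g \<gamma> < \<epsilon>"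
      by (rule seg[OF d(1) c(2) VQ[OF x] x0Q]) (use d(2) in \<open>simp add: dist_commute\<close>)
  qed
qed

lemma riemannian_ball_iff:
  "y \<in> riemannian_ball \<A> g x \<epsilon> \<longleftrightarrow>
    (\<exists>\<gamma>. piecewise_C1_curve \<A> \<gamma> \<and> pathstart \<gamma> = x \<and> pathfinish \<gamma> = y \<and> curve_length \<A> g \<gamma> < \<epsilon>)"
  unfolding riemannian_ball_def riemannian_dist_def mem_Collect_eq INF_less_iff
  by (auto simp: ennreal_less_iff[OF curve_length_nonneg])

lemma center_in_riemannian_ball: "0 < \<epsilon> \<Longrightarrow> x \<in> riemannian_ball \<A> g x \<epsilon>"
  unfolding riemannian_ball_iff using short_curves_nearby[of \<epsilon> x] by blast

text \<open>
  A curve from \<open>x\<close> to \<open>y\<close> that is shorter than \<open>\<epsilon>\<close> leaves some slack, which is spent on short curves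
  from \<open>x'\<close> to \<open>x\<close> and from \<open>y\<close> to \<open>y'\<close>.
\<close>

lemma open_riemannian_balls: "open {(x, y). y \<in> riemannian_ball \<A> g x \<epsilon>}"
proof (rule Topological_Spaces.openI)
  fix z assume z: "z \<in> {(x, y). y \<in> riemannian_ball \<A> g x \<epsilon>}"
  obtain x y where xy: "z = (x, y)" by (cases z)
  then have "y \<in> riemannian_ball \<A> g x \<epsilon>" using z by simp
  then obtain \<gamma> where \<gamma>: "piecewise_C1_curve \<A> \<gamma>" "pathstart \<gamma> = x" "pathfinish \<gamma> = y" "curve_length \<A> g \<gamma> < \<epsilon>"
    unfolding riemannian_ball_iff by blast
  define \<delta> where "\<delta> = (\<epsilon> - curve_length \<A> g \<gamma>) / 2"
  have \<delta>: "0 < \<delta>" using \<gamma>(4) by (simp add: \<delta>_def)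
  obtain V where V: "open V" "x \<in> V" "\<And>x'. x' \<in> V \<Longrightarrow>
    \<exists>\<gamma>. piecewise_C1_curve \<A> \<gamma> \<and> pathstart \<gamma> = x' \<and> pathfinish \<gamma> = x \<and> curve_length \<A> g \<gamma> < \<delta>"
    using short_curves_nearby[OF \<delta>, of x] by blast
  obtain W where W: "open W" "y \<in> W" "\<And>y'. y' \<in> W \<Longrightarrow>
    \<exists>\<gamma>. piecewise_C1_curve \<A> \<gamma> \<and> pathstart \<gamma> = y \<and> pathfinish \<gamma> = y' \<and> curve_length \<A> g \<gamma> < \<delta>"
    using short_curves_nearby[OF \<delta>, of y] by blast
  have "y' \<in> riemannian_ball \<A> g x' \<epsilon>" if xV: "x' \<in> V" and yW: "y' \<in> W" for x' y'
  proof -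
    obtain \<alpha> where \<alpha>: "piecewise_C1_curve \<A> \<alpha>" "pathstart \<alpha> = x'" "pathfinish \<alpha> = x" "curve_length \<A> g \<alpha> < \<delta>"
      using V(3)[OF xV] by blast
    obtain \<beta> where \<beta>: "piecewise_C1_curve \<A> \<beta>" "pathstart \<beta> = y" "pathfinish \<beta> = y'" "curve_length \<A> g \<beta> < \<delta>"
      using W(3)[OF yW] by blast
    have j1: "pathfinish \<alpha> = pathstart \<gamma>" using \<alpha>(3) \<gamma>(2) by simp
    have j2: "pathfinish (\<alpha> +++ \<gamma>) = pathstart \<beta>" using \<gamma>(3) \<beta>(2) by simp
    note C = piecewise_C1_join[OF \<alpha>(1) \<gamma>(1) j1]
    have "curve_length \<A> g ((\<alpha> +++ \<gamma>) +++ \<beta>) < \<epsilon>"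
      using curve_length_join[OF C \<beta>(1) j2] curve_length_join[OF \<alpha>(1) \<gamma>(1) j1] \<alpha>(4) \<beta>(4)
      by (simp add: \<delta>_def)
    then show ?thesis unfolding riemannian_ball_iff
      using piecewise_C1_join[OF C \<beta>(1) j2] \<alpha>(2) \<beta>(3)
      by (intro exI[of _ "(\<alpha> +++ \<gamma>) +++ \<beta>"]) simp
  qed
  then have "V \<times> W \<subseteq> {(x, y). y \<in> riemannian_ball \<A> g x \<epsilon>}" by auto
  moreover have "open (V \<times> W)" using V(1) W(1) by (rule open_Times)
  ultimately show "\<exists>T. open T \<and> z \<in> T \<and> T \<subseteq> {(x, y). y \<in> riemannian_ball \<A> g x \<epsilon>}"
    using V(2) W(2) xy by (intro exI[of _ "V \<times> W"]) simp
qed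

text \<open>
  Around each point \<open>z\<close>, short curves starting near \<open>z\<close> end where \<open>\<phi>\<close> is within \<open>\<eta>/2\<close> of \<open>\<phi> z\<close>; finitely
  many such neighbourhoods cover the compact manifold.
\<close>

lemma riemannian_balls_uniformly_small:
  fixes \<phi> :: "'a \<Rightarrow> real"
  assumes comp: "compact (UNIV :: 'a set)" and \<phi>: "continuous_on UNIV \<phi>" and \<eta>: "0 < \<eta>"
  shows "\<exists>\<epsilon>\<^sub>0>0. \<forall>\<epsilon> x. \<forall>y\<in>riemannian_ball \<A> g x \<epsilon>. \<epsilon> \<le> \<epsilon>\<^sub>0 \<longrightarrow> \<bar>\<phi> y - \<phi> x\<bar> < \<eta>"
proof -
  define U where "U z = \<phi> -` ball (\<phi> z) (\<eta>/2)" for z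
  have U: "open (U z)" "z \<in> U z" for z
    unfolding U_def using \<eta> by (auto intro: open_vimage[OF open_ball \<phi>])
  have "\<exists>V \<epsilon>. open V \<and> z \<in> V \<and> 0 < \<epsilon> \<and> (\<forall>\<gamma>. piecewise_C1_curve \<A> \<gamma> \<longrightarrow> pathstart \<gamma> \<in> V \<longrightarrow>
    curve_length \<A> g \<gamma> < \<epsilon> \<longrightarrow> pathfinish \<gamma> \<in> U z)" for z
    by (rule short_curves_stay_near[OF U])
  then obtain V \<epsilon> where V: "\<And>z. open (V z)" "\<And>z. z \<in> V z" "\<And>z. 0 < \<epsilon> z"
    "\<And>z. \<forall>\<gamma>. piecewise_C1_curve \<A> \<gamma> \<longrightarrow> pathstart \<gamma> \<in> V z \<longrightarrow> curve_length \<A> g \<gamma> < \<epsilon> z \<longrightarrow> pathfinish \<gamma> \<in> U z"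
    by metis
  obtain F where F: "finite F" "UNIV \<subseteq> (\<Union>z\<in>F. V z \<inter> U z)"
  proof (rule compactE_image[OF comp, of UNIV "\<lambda>z. V z \<inter> U z"])
    show "UNIV \<subseteq> (\<Union>z. V z \<inter> U z)" using V(2) U(2) by blast
  qed (use V(1) U(1) in auto)
  have "F \<noteq> {}" using F(2) by auto
  define \<epsilon>\<^sub>0 where "\<epsilon>\<^sub>0 = Min (\<epsilon> ` F)"
  have "0 < \<epsilon>\<^sub>0" unfolding \<epsilon>\<^sub>0_def using F(1) \<open>F \<noteq> {}\<close> V(3) by simp
  moreover have "\<bar>\<phi> y - \<phi> x\<bar> < \<eta>" if y: "y \<in> riemannian_ball \<A> g x \<delta>" and \<delta>: "\<delta> \<le> \<epsilon>\<^sub>0" for \<delta> x y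
  proof -
    obtain z where z: "z \<in> F" "x \<in> V z" "x \<in> U z" using F(2) by blast
    obtain \<gamma> where \<gamma>: "piecewise_C1_curve \<A> \<gamma>" "pathstart \<gamma> = x" "pathfinish \<gamma> = y" "curve_length \<A> g \<gamma> < \<delta>"
      using y unfolding riemannian_ball_iff by blast
    have "\<epsilon>\<^sub>0 \<le> \<epsilon> z" unfolding \<epsilon>\<^sub>0_def using F(1) z(1) by simp
    then have "curve_length \<A> g \<gamma> < \<epsilon> z" using \<gamma>(4) \<delta> by linarith
    then have "y \<in> U z" using V(4)[of z, rule_format, OF \<gamma>(1)] \<gamma>(2,3) z(2) by simp
    then have "\<bar>\<phi> z - \<phi> y\<bar> < \<eta>/2" "\<bar>\<phi> z - \<phi> x\<bar> < \<eta>/2" using z(3) unfolding U_def by (simp_all add: dist_real_def)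
    then show ?thesis by linarith
  qed
  ultimately show ?thesis by blast
qed

lemma continuous_density: "c \<in> \<A> \<Longrightarrow> continuous_on (snd c ` fst c) (\<lambda>q. sqrt (det (g c q)))"
  by (intro continuous_on_real_sqrt continuous_on_det metric_continuous)

lemma density_pos: "c \<in> \<A> \<Longrightarrow> q \<in> snd c ` fst c \<Longrightarrow> 0 < sqrt (det (g c q))"
  using positive_definite_det_pos[of "g c q"] quad_pos[of c q] unfolding quad_def by simp

lemma volume_eq:
  assumes "riemannian_volume \<A> g m" "c \<in> \<A>" "A \<in> sets borel" "A \<subseteq> fst c"
  shows "emeasure m A = (\<integral>\<^sup>+x\<in>snd c ` A. ennreal (sqrt (det (g c x))) \<partial>lborel)"
  using assms unfolding riemannian_volume_def by blast

text \<open>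
  In a compact part of a chart the density is bounded, and finitely many such parts cover the manifold.
\<close>

lemma volume_finite:
  assumes comp: "compact (UNIV :: 'a set)" and m: "riemannian_volume \<A> g m"
  shows "emeasure m UNIV < \<infinity>"
proof -
  have "\<exists>V. open V \<and> x \<in> V \<and> emeasure m V < \<infinity>" for x
  proof -
    obtain c where c: "c \<in> \<A>" "x \<in> fst c" using chart_cover by blast
    obtain r Q where r: "0 < r" and Q: "compact Q" "Q \<subseteq> snd c ` fst c"
      "snd c ` fst c \<inter> cball (snd c x) r \<subseteq> Q"
      using chart_compact_convex_neighbourhood[OF c open_UNIV UNIV_I] by auto
    have "compact ((\<lambda>q. sqrt (det (g c q))) ` Q)"
      by (intro compact_continuous_image continuous_on_subset[OF continuous_density[OF c(1)] Q(2)] Q(1))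
    then have "bounded ((\<lambda>q. sqrt (det (g c q))) ` Q)" by (rule compact_imp_bounded)
    then obtain C where "\<forall>y\<in>(\<lambda>q. sqrt (det (g c q))) ` Q. norm y \<le> C" unfolding bounded_iff ..
    then have C: "sqrt (det (g c q)) \<le> C" if "q \<in> Q" for q using that by (auto intro: abs_le_D1)
    let ?V = "fst c \<inter> snd c -` ball (snd c x) r"
    have oV: "open ?V" by (rule open_chart_preimage[OF c(1) open_ball])
    have "snd c ` ?V \<subseteq> snd c ` fst c \<inter> cball (snd c x) r" by auto
    then have VQ: "snd c ` ?V \<subseteq> Q" using Q(3) by (rule order_trans)
    have "emeasure m ?V = (\<integral>\<^sup>+q\<in>snd c ` ?V. ennreal (sqrt (det (g c q))) \<partial>lborel)"
      using oV by (intro volume_eq[OF m c(1)]) auto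
    also have "\<dots> \<le> (\<integral>\<^sup>+q. ennreal C * indicator (cball (snd c x) r) q \<partial>lborel)"
    proof (rule nn_integral_mono)
      fix q
      show "ennreal (sqrt (det (g c q))) * indicator (snd c ` ?V) q \<le> ennreal C * indicator (cball (snd c x) r) q"
      proof (cases "q \<in> snd c ` ?V")
        case True
        then have "q \<in> Q" "q \<in> cball (snd c x) r" using VQ by auto
        then show ?thesis using C[of q] True by (simp add: ennreal_leI)
      qed simp
    qed
    also have "\<dots> = ennreal C * emeasure lborel (cball (snd c x) r)"
      by (rule nn_integral_cmult_indicator) simp
    also have "\<dots> < \<infinity>" using emeasure_lborel_cball_finite[of "snd c x" r] by (simp add: ennreal_mult_less_top less_top)
    finally show ?thesis using oV c(2) r by (intro exI[of _ ?V]) simp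
  qed
  then obtain V where V: "\<And>x. open (V x)" "\<And>x. x \<in> V x" "\<And>x. emeasure m (V x) < \<infinity>" by metis
  obtain F where F: "finite F" "UNIV \<subseteq> (\<Union>z\<in>F. V z)"
  proof (rule compactE_image[OF comp, of UNIV V])
    show "UNIV \<subseteq> (\<Union>z. V z)" using V(2) by blast
  qed (use V(1) in auto)
  have sm: "sets m = sets borel" using m unfolding riemannian_volume_def by blast
  have "emeasure m UNIV \<le> emeasure m (\<Union>z\<in>F. V z)"
    using F V(1) sm by (intro emeasure_mono) auto
  also have "\<dots> \<le> (\<Sum>z\<in>F. emeasure m (V z))"
    using F(1) V(1) sm by (intro emeasure_subadditive_finite) auto
  also have "\<dots> < \<infinity>" using F(1) V(3) by (simp add: ennreal_sum_less_top)
  finally show ?thesis .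
qed

text \<open>
  The image of \<open>U\<close> in a chart contains a Euclidean ball, also if \<open>U\<close> lies near the boundary: moving the
  image of a point slightly in the direction \<open>b\<close> leads to the interior of the half-space. On a small
  ball there the density exceeds a positive constant.
\<close>

lemma volume_pos:
  assumes m: "riemannian_volume \<A> g m" and U: "open U" "U \<noteq> {}"
  shows "0 < emeasure m U"
proof -
  obtain x where x: "x \<in> U" using U(2) by blast
  obtain c where c: "c \<in> \<A>" "x \<in> fst c" using chart_cover by blast
  obtain b r where r: "0 < r" "snd c ` fst c \<subseteq> {q. 0 \<le> b \<bullet> q}"
    "cball (snd c x) r \<inter> {q. 0 \<le> b \<bullet> q} \<subseteq> snd c ` (fst c \<inter> U)"
    by (rule chart_relative_ball[OF c U(1) x])
  define p where "p = snd c x + (r / (2 * (norm b + 1))) *\<^sub>R b"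
  have nb: "0 < 2 * (norm b + 1)" by (intro mult_pos_pos add_nonneg_pos) auto
  have pr: "dist (snd c x) p < r"
  proof -
    have "dist (snd c x) p = r / (2 * (norm b + 1)) * norm b"
      using r(1) nb by (simp add: p_def dist_norm)
    also have "\<dots> < r / (2 * (norm b + 1)) * (2 * (norm b + 1))"
      using r(1) nb by (intro mult_strict_left_mono) auto
    also have "\<dots> = r" using nb by simp
    finally show ?thesis .
  qed
  have bx: "0 \<le> b \<bullet> snd c x" using r(2) c(2) by blast
  have "\<exists>W. open W \<and> p \<in> W \<and> W \<subseteq> {q. 0 \<le> b \<bullet> q}"
  proof (cases "b = 0")
    case False
    have "0 < b \<bullet> p" using bx r(1) nb False unfolding p_def
      by (simp add: inner_add_right add_nonneg_pos)
    then show ?thesis by (intro exI[of _ "{q. 0 < b \<bullet> q}"]) (auto simp: open_halfspace_gt)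
  qed (auto intro!: exI[of _ UNIV])
  then obtain W where W: "open W" "p \<in> W" "W \<subseteq> {q. 0 \<le> b \<bullet> q}" by blast
  define B where "B = W \<inter> ball (snd c x) r"
  have B: "open B" "p \<in> B" using W(1,2) pr unfolding B_def by auto
  have Bsub: "B \<subseteq> snd c ` (fst c \<inter> U)" using W(3) r(3) unfolding B_def by fastforce
  let ?h = "\<lambda>q. sqrt (det (g c q))"
  have hc: "continuous_on B ?h"
    by (rule continuous_on_subset[OF continuous_density[OF c(1)]]) (use Bsub in blast)
  have hp: "0 < ?h p" by (rule density_pos[OF c(1)]) (use Bsub B(2) in blast)
  define E where "E = B \<inter> ?h -` {?h p / 2<..}"
  have oE: "open E" unfolding E_def by (rule continuous_open_preimage[OF hc B(1) open_greaterThan])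
  have pE: "p \<in> E" using B(2) hp unfolding E_def by simp
  obtain e where e: "0 < e" "ball p e \<subseteq> E" using oE pE open_contains_ball by blast
  have oV: "open (fst c \<inter> U)" using open_chart[OF c(1)] U(1) by blast
  have "0 < ennreal (?h p / 2) * emeasure lborel (ball p e)"
  proof -
    have "emeasure lborel (ball p e) \<noteq> 0"
      using content_ball_pos[OF e(1), of p] by (metis measure_def enn2real_0 less_irrefl)
    then show ?thesis using hp by (simp add: ennreal_zero_less_mult_iff zero_less_iff_neq_zero)
  qed
  also have "\<dots> = (\<integral>\<^sup>+q. ennreal (?h p / 2) * indicator (ball p e) q \<partial>lborel)"
    by (rule nn_integral_cmult_indicator[symmetric]) simp
  also have "\<dots> \<le> (\<integral>\<^sup>+q\<in>snd c ` (fst c \<inter> U). ennreal (?h q) \<partial>lborel)"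
  proof (rule nn_integral_mono)
    fix q
    show "ennreal (?h p / 2) * indicator (ball p e) q \<le> ennreal (?h q) * indicator (snd c ` (fst c \<inter> U)) q"
    proof (cases "q \<in> ball p e")
      case True
      then have "q \<in> E" using e(2) by blast
      then have "q \<in> snd c ` (fst c \<inter> U)" "?h p / 2 \<le> ?h q" using Bsub unfolding E_def by auto
      then show ?thesis using True by (simp add: ennreal_leI)
    qed simp
  qed
  also have "\<dots> = emeasure m (fst c \<inter> U)"
    using oV by (intro volume_eq[OF m c(1), symmetric]) auto
  also have "\<dots> \<le> emeasure m U"
    using m U(1) unfolding riemannian_volume_def by (intro emeasure_mono) auto
  finally show ?thesis .
qed

end

section \<open>Existence, uniqueness and description of the globally stable set\<close>

theorem corollary3:
  fixes \<A> :: "('a::{t2_space, second_countable_topology}, 'n::finite) chart set"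
    and g :: "('a, 'n) chart \<Rightarrow> real ^ 'n \<Rightarrow> real ^ 'n ^ 'n"
    and m :: "'a measure"
    and ds :: "'a measure \<Rightarrow> 'a measure \<Rightarrow> real"
    and f :: "'a \<Rightarrow> 'a"
  assumes "compact_riemannian_manifold \<A> g"
    and "riemannian_volume \<A> g m"
    and "metrizes_weak_star ds"
    and "continuous_on UNIV f"
  shows "\<exists>K. globally_empirically_stochastically_stable \<A> g m f ds K \<and>
           (\<forall>K'. globally_empirically_stochastically_stable \<A> g m f ds K' \<longrightarrow> K' = K) \<and>
           (\<forall>\<mu>. \<mu> \<in> K \<longleftrightarrow> pseudo_physical m f ds \<mu>)"
proof -
  have comp: "compact (UNIV :: 'a set)" and atlas: "riemannian_atlas \<A> g"
    using assms(1) by (auto simp: compact_riemannian_manifold_def riemannian_atlas_def)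
  interpret riemannian_atlas \<A> g by (rule atlas)
  interpret metrized_noisy_dynamics \<A> g m f ds
  proof
    show "sets m = sets borel" using assms(2) unfolding riemannian_volume_def by blast
    show "emeasure m UNIV < \<infinity>" by (rule volume_finite[OF comp assms(2)])
  qed (rule comp volume_pos[OF assms(2)] open_riemannian_balls center_in_riemannian_ball
      riemannian_balls_uniformly_small[OF comp] assms(3) assms(4); assumption)+
  show ?thesis
    by (intro exI[of _ pseudo_physical_measures]) (simp add: globally_stable_iff)
qed

end
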